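(* Let $0<\alpha<1$, $\varepsilon>0$, and let $u$ be the solution of the time-fractional Allen-Cahn problem $$\partial_t^\alpha u=\varepsilon^2\Delta u-f(u),\quad \mathbf{x}\in\Omega=(a,b)\times(c,d),\ 0<t\le T,\qquad u(\mathbf{x},0)=u_0(\mathbf{x}),$$ with periodic boundary conditions and $f(u)=u^3-u$. Assume $\|u_0\|_{L^\infty(\Omega)}\le1$ and that for some $\sigma\in(0,1)$ and some constant $C_u>0$, $$\|u(t)\|_{W^{4,\infty}(\Omega)}\le C_u,\qquad \|\partial_t^{\ell}u(t)\|_{L^\infty(\Omega)}\le C_u(1+t^{\sigma-\ell})\quad\text{for }0<t\le T,\ \ell=1,2.$$ Let $u_h^n$ be a solution of the backward Euler scheme $$(\partial_f^\alpha u)^n=\varepsilon^2D_hu^n-f(u^n),\quad 1\le n\le N,\qquad u_h^0=u_0(\mathbf{x}_h),$$ on a time mesh $0=t_0<\dots<t_N=T$. If the maximum step size satisfies $\tau\le 1/\sqrt[\alpha]{6\Gamma(2-\alpha)}$, then the scheme is convergent in the maximum norm: for $1\le n\le N$, $$\|u(\mathbf{x}_h,t_n)-u_h^n\|_\infty\le C_u\Big(\frac{\tau_1^\sigma}{\sigma}+\frac1{1-\alpha}\max_{2\le k\le n}t_k^\alpha t_{k-1}^{\sigma-2}\tau_k^{2-\alpha}+\frac{\epsilon}{\sigma}t_n^\alpha\hat t_{n-1}^{\,2}+h_1^2+h_2^2\Big),$$ where $\hat t_n:=\max\{1,t_n\}$ and $\epsilon$ is the tolerance of the sum-of-exponentials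 approximation. Moreover, if the time mesh satisfies condition AssG with parameter $\gamma\ge1$ (see context), then for $1\le n\le N$, $$\|u(\mathbf{x}_h,t_n)-u_h^n\|_\infty\le\frac{C_u}{\sigma(1-\alpha)}\big(\tau^{\min\{2-\alpha,\gamma\sigma\}}+\epsilon\big)+C_u(h_1^2+h_2^2),$$ which achieves the optimal temporal accuracy $O(\tau^{2-\alpha})$ if $\gamma\ge\max\{1,(2-\alpha)/\sigma\}$.
   Context: $\partial_t^\alpha$ is the Caputo derivative of order $\alpha\in(0,1)$: $(\partial_t^\alpha v)(t)=\int_0^t\omega_{1-\alpha}(t-s)v'(s)\,ds$, with $\omega_\mu(t):=t^{\mu-1}/\Gamma(\mu)$. Constants: $C_u$ denotes a generic positive constant, not necessarily the same at each occurrence (in particular, not the same in the hypotheses and the conclusions). It may depend on the solution $u$ and its regularity bounds and on the fixed data $T,\Omega,\varepsilon,\alpha,\sigma$, on the maximum step ratio $\rho$, and on $\gamma,C_\gamma$ in the case of AssG, but not on the step sizes $\tau_k,h_1,h_2$, on $N$, $n$, or on $\epsilon$. A maximum over the empty set ($n=1$) is read as $0$. Time mesh: $0=t_0<t_1<\dots<t_N=T$, $\tau_k:=t_k-t_{k-1}$, $\tau:=\max_{1\le k\le N}\tau_k$, $\rho:=\max_k\tau_k/\tau_{k+1}$, and $\nabla_\tau v^k:=v^k-v^{k-1}$. Condition AssG: for a user-chosen parameter $\gamma\ge1$ there is a mesh-independent constant $C_\gamma>0$ such that $\tau_k\le C_\gamma\tau\min\{1,t_k^{1-1/\gamma}\}$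 for $1\le k\le N$ and $t_k\le C_\gamma t_{k-1}$ for $2\le k\le N$. Sum-of-exponentials (SOE) approximation: for the tolerance $\epsilon>0$ and the cut-off time $\Delta t>0$, with $\Delta t\le\min_k\tau_k$, there are fixed a positive integer $N_q$, positive nodes $\theta^\ell$ and positive weights $\varpi^\ell$ ($1\le\ell\le N_q$) with $\left|\omega_{1-\alpha}(t)-\sum_{\ell=1}^{N_q}\varpi^\ell e^{-\theta^\ell t}\right|\le\epsilon$ for all $t\in[\Delta t,T]$. Fast L1 formula: $(\partial_f^\alpha v)^n:=\sum_{k=1}^n A_{n-k}^{(n)}\nabla_\tau v^k$, $n\ge1$, where $$A_0^{(n)}:=a_0^{(n)},\qquad A_{n-k}^{(n)}:=\frac1{\tau_k}\int_{t_{k-1}}^{t_k}\sum_{\ell=1}^{N_q}\varpi^\ell e^{-\theta^\ell(t_n-s)}\,ds\quad(1\le k\le n-1),$$ $$a_{n-k}^{(n)}:=\frac1{\tau_k}\int_{t_{k-1}}^{t_k}\omega_{1-\alpha}(t_n-s)\,ds\quad(1\le k\le n).$$ Standing assumption: $\epsilon\le\min\{\tfrac13\omega_{1-\alpha}(T),\ \alpha\,\omega_{2-\alpha}(1)\}$, together with the resulting kernel properties (known from the literature and taken as given): (i) $A_{k-1}^{(n)}>A_k^{(n)}>0$ for $1\le k\le n-1$; (ii) $A_{n-k}^{(n)}\ge\frac23 a_{n-k}^{(n)}$ for $1\le k\le n-1$. The continuous problem obeys the (known) maximum principle: $|u(\mathbf{x},t)|\le1$ for $t>0$ if $|u(\mathbf{x},0)|\le1$.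 Spatial discretization: $M_1,M_2$ are positive integers ($\ge3$), $h_1=(b-a)/M_1$, $h_2=(d-c)/M_2$, $x_i=a+ih_1$, $y_j=c+jh_2$, $\mathbf{x}_h=(x_i,y_j)$. $\mathbb{V}_h$ is the space of real grid vectors $v=(v_{i,j})$, $0\le i\le M_1-1$, $0\le j\le M_2-1$ (extended periodically), ordered with $i$ running fastest; $u^n\in\mathbb{V}_h$ has entries $u_h^n$, and $f$ is applied componentwise. $\|v\|_\infty$ is the maximum of $|v_{i,j}|$ over the grid. $D_h=I_1\otimes D_1+D_2\otimes I_2$ is the periodic five-point discrete Laplacian, where $I_1,I_2$ are identity matrices of orders $M_2$ and $M_1$, and $D_1$ (order $M_1$), $D_2$ (order $M_2$) are $h_1^{-2}$, respectively $h_2^{-2}$, times the circulant matrix with $-2$ on the diagonal, $1$ on the two adjacent off-diagonals, and $1$ in the top-right and bottom-left corners. *)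

theory Defs
  imports "HOL-Analysis.Analysis" "HOL-Probability.Essential_Supremum"
begin

section \<open>Periodic functions and Sobolev norms on the rectangle\<close>

definition rect :: "real \<Rightarrow> real \<Rightarrow> real \<Rightarrow> real \<Rightarrow> (real \<times> real) set" where
  "rect a b c d = {a<..<b} \<times> {c<..<d}"

definition rect_periodic :: "real \<Rightarrow> real \<Rightarrow> real \<Rightarrow> real \<Rightarrow> (real \<times> real \<Rightarrow> real) \<Rightarrow> bool" where
  "rect_periodic a b c d v \<longleftrightarrow>
     (\<forall>x y. v (x + (b - a), y) = v (x, y) \<and> v (x, y + (d - c)) = v (x, y))"

text \<open>The value is \<open>\<infinity>\<close> if \<open>v\<close> is not measurable on \<open>S\<close>.\<close>

definition Linf_norm :: "(real \<times> real) set \<Rightarrow> (real \<times> real \<Rightarrow> real) \<Rightarrow> ereal" where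
  "Linf_norm S v = esssup (lebesgue_on S) (\<lambda>z. ereal \<bar>v z\<bar>)"

definition px :: "(real \<times> real \<Rightarrow> real) \<Rightarrow> real \<times> real \<Rightarrow> real" where
  "px v = (\<lambda>(x, y). deriv (\<lambda>s. v (s, y)) x)"

definition py :: "(real \<times> real \<Rightarrow> real) \<Rightarrow> real \<times> real \<Rightarrow> real" where
  "py v = (\<lambda>(x, y). deriv (\<lambda>s. v (x, s)) y)"

text \<open>\<open>C\<^sup>\<infinity>\<close>: every iterated partial derivative (in any order of the directions) exists
  and is totally differentiable everywhere.\<close>

definition smooth_fun :: "(real \<times> real \<Rightarrow> real) \<Rightarrow> bool" where
  "smooth_fun v \<longleftrightarrow>
     (\<forall>ds :: bool list. foldr (\<lambda>e. if e then px else py) ds v differentiable_on UNIV)"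

text \<open>Weak derivative \<open>\<partial>\<^sub>x\<^sup>i \<partial>\<^sub>y\<^sup>j v = g\<close> of a periodic function, i.e. a function on
  the torus: the test functions are the smooth periodic functions, so that \<open>g\<close> is also the
  derivative across the boundary of the rectangle.\<close>

definition has_weak_deriv ::
  "real \<Rightarrow> real \<Rightarrow> real \<Rightarrow> real \<Rightarrow> nat \<Rightarrow> nat \<Rightarrow> (real \<times> real \<Rightarrow> real) \<Rightarrow> (real \<times> real \<Rightarrow> real) \<Rightarrow> bool" where
  "has_weak_deriv a b c d i j v g \<longleftrightarrow>
     set_integrable lebesgue (rect a b c d) v \<and>
     set_integrable lebesgue (rect a b c d) g \<and>
     (\<forall>\<phi>. smooth_fun \<phi> \<and> rect_periodic a b c d \<phi> \<longrightarrow>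
        (LINT z:rect a b c d|lebesgue. v z * (px ^^ i) ((py ^^ j) \<phi>) z) =
        (-1) ^ (i + j) * (LINT z:rect a b c d|lebesgue. g z * \<phi> z))"

text \<open>Norm of the periodic space \<open>W\<^bsup>k,\<infinity>\<^esup>\<close>; it is \<open>\<infinity>\<close> (infimum of the empty set)
  if some weak derivative of order at most \<open>k\<close> does not exist. The infimum only removes the
  choice of the (almost everywhere unique) derivatives.\<close>

definition Winf_norm ::
  "real \<Rightarrow> real \<Rightarrow> real \<Rightarrow> real \<Rightarrow> nat \<Rightarrow> (real \<times> real \<Rightarrow> real) \<Rightarrow> ereal" where
  "Winf_norm a b c d k v =
     (INF g \<in> {g. \<forall>i j. i + j \<le> k \<longrightarrow> has_weak_deriv a b c d i j v (g i j)}.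
        SUP (i, j) \<in> {(i, j). i + j \<le> k}. Linf_norm (rect a b c d) (g i j))"

definition laplacian :: "(real \<times> real \<Rightarrow> real) \<Rightarrow> real \<times> real \<Rightarrow> real" where
  "laplacian v z = px (px v) z + py (py v) z"

definition twice_partially_differentiable_on ::
  "(real \<times> real) set \<Rightarrow> (real \<times> real \<Rightarrow> real) \<Rightarrow> bool" where
  "twice_partially_differentiable_on S v \<longleftrightarrow>
     (\<forall>(x, y) \<in> S.
        (\<lambda>s. v (s, y)) differentiable (at x) \<and> (\<lambda>s. px v (s, y)) differentiable (at x) \<and>
        (\<lambda>s. v (x, s)) differentiable (at y) \<and> (\<lambda>s. py v (x, s)) differentiable (at y))"

section \<open>The continuous problem\<close>

definition omega :: "real \<Rightarrow> real \<Rightarrow> real" where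
  "omega \<mu> t = t powr (\<mu> - 1) / Gamma \<mu>"

definition caputo :: "real \<Rightarrow> (real \<Rightarrow> real) \<Rightarrow> real \<Rightarrow> real" where
  "caputo \<alpha> v t = integral {0..t} (\<lambda>s. omega (1 - \<alpha>) (t - s) * deriv v s)"

definition AC_f :: "real \<Rightarrow> real" where
  "AC_f w = w ^ 3 - w"

text \<open>Functions subject to the periodic boundary conditions are represented by their periodic
  extensions to the plane; \<open>u z t\<close> is the value at the point \<open>z\<close> and the time \<open>t\<close>, and
  only the times \<open>0 \<le> t \<le> T\<close> matter.\<close>

definition allen_cahn_solution ::
  "real \<Rightarrow> real \<Rightarrow> real \<Rightarrow> real \<Rightarrow> real \<Rightarrow> real \<Rightarrow> real \<Rightarrow> (real \<times> real \<Rightarrow> real) \<Rightarrow>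
   (real \<times> real \<Rightarrow> real \<Rightarrow> real) \<Rightarrow> bool" where
  "allen_cahn_solution a b c d T \<alpha> \<epsilon> u0 u \<longleftrightarrow>
     (\<forall>t\<in>{0..T}. rect_periodic a b c d (\<lambda>z. u z t)) \<and>
     continuous_on (UNIV \<times> {0..T}) (\<lambda>(z, t). u z t) \<and>
     (\<forall>z. u z 0 = u0 z) \<and>
     (\<forall>z\<in>rect a b c d. \<forall>t\<in>{0<..<T}. u z differentiable (at t)) \<and>
     (\<forall>t\<in>{0<..T}. twice_partially_differentiable_on (rect a b c d) (\<lambda>z. u z t)) \<and>
     (\<forall>z\<in>rect a b c d. \<forall>t\<in>{0<..T}.
        caputo \<alpha> (u z) t = \<epsilon>\<^sup>2 * laplacian (\<lambda>z. u z t) z - AC_f (u z t))"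

text \<open>At \<open>t = T\<close> the time derivatives are one-sided.\<close>

definition solution_regularity ::
  "real \<Rightarrow> real \<Rightarrow> real \<Rightarrow> real \<Rightarrow> real \<Rightarrow> real \<Rightarrow> real \<Rightarrow> (real \<times> real \<Rightarrow> real \<Rightarrow> real) \<Rightarrow> bool" where
  "solution_regularity a b c d T \<sigma> C u \<longleftrightarrow>
     (\<forall>t\<in>{0<..T}. Winf_norm a b c d 4 (\<lambda>z. u z t) \<le> ereal C) \<and>
     (\<exists>u' u''.
        (\<forall>z\<in>rect a b c d. \<forall>t\<in>{0<..T}.
           (u z has_real_derivative u' z t) (at t within {0<..T}) \<and>
           (u' z has_real_derivative u'' z t) (at t within {0<..T})) \<and>
        (\<forall>t\<in>{0<..T}.
           Linf_norm (rect a b c d) (\<lambda>z. u' z t) \<le> ereal (C * (1 + t powr (\<sigma> - 1))) \<and>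
           Linf_norm (rect a b c d) (\<lambda>z. u'' z t) \<le> ereal (C * (1 + t powr (\<sigma> - 2)))))"

section \<open>Time meshes\<close>

definition time_mesh :: "real \<Rightarrow> nat \<Rightarrow> (nat \<Rightarrow> real) \<Rightarrow> bool" where
  "time_mesh T N t \<longleftrightarrow> N \<ge> 1 \<and> t 0 = 0 \<and> t N = T \<and> (\<forall>k\<in>{1..N}. t (k - 1) < t k)"

definition step :: "(nat \<Rightarrow> real) \<Rightarrow> nat \<Rightarrow> real" where
  "step t k = t k - t (k - 1)"

definition max_step :: "nat \<Rightarrow> (nat \<Rightarrow> real) \<Rightarrow> real" where
  "max_step N t = Max (step t ` {1..N})"

definition step_ratio_le :: "real \<Rightarrow> nat \<Rightarrow> (nat \<Rightarrow> real) \<Rightarrow> bool" where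
  "step_ratio_le \<rho> N t \<longleftrightarrow> (\<forall>k\<in>{1..<N}. step t k / step t (k + 1) \<le> \<rho>)"

definition AssG :: "real \<Rightarrow> real \<Rightarrow> nat \<Rightarrow> (nat \<Rightarrow> real) \<Rightarrow> bool" where
  "AssG \<gamma> C\<^sub>\<gamma> N t \<longleftrightarrow>
     (\<forall>k\<in>{1..N}. step t k \<le> C\<^sub>\<gamma> * max_step N t * min 1 (t k powr (1 - 1 / \<gamma>))) \<and>
     (\<forall>k\<in>{2..N}. t k \<le> C\<^sub>\<gamma> * t (k - 1))"

section \<open>The fast L1 formula\<close>

definition soe :: "nat \<Rightarrow> (nat \<Rightarrow> real) \<Rightarrow> (nat \<Rightarrow> real) \<Rightarrow> real \<Rightarrow> real" where
  "soe Nq \<theta> w t = (\<Sum>l=1..Nq. w l * exp (- \<theta> l * t))"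

definition soe_approximation ::
  "real \<Rightarrow> real \<Rightarrow> nat \<Rightarrow> (nat \<Rightarrow> real) \<Rightarrow> real \<Rightarrow> real \<Rightarrow> nat \<Rightarrow> (nat \<Rightarrow> real) \<Rightarrow> (nat \<Rightarrow> real) \<Rightarrow> bool" where
  "soe_approximation \<alpha> T N t tol \<Delta>t Nq \<theta> w \<longleftrightarrow>
     0 < tol \<and> 0 < \<Delta>t \<and> (\<forall>k\<in>{1..N}. \<Delta>t \<le> step t k) \<and>
     Nq \<ge> 1 \<and> (\<forall>l\<in>{1..Nq}. 0 < \<theta> l \<and> 0 < w l) \<and>
     (\<forall>s\<in>{\<Delta>t..T}. \<bar>omega (1 - \<alpha>) s - soe Nq \<theta> w s\<bar> \<le> tol)"

text \<open>\<open>L1_kernel \<alpha> t n m\<close> is \<open>a\<^sub>m\<^sup>(\<^sup>n\<^sup>)\<close> and \<open>fast_kernel \<alpha> t Nq \<theta> w n m\<close> is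
  \<open>A\<^sub>m\<^sup>(\<^sup>n\<^sup>)\<close>; the index \<open>m\<close> is \<open>n - k\<close>.\<close>

definition L1_kernel :: "real \<Rightarrow> (nat \<Rightarrow> real) \<Rightarrow> nat \<Rightarrow> nat \<Rightarrow> real" where
  "L1_kernel \<alpha> t n m = (let k = n - m in
     1 / step t k * integral {t (k - 1)..t k} (\<lambda>s. omega (1 - \<alpha>) (t n - s)))"

definition fast_kernel ::
  "real \<Rightarrow> (nat \<Rightarrow> real) \<Rightarrow> nat \<Rightarrow> (nat \<Rightarrow> real) \<Rightarrow> (nat \<Rightarrow> real) \<Rightarrow> nat \<Rightarrow> nat \<Rightarrow> real" where
  "fast_kernel \<alpha> t Nq \<theta> w n m =
     (if m = 0 then L1_kernel \<alpha> t n 0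
      else let k = n - m in
        1 / step t k * integral {t (k - 1)..t k} (\<lambda>s. soe Nq \<theta> w (t n - s)))"

definition fast_L1 ::
  "real \<Rightarrow> (nat \<Rightarrow> real) \<Rightarrow> nat \<Rightarrow> (nat \<Rightarrow> real) \<Rightarrow> (nat \<Rightarrow> real) \<Rightarrow> (nat \<Rightarrow> real) \<Rightarrow> nat \<Rightarrow> real" where
  "fast_L1 \<alpha> t Nq \<theta> w v n =
     (\<Sum>k=1..n. fast_kernel \<alpha> t Nq \<theta> w n (n - k) * (v k - v (k - 1)))"

section \<open>Spatial discretization\<close>

text \<open>A grid vector is a function \<open>v i j\<close>, of which only the entries with \<open>i < M1\<close> and
  \<open>j < M2\<close> matter.\<close>

definition grid_norm :: "nat \<Rightarrow> nat \<Rightarrow> (nat \<Rightarrow> nat \<Rightarrow> real) \<Rightarrow> real" where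
  "grid_norm M1 M2 v = Max ((\<lambda>(i, j). \<bar>v i j\<bar>) ` ({..<M1} \<times> {..<M2}))"

definition mesh_width :: "real \<Rightarrow> real \<Rightarrow> nat \<Rightarrow> real" where
  "mesh_width a b M = (b - a) / real M"

definition grid_point ::
  "real \<Rightarrow> real \<Rightarrow> real \<Rightarrow> real \<Rightarrow> nat \<Rightarrow> nat \<Rightarrow> nat \<Rightarrow> nat \<Rightarrow> real \<times> real" where
  "grid_point a b c d M1 M2 i j =
     (a + real i * mesh_width a b M1, c + real j * mesh_width c d M2)"

definition id_mat :: "nat \<Rightarrow> nat \<Rightarrow> real" where
  "id_mat i k = (if i = k then 1 else 0)"

definition circ_mat :: "nat \<Rightarrow> real \<Rightarrow> nat \<Rightarrow> nat \<Rightarrow> real" where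
  "circ_mat M h i k = 1 / h\<^sup>2 *
     (if i = k then -2
      else if k = i + 1 \<or> i = k + 1 \<or> (i = 0 \<and> k = M - 1) \<or> (i = M - 1 \<and> k = 0) then 1
      else 0)"

text \<open>As \<open>i\<close> runs fastest, the entry of the Kronecker product \<open>A \<otimes> B\<close> in the row of
  \<open>(i, j)\<close> and the column of \<open>(k, l)\<close> is \<open>A j l * B i k\<close>. The matrix below is
  \<open>I\<^sub>1 \<otimes> D\<^sub>1 + D\<^sub>2 \<otimes> I\<^sub>2\<close>.\<close>

definition discrete_laplacian ::
  "nat \<Rightarrow> nat \<Rightarrow> real \<Rightarrow> real \<Rightarrow> (nat \<Rightarrow> nat \<Rightarrow> real) \<Rightarrow> nat \<Rightarrow> nat \<Rightarrow> real" where
  "discrete_laplacian M1 M2 h1 h2 v i j =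
     (\<Sum>l<M2. \<Sum>k<M1. (id_mat j l * circ_mat M1 h1 i k + circ_mat M2 h2 j l * id_mat i k) * v k l)"

text \<open>\<open>U n i j\<close> is the numerical solution at the time level \<open>n\<close> and the grid point
  \<open>(x\<^sub>i, y\<^sub>j)\<close>.\<close>

definition backward_euler ::
  "real \<Rightarrow> real \<Rightarrow> real \<Rightarrow> real \<Rightarrow> real \<Rightarrow> real \<Rightarrow> (real \<times> real \<Rightarrow> real) \<Rightarrow>
   nat \<Rightarrow> (nat \<Rightarrow> real) \<Rightarrow> nat \<Rightarrow> (nat \<Rightarrow> real) \<Rightarrow> (nat \<Rightarrow> real) \<Rightarrow> nat \<Rightarrow> nat \<Rightarrow>
   (nat \<Rightarrow> nat \<Rightarrow> nat \<Rightarrow> real) \<Rightarrow> bool" where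
  "backward_euler a b c d \<alpha> \<epsilon> u0 N t Nq \<theta> w M1 M2 U \<longleftrightarrow>
     (\<forall>i<M1. \<forall>j<M2.
        U 0 i j = u0 (grid_point a b c d M1 M2 i j) \<and>
        (\<forall>n\<in>{1..N}.
           fast_L1 \<alpha> t Nq \<theta> w (\<lambda>k. U k i j) n =
             \<epsilon>\<^sup>2 * discrete_laplacian M1 M2 (mesh_width a b M1) (mesh_width c d M2) (U n) i j
             - AC_f (U n i j)))"

definition discrete_setting ::
  "real \<Rightarrow> real \<Rightarrow> real \<Rightarrow> real \<Rightarrow> real \<Rightarrow> real \<Rightarrow> real \<Rightarrow> (real \<times> real \<Rightarrow> real) \<Rightarrow> real \<Rightarrow>
   nat \<Rightarrow> (nat \<Rightarrow> real) \<Rightarrow> real \<Rightarrow> real \<Rightarrow> nat \<Rightarrow> (nat \<Rightarrow> real) \<Rightarrow> (nat \<Rightarrow> real) \<Rightarrow> nat \<Rightarrow> nat \<Rightarrow>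
   (nat \<Rightarrow> nat \<Rightarrow> nat \<Rightarrow> real) \<Rightarrow> bool" where
  "discrete_setting a b c d T \<alpha> \<epsilon> u0 \<rho> N t tol \<Delta>t Nq \<theta> w M1 M2 U \<longleftrightarrow>
     time_mesh T N t \<and> step_ratio_le \<rho> N t \<and>
     soe_approximation \<alpha> T N t tol \<Delta>t Nq \<theta> w \<and>
     tol \<le> min (1 / 3 * omega (1 - \<alpha>) T) (\<alpha> * omega (2 - \<alpha>) 1) \<and>
     max_step N t \<le> 1 / (6 * Gamma (2 - \<alpha>)) powr (1 / \<alpha>) \<and>
     M1 \<ge> 3 \<and> M2 \<ge> 3 \<and>
     backward_euler a b c d \<alpha> \<epsilon> u0 N t Nq \<theta> w M1 M2 U"

definition max_error ::
  "real \<Rightarrow> real \<Rightarrow> real \<Rightarrow> real \<Rightarrow> (real \<times> real \<Rightarrow> real \<Rightarrow> real) \<Rightarrow> (nat \<Rightarrow> real) \<Rightarrow> nat \<Rightarrow> nat \<Rightarrow>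
   (nat \<Rightarrow> nat \<Rightarrow> nat \<Rightarrow> real) \<Rightarrow> nat \<Rightarrow> real" where
  "max_error a b c d u t M1 M2 U n =
     grid_norm M1 M2 (\<lambda>i j. u (grid_point a b c d M1 M2 i j) (t n) - U n i j)"

text \<open>The number \<open>0\<close> is inserted to cover the empty maximum for \<open>n = 1\<close>; all other
  terms are nonnegative.\<close>

definition mesh_term :: "real \<Rightarrow> real \<Rightarrow> (nat \<Rightarrow> real) \<Rightarrow> nat \<Rightarrow> real" where
  "mesh_term \<alpha> \<sigma> t n =
     Max (insert 0 ((\<lambda>k. t k powr \<alpha> * t (k - 1) powr (\<sigma> - 2) * step t k powr (2 - \<alpha>)) ` {2..n}))"

end

theory Submission
  imports Defs
begin

text \<open>
The proof is a comparison argument for the maximum norm of the error. At a grid point where the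
modulus of the error is largest, the discrete Laplacian and the cubic part of the nonlinearity
have the favourable sign, and the weights of the fast L1 formula decrease; hence the norms
\<open>E n\<close> of the errors satisfy the scalar inequality \<open>discrete_caputo A E n \<le> E n + R n\<close>, where \<open>R n\<close>
bounds the residual of the exact solution (\<open>error_inequality\<close>).

This inequality is resolved by explicit supersolutions (\<open>discrete_stability\<close>). The error of the L1
formula is a sum of interpolation errors \<open>G k\<close> over all steps, weighted by differences of the
kernel; summation by parts identifies it with a multiple of \<open>A n 0 * G n\<close> minus a multiple of
the discrete derivative of \<open>G\<close>, so that the memory is absorbed by passing from \<open>E\<close> to
\<open>E + 2 G\<close>. The remaining term \<open>A n 0 * G n\<close> is at most a constant times the smallest weight of the
kernel, which is the discrete derivative of a jump function; this is where the maximum of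
\<open>t k powr \<alpha> * t (k - 1) powr (\<sigma> - 2) * step t k powr (2 - \<alpha>)\<close> arises. A constant load is compared
with a combination of \<open>exp (\<mu> t) - 1\<close> and \<open>t powr \<alpha>\<close> (\<open>barrier_exists\<close>), a discrete substitute for
the Mittag-Leffler function. It vanishes like \<open>t powr \<alpha>\<close> at the initial time, whence this
factor in the contribution of the tolerance. The bound on the step ratio enters through the
exponential part: it prevents a long step from hiding the growth of the exponential.

The residual has a temporal and a spatial part. In time, integration by parts on every step
(\<open>kernel_integral_by_parts\<close>) reduces the consistency error to the interpolation errors times the
variation of the kernel, and convexity of the kernel bounds the variation by the differences
of its mean values (\<open>fast_L1_consistency\<close>). The time derivatives are bounded at each time for almost
every point only; Fubini's theorem yields bounds at almost every point for almost every time
(\<open>AE_weakly_singular_function\<close>). In space, the second differences at two step sizes are compared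
through Taylor's formula for periodic mollifications of the solution, whose fourth derivatives
inherit the bound on the weak ones; one of the step sizes then tends to zero
(\<open>second_diff_error\<close>). The bound for the residual thus holds at almost every point of the
rectangle, and the residual is continuous, so it holds at the grid points, including
those on the boundary (\<open>residual_bound\<close>).
\<close>

section \<open>Discrete convolutions with decreasing kernels\<close>

definition discrete_caputo :: "(nat \<Rightarrow> nat \<Rightarrow> real) \<Rightarrow> (nat \<Rightarrow> real) \<Rightarrow> nat \<Rightarrow> real" where
  "discrete_caputo A v n = (\<Sum>k=1..n. A n (n - k) * (v k - v (k - 1)))"

lemma fast_L1_eq_discrete_caputo:
  "fast_L1 \<alpha> t Nq \<theta> w v n = discrete_caputo (fast_kernel \<alpha> t Nq \<theta> w) v n"
  by (simp add: fast_L1_def discrete_caputo_def)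

lemma discrete_caputo_add:
  "discrete_caputo A (\<lambda>k. v k + w k) n = discrete_caputo A v n + discrete_caputo A w n"
  by (simp add: discrete_caputo_def algebra_simps sum.distrib sum_subtractf)

lemma discrete_caputo_mult:
  "discrete_caputo A (\<lambda>k. c * v k) n = c * discrete_caputo A v n"
  by (simp add: discrete_caputo_def sum_distrib_left algebra_simps)

lemma discrete_caputo_diff:
  "discrete_caputo A (\<lambda>k. v k - w k) n = discrete_caputo A v n - discrete_caputo A w n"
  using discrete_caputo_add[of A v "\<lambda>k. (-1) * w k" n] discrete_caputo_mult[of A "-1" w n] by simp

lemma discrete_caputo_by_parts:
  assumes "1 \<le> n"
  shows "discrete_caputo A v n =
    A n 0 * v n - (\<Sum>k=1..<n. (A n (n - k - 1) - A n (n - k)) * v k) - A n (n - 1) * v 0"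
proof -
  have "(\<Sum>k=1..m. A n (n - k) * (v k - v (k - 1))) =
      A n (n - m) * v m - (\<Sum>k=1..<m. (A n (n - k - 1) - A n (n - k)) * v k) - A n (n - 1) * v 0"
    if "1 \<le> m" "m \<le> n" for m
    using that
  proof (induction m rule: dec_induct)
    case base
    then show ?case by (simp add: algebra_simps)
  next
    case (step m)
    have "n - m - 1 = n - Suc m" by simp
    with step show ?case by (simp add: algebra_simps)
  qed
  from this[of n] assms show ?thesis by (simp add: discrete_caputo_def)
qed

lemma discrete_caputo_step_function:
  assumes "1 \<le> n"
  shows "discrete_caputo A (\<lambda>k. if k = 0 then 0 else 1) n = A n (n - 1)"
proof -
  have "discrete_caputo A (\<lambda>k. if k = 0 then 0 else 1) n
      = (\<Sum>k=1..n. if k = 1 then A n (n - 1) else 0)"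
    unfolding discrete_caputo_def by (rule sum.cong) auto
  also have "\<dots> = A n (n - 1)" using assms by (subst sum.delta) auto
  finally show ?thesis .
qed

locale decreasing_kernel =
  fixes A :: "nat \<Rightarrow> nat \<Rightarrow> real" and N :: nat
  assumes kernel_pos: "\<lbrakk>n \<in> {1..N}; k < n\<rbrakk> \<Longrightarrow> 0 < A n k"
    and kernel_step: "\<lbrakk>n \<in> {1..N}; 1 \<le> k; k < n\<rbrakk> \<Longrightarrow> A n k \<le> A n (k - 1)"
    and kernel_diag: "n \<in> {1..N} \<Longrightarrow> 6 \<le> A n 0"
begin

lemma kernel_antimono:
  assumes "n \<in> {1..N}" "j \<le> k" "k < n"
  shows "A n k \<le> A n j"
  using assms(2,3)
proof (induction k rule: dec_induct)
  case (step k)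
  then show ?case using kernel_step[OF assms(1), of "Suc k"] by simp
qed simp

text \<open>After summation by parts, the kernel being decreasing, all earlier values carry nonpositive
  coefficients. This sign structure is behind all comparison arguments for the scheme.\<close>

lemma discrete_caputo_ge_diag:
  assumes "n \<in> {1..N}" "\<And>k. k < n \<Longrightarrow> w k \<le> 0"
  shows "A n 0 * w n \<le> discrete_caputo A w n"
proof -
  have "(\<Sum>k=1..<n. (A n (n - k - 1) - A n (n - k)) * w k) \<le> 0"
  proof (rule sum_nonpos)
    fix k assume k: "k \<in> {1..<n}"
    then have "A n (n - k) \<le> A n (n - k - 1)" by (intro kernel_step[OF assms(1)]) auto
    then show "(A n (n - k - 1) - A n (n - k)) * w k \<le> 0"
      using assms(2)[of k] k by (simp add: mult_nonneg_nonpos)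
  qed
  moreover have "A n (n - 1) * w 0 \<le> 0"
    using assms kernel_pos[OF assms(1), of "n - 1"] by (simp add: mult_nonneg_nonpos)
  ultimately show ?thesis using assms(1) by (simp add: discrete_caputo_by_parts)
qed

text \<open>At a point where the modulus of a grid function is maximal, the discrete derivative of the
  maximum norm is at most that of the signed value: this turns the error equation of a single
  grid point into a scalar inequality for the norms.\<close>

lemma discrete_caputo_norm_le:
  assumes "n \<in> {1..N}" "\<bar>s\<bar> = 1" "s * v n = E n" "\<And>k. k < n \<Longrightarrow> \<bar>v k\<bar> \<le> E k"
  shows "discrete_caputo A E n \<le> s * discrete_caputo A v n"
proof -
  have "s * v k - E k \<le> 0" if "k < n" for k
  proof -
    have "s * v k \<le> \<bar>s * v k\<bar>" by simp
    also have "\<dots> = \<bar>v k\<bar>" using assms(2) by (simp add: abs_mult)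
    finally show ?thesis using assms(4)[OF that] by simp
  qed
  then have "A n 0 * (s * v n - E n) \<le> discrete_caputo A (\<lambda>k. s * v k - E k) n"
    by (intro discrete_caputo_ge_diag[OF assms(1), of "\<lambda>k. s * v k - E k"])
  then show ?thesis using assms(3) by (simp add: discrete_caputo_diff discrete_caputo_mult)
qed

text \<open>The zeroth-order term on the right is dominated by the diagonal weight.\<close>

lemma discrete_comparison:
  assumes "w 0 \<le> 0" "m \<le> N"
    and "\<And>n. n \<in> {1..m} \<Longrightarrow> discrete_caputo A w n \<le> w n"
  shows "n \<le> m \<Longrightarrow> w n \<le> 0"
proof (induction n rule: less_induct)
  case (less n)
  show ?case
  proof (cases "n = 0")
    case False
    then have n: "n \<in> {1..N}" "n \<in> {1..m}" using less.prems assms(2) by auto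
    have "A n 0 * w n \<le> discrete_caputo A w n"
      using less.IH less.prems by (intro discrete_caputo_ge_diag[OF n(1)]) auto
    also have "\<dots> \<le> w n" using assms(3)[OF n(2)] .
    finally have "(A n 0 - 1) * w n \<le> 0" by (simp add: algebra_simps)
    then show ?thesis using kernel_diag[OF n(1)] by (smt (verit) mult_pos_pos)
  qed (use assms in simp)
qed

text \<open>For a nondecreasing sequence the increments before the node \<open>m\<close> may be dropped and the
  remaining weights replaced by the smallest one.\<close>

lemma discrete_caputo_ge_window:
  assumes "n \<in> {1..N}" "m < n" "\<And>k. k \<in> {1..n} \<Longrightarrow> v (k - 1) \<le> v k"
  shows "A n (n - m - 1) * (v n - v m) \<le> discrete_caputo A v n"
proof -
  have tel: "(\<Sum>k=Suc m..n. v k - v (k - 1)) = v n - v m"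
    using sum_telescope''[of m n v] assms(2) by simp
  have "A n (n - m - 1) * (v n - v m) = (\<Sum>k=Suc m..n. A n (n - m - 1) * (v k - v (k - 1)))"
    by (simp add: sum_distrib_left flip: tel)
  also have "\<dots> \<le> (\<Sum>k=Suc m..n. A n (n - k) * (v k - v (k - 1)))"
  proof (rule sum_mono)
    fix k assume k: "k \<in> {Suc m..n}"
    have "A n (n - m - 1) \<le> A n (n - k)"
      using k assms(2) by (intro kernel_antimono[OF assms(1)]) auto
    then show "A n (n - m - 1) * (v k - v (k - 1)) \<le> A n (n - k) * (v k - v (k - 1))"
      using assms(3)[of k] k by (intro mult_right_mono) auto
  qed
  also have "\<dots> \<le> (\<Sum>k=1..n. A n (n - k) * (v k - v (k - 1)))"
  proof (rule sum_mono2)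
    fix k assume k: "k \<in> {1..n} - {Suc m..n}"
    then have "0 < A n (n - k)" by (intro kernel_pos[OF assms(1)]) auto
    then show "0 \<le> A n (n - k) * (v k - v (k - 1))" using assms(3)[of k] k by auto
  qed auto
  finally show ?thesis by (simp add: discrete_caputo_def)
qed

end

section \<open>A barrier function and stability\<close>

lemma time_mesh_less:
  assumes "time_mesh T N t" "i < j" "j \<le> N"
  shows "t i < t j"
  using assms(2,3)
proof (induction j)
  case (Suc j)
  have "Suc j \<in> {1..N}" using Suc.prems by auto
  then have "t (Suc j - 1) < t (Suc j)" using assms(1) unfolding time_mesh_def by blast
  then show ?case using Suc by (cases "i = j") auto
qed simp

lemma time_mesh_le:
  assumes "time_mesh T N t" "i \<le> j" "j \<le> N"
  shows "t i \<le> t j"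
  using time_mesh_less[OF assms(1), of i j] assms by (cases "i = j") auto

lemma time_mesh_nonneg:
  assumes "time_mesh T N t" "j \<le> N"
  shows "0 \<le> t j"
  using time_mesh_le[OF assms(1), of 0 j] assms by (simp add: time_mesh_def)

lemma time_mesh_pos:
  assumes "time_mesh T N t" "1 \<le> j" "j \<le> N"
  shows "0 < t j"
  using time_mesh_less[OF assms(1), of 0 j] assms by (simp add: time_mesh_def)

lemma time_mesh_le_T:
  assumes "time_mesh T N t" "j \<le> N"
  shows "t j \<le> T"
  using time_mesh_le[OF assms(1), of j N] assms by (simp add: time_mesh_def)

lemma omega_one_minus: "omega (1 - \<alpha>) s = s powr (- \<alpha>) / Gamma (1 - \<alpha>)"
  by (simp add: omega_def)

lemma omega_antimono:
  assumes "0 < \<alpha>" "\<alpha> < 1" "0 < r" "r \<le> s"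
  shows "omega (1 - \<alpha>) s \<le> omega (1 - \<alpha>) r"
  using assms by (auto simp: omega_one_minus Gamma_real_pos intro!: divide_right_mono powr_mono2')

text \<open>Apart from the sign structure, the barrier only needs that the kernel is bounded below by a
  multiple of the singular kernel.\<close>

locale caputo_kernel = decreasing_kernel A N
  for A :: "nat \<Rightarrow> nat \<Rightarrow> real" and N :: nat +
  fixes \<alpha> T \<rho> :: real and t :: "nat \<Rightarrow> real"
  assumes alpha: "0 < \<alpha>" "\<alpha> < 1"
    and mesh: "time_mesh T N t"
    and ratio: "step_ratio_le \<rho> N t"
    and kernel_ge: "\<lbrakk>n \<in> {1..N}; 1 \<le> k; k \<le> n\<rbrakk> \<Longrightarrow>
      2 / 3 * omega (1 - \<alpha>) (t n - t (k - 1)) \<le> A n (n - k)"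
begin

lemma kernel_last_ge:
  assumes "n \<in> {1..N}"
  shows "2 / 3 * (t n powr (- \<alpha>) / Gamma (1 - \<alpha>)) \<le> A n (n - 1)"
  using kernel_ge[OF assms, of 1] assms mesh by (simp add: time_mesh_def omega_one_minus)

text \<open>The kernel is at least \<open>4\<close> on a window of length \<open>\<delta>\<close> before the current node, and the
  exponential at least doubles over the part of length \<open>\<delta>' = \<delta> / (\<bar>\<rho>\<bar> + 2)\<close> of this window. The
  increments inside the window therefore suffice if its first node is at distance at least \<open>\<delta>'\<close>
  from the current one. Otherwise a step longer than \<open>\<delta> - \<delta>'\<close> crosses the left end of the
  window. If it is the last step, the large diagonal weight suffices; if not, the step after it
  is shorter than \<open>\<delta>'\<close>, against the bound on the step ratio.\<close>

lemma discrete_caputo_exp_ge: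
  fixes \<delta> \<mu> :: real
  defines "\<delta> \<equiv> (6 * Gamma (1 - \<alpha>)) powr (- 1 / \<alpha>)"
  defines "\<mu> \<equiv> (\<bar>\<rho>\<bar> + 2) * ln 2 / \<delta>"
  assumes n: "n \<in> {1..N}"
  shows "2 * (exp (\<mu> * t n) - 1) \<le> discrete_caputo A (\<lambda>k. exp (\<mu> * t k)) n"
proof -
  define \<delta>' where "\<delta>' = \<delta> / (\<bar>\<rho>\<bar> + 2)"
  define B where "B k = exp (\<mu> * t k)" for k
  have G: "0 < Gamma (1 - \<alpha>)" using alpha by (intro Gamma_real_pos) auto
  have \<delta>: "0 < \<delta>" using G by (simp add: \<delta>_def)
  have \<mu>: "0 < \<mu>" unfolding \<mu>_def using \<delta> by (intro divide_pos_pos mult_pos_pos) auto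
  have \<delta>'_pos: "0 < \<delta>'" unfolding \<delta>'_def using \<delta> by (intro divide_pos_pos) auto
  have \<delta>'_le: "\<delta>' \<le> \<delta>" unfolding \<delta>'_def using \<delta> by (simp add: field_simps)
  have split: "\<delta> = (\<bar>\<rho>\<bar> + 2) * \<delta>'" by (simp add: \<delta>'_def add_nonneg_eq_0_iff)
  have \<mu>\<delta>': "\<mu> * \<delta>' = ln 2" using \<delta> by (simp add: \<mu>_def \<delta>'_def)
  have omega_\<delta>: "omega (1 - \<alpha>) \<delta> = 6"
    using G alpha less_imp_neq[OF G] by (simp add: omega_one_minus \<delta>_def powr_powr)
  have nN: "n \<le> N" "1 \<le> n" using n by auto
  have B_mono: "B i \<le> B j" if "i \<le> j" "j \<le> n" for i j
    using time_mesh_le[OF mesh that(1)] that nN \<mu> by (simp add: B_def)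
  have B1: "1 \<le> B n" using B_mono[of 0 n] mesh by (simp add: B_def time_mesh_def)
  have half: "2 * B k \<le> B n" if "t k \<le> t n - \<delta>'" for k
  proof -
    have "B k \<le> exp (\<mu> * (t n - \<delta>'))" using that \<mu> by (simp add: B_def)
    also have "\<dots> = B n / 2" by (simp add: B_def right_diff_distrib \<mu>\<delta>' exp_diff)
    finally show ?thesis by simp
  qed
  have window: "A n (n - m - 1) * (B n - B m) \<le> discrete_caputo A B n" if "m < n" for m
    using that B_mono by (intro discrete_caputo_ge_window[OF n]) auto
  (* the first node inside the window *)
  define m where "m = (LEAST k. t n - \<delta> \<le> t k)"
  have tm: "t n - \<delta> \<le> t m" unfolding m_def by (rule LeastI[of _ n]) (use \<delta> in simp)
  have m_le: "m \<le> n" unfolding m_def by (rule Least_le) (use \<delta> in simp)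
  have before: "t k < t n - \<delta>" if "k < m" for k
    using not_less_Least[of k "\<lambda>k. t n - \<delta> \<le> t k"] that unfolding m_def by auto
  have "2 * (B n - 1) \<le> discrete_caputo A B n"
  proof (cases "m = n")
    case True
    then have "2 * B (n - 1) \<le> B n" using before[of "n - 1"] nN \<delta>'_le by (intro half) auto
    moreover have "6 * (B n - B (n - 1)) \<le> A n 0 * (B n - B (n - 1))"
      using kernel_diag[OF n] B_mono[of "n - 1" n] by (intro mult_right_mono) auto
    ultimately show ?thesis using window[of "n - 1"] nN B1 by simp
  next
    case False
    then have m: "m < n" using m_le by simp
    have pos: "0 < t n - t m" using time_mesh_less[OF mesh m nN(1)] by simp
    have "4 = 2 / 3 * omega (1 - \<alpha>) \<delta>" by (simp add: omega_\<delta>)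
    also have "\<dots> \<le> 2 / 3 * omega (1 - \<alpha>) (t n - t m)"
      using omega_antimono[OF alpha pos, of \<delta>] tm by simp
    also have "\<dots> \<le> A n (n - m - 1)" using kernel_ge[OF n, of "Suc m"] m by simp
    finally have "4 * (B n - B m) \<le> A n (n - m - 1) * (B n - B m)"
      using B_mono[of m n] m by (intro mult_right_mono) auto
    then have 4: "4 * (B n - B m) \<le> discrete_caputo A B n" using window[OF m] by simp
    show ?thesis
    proof (cases "m = 0")
      case True
      then have "B m = 1" using mesh by (simp add: B_def time_mesh_def)
      then show ?thesis using 4 B1 by simp
    next
      case m0: False
      have "t m \<le> t n - \<delta>'"
      proof (rule ccontr)
        assume "\<not> t m \<le> t n - \<delta>'"
        then have small: "step t (m + 1) < \<delta>'"
          using time_mesh_le[OF mesh, of "m + 1" n] m nN by (simp add: step_def)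
        have big: "(\<bar>\<rho>\<bar> + 1) * \<delta>' < step t m" using before[of "m - 1"] m0 \<open>\<not> t m \<le> t n - \<delta>'\<close> split
          by (simp add: step_def algebra_simps)
        have sp: "0 < step t (m + 1)"
          using time_mesh_less[OF mesh, of m "m + 1"] m nN by (simp add: step_def)
        have "step t m / step t (m + 1) \<le> \<bar>\<rho>\<bar>" using ratio m m0 nN unfolding step_ratio_le_def
          by (metis abs_ge_self atLeastLessThan_iff less_le_trans less_one not_le order_trans)
        then have "step t m \<le> \<bar>\<rho>\<bar> * step t (m + 1)" using sp by (simp add: field_simps)
        also have "\<dots> \<le> \<bar>\<rho>\<bar> * \<delta>'" using small by (intro mult_left_mono) auto
        finally show False using big \<delta>'_pos by (simp add: algebra_simps)
      qed
      then have "2 * B m \<le> B n" by (rule half)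
      then show ?thesis using 4 by simp
    qed
  qed
  then show ?thesis by (simp add: B_def[abs_def])
qed

text \<open>Replacing all weights by the smallest one loses only a constant factor here, because that weight
  is of the order \<open>t n powr (- \<alpha>)\<close>.\<close>

lemma discrete_caputo_powr_ge:
  assumes n: "n \<in> {1..N}"
  shows "2 / (3 * Gamma (1 - \<alpha>)) \<le> discrete_caputo A (\<lambda>k. t k powr \<alpha>) n"
proof -
  have tn: "0 < t n" using time_mesh_pos[OF mesh] n by auto
  have "A n (n - 0 - 1) * (t n powr \<alpha> - t 0 powr \<alpha>) \<le> discrete_caputo A (\<lambda>k. t k powr \<alpha>) n"
  proof (rule discrete_caputo_ge_window[OF n])
    fix k assume "k \<in> {1..n}"
    then show "t (k - 1) powr \<alpha> \<le> t k powr \<alpha>"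
      using time_mesh_le[OF mesh, of "k - 1" k] time_mesh_nonneg[OF mesh, of "k - 1"] n alpha
      by (intro powr_mono2) auto
  qed (use n in auto)
  moreover have "t 0 = 0" using mesh by (simp add: time_mesh_def)
  moreover have "2 / 3 * (t n powr (- \<alpha>) / Gamma (1 - \<alpha>)) * t n powr \<alpha>
      \<le> A n (n - 1) * t n powr \<alpha>"
    using kernel_last_ge[OF n] by (intro mult_right_mono) auto
  moreover have "2 / 3 * (t n powr (- \<alpha>) / Gamma (1 - \<alpha>)) * t n powr \<alpha> = 2 / (3 * Gamma (1 - \<alpha>))"
    using tn by (simp add: powr_minus)
  ultimately show ?thesis by (simp only: powr_0 diff_0_right diff_zero)
qed

end

text \<open>The barrier is a multiple of \<open>exp (\<mu> t) - 1\<close>, which absorbs the zeroth-order term away from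
  the initial time, plus a multiple of \<open>t powr \<alpha>\<close>, which produces the constant load and dominates
  for small times. Its constants do not depend on the mesh, and it vanishes like \<open>t powr \<alpha>\<close> at
  the initial time.\<close>

lemma barrier_exists:
  fixes \<alpha> T \<rho> :: real
  assumes alpha: "0 < \<alpha>" "\<alpha> < 1" and T: "0 < T"
  shows "\<exists>C>0. \<forall>A N t. caputo_kernel A N \<alpha> T \<rho> t \<longrightarrow>
    (\<exists>S. S 0 = 0 \<and> (\<forall>n\<in>{1..N}. S n + 1 \<le> discrete_caputo A S n \<and> S n \<le> C * t n powr \<alpha>))"
proof -
  define \<delta> where "\<delta> = (6 * Gamma (1 - \<alpha>)) powr (- 1 / \<alpha>)"
  define \<mu> where "\<mu> = (\<bar>\<rho>\<bar> + 2) * ln 2 / \<delta>"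
  (* K makes the discrete derivative of the power at least 2. The power part is at most 1 up to
     the time t0, and from there on L makes the exponential part exceed it. *)
  define K where "K = 3 * Gamma (1 - \<alpha>)"
  define t0 where "t0 = K powr (- 1 / \<alpha>)"
  define L where "L = K * T powr \<alpha> / (exp (\<mu> * t0) - 1)"
  define C where "C = L * (\<mu> * exp (\<mu> * T) * T powr (1 - \<alpha>)) + K"
  have G: "0 < Gamma (1 - \<alpha>)" using alpha by (intro Gamma_real_pos) auto
  have \<delta>: "0 < \<delta>" using G by (simp add: \<delta>_def)
  have \<mu>: "0 < \<mu>" unfolding \<mu>_def using \<delta> by (intro divide_pos_pos mult_pos_pos) auto
  have K: "0 < K" using G by (simp add: K_def)
  have t0: "0 < t0" using K by (simp add: t0_def)
  have e0: "0 < exp (\<mu> * t0) - 1" using \<mu> t0 by simp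
  have L: "0 < L" unfolding L_def using K T e0 by (intro divide_pos_pos mult_pos_pos) auto
  have C: "0 < C" unfolding C_def using L K \<mu> by (intro add_nonneg_pos mult_nonneg_nonneg) auto
  have "\<exists>S. S 0 = 0 \<and> (\<forall>n\<in>{1..N}. S n + 1 \<le> discrete_caputo A S n \<and> S n \<le> C * t n powr \<alpha>)"
    if "caputo_kernel A N \<alpha> T \<rho> t" for A N t
  proof -
    interpret caputo_kernel A N \<alpha> T \<rho> t by fact
    define S where "S k = L * (exp (\<mu> * t k) - 1) + K * t k powr \<alpha>" for k
    have "S 0 = 0" using mesh by (simp add: S_def time_mesh_def)
    moreover have "S n + 1 \<le> discrete_caputo A S n \<and> S n \<le> C * t n powr \<alpha>" if n: "n \<in> {1..N}" for n
    proof
      have tn: "0 < t n" "t n \<le> T" using time_mesh_pos[OF mesh] time_mesh_le_T[OF mesh] n by auto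
      have one: "discrete_caputo A (\<lambda>k. 1) n = 0" by (simp add: discrete_caputo_def)
      have "discrete_caputo A S n
          = L * discrete_caputo A (\<lambda>k. exp (\<mu> * t k)) n + K * discrete_caputo A (\<lambda>k. t k powr \<alpha>) n"
        by (simp add: S_def[abs_def] discrete_caputo_add discrete_caputo_mult discrete_caputo_diff one)
      moreover have "L * (2 * (exp (\<mu> * t n) - 1)) \<le> L * discrete_caputo A (\<lambda>k. exp (\<mu> * t k)) n"
        using discrete_caputo_exp_ge[OF n] L unfolding \<mu>_def \<delta>_def by (intro mult_left_mono) auto
      moreover have "2 \<le> K * discrete_caputo A (\<lambda>k. t k powr \<alpha>) n"
      proof -
        have "K * (2 / (3 * Gamma (1 - \<alpha>))) \<le> K * discrete_caputo A (\<lambda>k. t k powr \<alpha>) n"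
          using discrete_caputo_powr_ge[OF n] K by (intro mult_left_mono) auto
        then show ?thesis using G by (simp add: K_def)
      qed
      moreover have "K * t n powr \<alpha> \<le> 1 + L * (exp (\<mu> * t n) - 1)"
      proof (cases "t n \<le> t0")
        case True
        have "K * t n powr \<alpha> \<le> K * t0 powr \<alpha>"
          using True tn alpha K by (intro mult_left_mono powr_mono2) auto
        also have "t0 powr \<alpha> = K powr (-1)" unfolding t0_def powr_powr using alpha by simp
        also have "K * K powr (-1) = 1" using K by (simp add: powr_minus_divide)
        finally show ?thesis using L \<mu> tn by (simp add: add_increasing2)
      next
        case False
        have "K * t n powr \<alpha> \<le> K * T powr \<alpha>"
          using tn alpha K by (intro mult_left_mono powr_mono2) auto
        also have "\<dots> = L * (exp (\<mu> * t0) - 1)" using e0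
          by (metis L_def less_irrefl nonzero_eq_divide_eq)
        also have "\<dots> \<le> L * (exp (\<mu> * t n) - 1)" using False L \<mu> by (intro mult_left_mono) auto
        finally show ?thesis by simp
      qed
      ultimately show "S n + 1 \<le> discrete_caputo A S n" by (simp add: S_def algebra_simps)
      have "exp (\<mu> * t n) - 1 \<le> \<mu> * t n * exp (\<mu> * t n)" using exp_ge_add_one_self[of "- (\<mu> * t n)"]
          mult_right_mono[of "1 - \<mu> * t n" "exp (- (\<mu> * t n))" "exp (\<mu> * t n)"]
        by (simp add: algebra_simps flip: exp_add)
      also have "\<dots> \<le> \<mu> * (T powr (1 - \<alpha>) * t n powr \<alpha>) * exp (\<mu> * T)"
      proof -
        have "t n = t n powr (1 - \<alpha>) * t n powr \<alpha>" using tn by (simp flip: powr_add)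
        also have "\<dots> \<le> T powr (1 - \<alpha>) * t n powr \<alpha>"
          using tn alpha by (intro mult_right_mono powr_mono2) auto
        finally show ?thesis using \<mu> tn by (intro mult_mono) auto
      qed
      finally have "L * (exp (\<mu> * t n) - 1) \<le> L * (\<mu> * (T powr (1 - \<alpha>) * t n powr \<alpha>) * exp (\<mu> * T))"
        using L by (intro mult_left_mono) auto
      then show "S n \<le> C * t n powr \<alpha>" by (simp add: S_def C_def algebra_simps)
    qed
    ultimately show ?thesis by blast
  qed
  then show ?thesis using C by blast
qed

text \<open>The load consists of the consistency error, whose part with the interpolation errors \<open>G\<close> is
  written through the discrete derivative of \<open>G\<close> itself. Adding \<open>2 G\<close> to the error \<open>E\<close> therefore
  removes the memory terms. What is left on the right, \<open>3 A n 0 * G n\<close>, is bounded by a multiple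
  of \<open>A n (n - 1)\<close>, the discrete derivative of the function that jumps from \<open>0\<close> to \<open>1\<close> after the
  initial time; subtracting this jump function leaves a constant load, for which a multiple
  of the barrier is a supersolution.\<close>

lemma discrete_stability:
  fixes \<alpha> T \<rho> :: real
  assumes alpha: "0 < \<alpha>" "\<alpha> < 1" and T: "0 < T"
  shows "\<exists>C>0. \<forall>A N t E G K Q m. caputo_kernel A N \<alpha> T \<rho> t \<and> m \<in> {1..N} \<and>
      E 0 = 0 \<and> G 0 = 0 \<and> 0 \<le> K \<and> 0 \<le> Q \<and>
      (\<forall>n\<in>{1..m}. 0 \<le> G n \<and> A n 0 * G n \<le> Q * A n (n - 1) \<and>
         discrete_caputo A E n \<le> E n + 3 * A n 0 * G n - 2 * discrete_caputo A G n + K) \<longrightarrow>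
      E m \<le> C * (Q + K * t m powr \<alpha>)"
proof -
  obtain C where C: "0 < C" and barrier: "\<And>A N t. caputo_kernel A N \<alpha> T \<rho> t \<Longrightarrow>
    \<exists>S. S 0 = 0 \<and> (\<forall>n\<in>{1..N}. S n + 1 \<le> discrete_caputo A S n \<and> S n \<le> C * t n powr \<alpha>)"
    using barrier_exists[OF assms] by blast
  define D where "D = 3 + 3 * C * T powr \<alpha> + C"
  have D: "0 < D" using C by (simp add: D_def add_pos_pos add_pos_nonneg)
  have bound: "E m \<le> D * (Q + K * t m powr \<alpha>)"
    if ker: "caputo_kernel A N \<alpha> T \<rho> t" and m: "m \<in> {1..N}" and E0: "E 0 = 0" and G0: "G 0 = 0"
      and K: "0 \<le> K" and Q: "0 \<le> Q"
      and load: "\<And>n. n \<in> {1..m} \<Longrightarrow> 0 \<le> G n \<and> A n 0 * G n \<le> Q * A n (n - 1) \<and>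
         discrete_caputo A E n \<le> E n + 3 * A n 0 * G n - 2 * discrete_caputo A G n + K"
    for A N t and E G :: "nat \<Rightarrow> real" and K Q m
  proof -
    interpret caputo_kernel A N \<alpha> T \<rho> t by fact
    obtain S where S0: "S 0 = 0"
      and S: "\<And>n. n \<in> {1..N} \<Longrightarrow> S n + 1 \<le> discrete_caputo A S n \<and> S n \<le> C * t n powr \<alpha>"
      using barrier[OF ker] by blast
    define J :: "nat \<Rightarrow> real" where "J k = (if k = 0 then 0 else 1)" for k
    define w where "w k = E k + 2 * G k - 3 * Q * J k - (3 * Q + K) * S k" for k
    have "w m \<le> 0"
    proof (rule discrete_comparison[of w m])
      fix n assume n: "n \<in> {1..m}"
      then have nN: "n \<in> {1..N}" "1 \<le> n" using m by auto
      have "discrete_caputo A w n = discrete_caputo A E n + 2 * discrete_caputo A G n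
          - 3 * Q * discrete_caputo A J n - (3 * Q + K) * discrete_caputo A S n"
        by (simp add: w_def[abs_def] discrete_caputo_add discrete_caputo_mult discrete_caputo_diff)
      moreover have "discrete_caputo A J n = A n (n - 1)"
        using discrete_caputo_step_function[OF nN(2)] by (simp add: J_def[abs_def])
      moreover have "(3 * Q + K) * (S n + 1) \<le> (3 * Q + K) * discrete_caputo A S n"
        using S[OF nN(1)] Q K by (intro mult_left_mono) auto
      moreover have "J n = 1" using nN by (simp add: J_def)
      ultimately show "discrete_caputo A w n \<le> w n"
        using load[OF n] by (simp add: w_def algebra_simps)
    qed (use m E0 G0 S0 in \<open>auto simp: w_def J_def\<close>)
    moreover have "J m = 1" "0 \<le> G m" using m load[of m] by (auto simp: J_def)
    ultimately have "E m \<le> 3 * Q + (3 * Q + K) * S m" by (simp add: w_def)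
    also have "\<dots> \<le> 3 * Q + (3 * Q + K) * (C * t m powr \<alpha>)"
      using S[OF m] Q K by (intro add_left_mono mult_left_mono) auto
    also have "\<dots> = 3 * Q + 3 * C * Q * t m powr \<alpha> + C * (K * t m powr \<alpha>)" by (simp add: algebra_simps)
    also have "\<dots> \<le> 3 * Q + 3 * C * Q * T powr \<alpha> + C * (K * t m powr \<alpha>)"
      using time_mesh_le_T[OF mesh, of m] time_mesh_nonneg[OF mesh, of m] m C Q alpha
      by (intro add_right_mono add_left_mono mult_left_mono powr_mono2) auto
    also have "\<dots> \<le> D * Q + D * (K * t m powr \<alpha>)"
    proof (rule add_mono)
      show "3 * Q + 3 * C * Q * T powr \<alpha> \<le> D * Q" using C Q by (simp add: D_def algebra_simps)
      show "C * (K * t m powr \<alpha>) \<le> D * (K * t m powr \<alpha>)"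
        using C K by (intro mult_right_mono) (auto simp: D_def)
    qed
    finally show ?thesis by (simp add: algebra_simps)
  qed
  show ?thesis
    apply (intro exI[of _ D] conjI allI impI D)
    subgoal for A N t E G K Q m
      by (elim conjE, rule bound[where E = E and G = G and Q = Q and K = K]) auto
    done
qed

section \<open>The kernel of the fast L1 formula\<close>

lemma Gamma_two_minus:
  fixes \<alpha> :: real
  assumes "\<alpha> < 1"
  shows "Gamma (2 - \<alpha>) = (1 - \<alpha>) * Gamma (1 - \<alpha>)"
  using Gamma_plus1[of "1 - \<alpha>"] assms by (simp add: add.commute nonpos_Ints_def)

text \<open>The point \<open>2\<close>, where the logarithm of the Gamma function vanishes, lies between
  \<open>2 - \<alpha>\<close> and \<open>3\<close>, so convexity of that logarithm gives a lower bound.\<close>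

lemma Gamma_two_minus_ge:
  fixes \<alpha> :: real
  assumes "0 < \<alpha>" "\<alpha> < 1"
  shows "1 / 2 \<le> Gamma (2 - \<alpha>)"
proof -
  have G3: "Gamma (3 :: real) = 2" using Gamma_fact[of 2, where 'a = real] by (simp add: eval_nat_numeral)
  have G2: "Gamma (2 :: real) = 1" using Gamma_fact[of 1, where 'a = real] by simp
  have pos: "0 < Gamma (2 - \<alpha>)" using assms by (intro Gamma_real_pos) auto
  have comb: "(1 - \<alpha> / (1 + \<alpha>)) *\<^sub>R (2 - \<alpha>) + (\<alpha> / (1 + \<alpha>)) *\<^sub>R 3 = 2"
    using assms by (simp add: divide_simps)
  have "(ln \<circ> Gamma) ((1 - \<alpha> / (1 + \<alpha>)) *\<^sub>R (2 - \<alpha>) + (\<alpha> / (1 + \<alpha>)) *\<^sub>R 3)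
      \<le> (1 - \<alpha> / (1 + \<alpha>)) * (ln \<circ> Gamma) (2 - \<alpha>) + (\<alpha> / (1 + \<alpha>)) * (ln \<circ> Gamma) 3"
    using assms by (intro convex_onD[OF log_convex_Gamma_real]) (auto simp: field_simps)
  then have "0 \<le> (1 - \<alpha> / (1 + \<alpha>)) * ln (Gamma (2 - \<alpha>)) + (\<alpha> / (1 + \<alpha>)) * ln 2"
    unfolding comb by (simp add: G2 G3)
  also have "\<dots> = (ln (Gamma (2 - \<alpha>)) + \<alpha> * ln 2) / (1 + \<alpha>)"
  proof -
    have "1 - \<alpha> / (1 + \<alpha>) = 1 / (1 + \<alpha>)" using assms by (simp add: field_simps)
    then show ?thesis by (simp add: add_divide_distrib)
  qed
  finally have "0 \<le> ln (Gamma (2 - \<alpha>)) + \<alpha> * ln 2" using assms by (simp add: zero_le_divide_iff)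
  moreover have "\<alpha> * ln 2 \<le> ln (2 :: real)" using assms by simp
  ultimately have "- ln 2 \<le> ln (Gamma (2 - \<alpha>))" by linarith
  then have "ln (1 / 2) \<le> ln (Gamma (2 - \<alpha>))" by (simp add: ln_div)
  then show ?thesis using pos by (subst (asm) ln_le_cancel_iff) auto
qed

lemma omega_has_integral:
  assumes alpha: "0 < \<alpha>" "\<alpha> < 1" and "p \<le> q" "q \<le> r"
  shows "((\<lambda>s. omega (1 - \<alpha>) (r - s)) has_integral
    (omega (2 - \<alpha>) (r - p) - omega (2 - \<alpha>) (r - q))) {p..q}"
proof -
  have G: "0 < Gamma (1 - \<alpha>)" "0 < Gamma (2 - \<alpha>)" using alpha by (auto intro!: Gamma_real_pos)
  have om: "omega (2 - \<alpha>) x = x powr (1 - \<alpha>) / Gamma (2 - \<alpha>)" for x by (simp add: omega_def)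
  have "((\<lambda>s. omega (1 - \<alpha>) (r - s)) has_integral
      (- omega (2 - \<alpha>) (r - q) - (- omega (2 - \<alpha>) (r - p)))) {p..q}"
  proof (rule fundamental_theorem_of_calculus_interior)
    show "continuous_on {p..q} (\<lambda>s. - omega (2 - \<alpha>) (r - s))"
      unfolding om using assms G less_imp_neq[OF G(2)]
      by (intro continuous_on_minus continuous_on_divide continuous_on_powr' continuous_intros) auto
    fix s assume s: "s \<in> {p<..<q}"
    have "((\<lambda>s. - ((r - s) powr (1 - \<alpha>) / Gamma (2 - \<alpha>))) has_real_derivative
        (1 - \<alpha>) * (r - s) powr (- \<alpha>) / Gamma (2 - \<alpha>)) (at s)"
      using s assms less_imp_neq[OF G(2)] by (auto intro!: derivative_eq_intros)
    moreover have "(1 - \<alpha>) * (r - s) powr (- \<alpha>) / Gamma (2 - \<alpha>) = omega (1 - \<alpha>) (r - s)"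
      using alpha by (simp add: omega_one_minus Gamma_two_minus)
    ultimately show "((\<lambda>s. - omega (2 - \<alpha>) (r - s)) has_vector_derivative omega (1 - \<alpha>) (r - s)) (at s)"
      by (simp add: om[abs_def] has_real_derivative_iff_has_vector_derivative)
  qed (use assms in auto)
  then show ?thesis by simp
qed

lemma L1_kernel_diag:
  assumes "0 < \<alpha>" "\<alpha> < 1" "t (n - 1) < t n"
  shows "L1_kernel \<alpha> t n 0 = step t n powr (- \<alpha>) / Gamma (2 - \<alpha>)"
proof -
  have "0 < step t n" using assms by (simp add: step_def)
  moreover have "integral {t (n - 1)..t n} (\<lambda>s. omega (1 - \<alpha>) (t n - s)) = omega (2 - \<alpha>) (step t n)"
    using integral_unique[OF omega_has_integral[OF assms(1,2), of "t (n - 1)" "t n" "t n"]] assms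
    by (simp only: step_def) (simp add: omega_def)
  ultimately show ?thesis by (simp add: L1_kernel_def omega_def powr_diff powr_minus_divide)
qed

lemma average_le:
  fixes f :: "real \<Rightarrow> real"
  assumes "p < q" "f integrable_on {p..q}" "\<And>s. s \<in> {p..q} \<Longrightarrow> f s \<le> B"
  shows "1 / (q - p) * integral {p..q} f \<le> B"
proof -
  have "integral {p..q} f \<le> integral {p..q} (\<lambda>_. B)" using assms by (intro integral_le) auto
  then show ?thesis using assms by (simp add: field_simps)
qed

lemma average_ge:
  fixes f :: "real \<Rightarrow> real"
  assumes "p < q" "f integrable_on {p..q}" "\<And>s. s \<in> {p..q} \<Longrightarrow> B \<le> f s"
  shows "B \<le> 1 / (q - p) * integral {p..q} f"
proof -
  have "integral {p..q} (\<lambda>_. B) \<le> integral {p..q} f" using assms by (intro integral_le) auto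
  then show ?thesis using assms by (simp add: field_simps)
qed

lemma soe_integrable: "(\<lambda>s. soe Nq \<theta> w (r - s)) integrable_on {p..q}"
  unfolding soe_def by (intro integrable_continuous_real continuous_intros)

locale fast_L1_mesh =
  fixes \<alpha> T \<rho> tol \<Delta>t :: real and N Nq :: nat and t \<theta> w :: "nat \<Rightarrow> real"
  assumes alpha: "0 < \<alpha>" "\<alpha> < 1"
    and mesh: "time_mesh T N t"
    and ratio: "step_ratio_le \<rho> N t"
    and soe: "soe_approximation \<alpha> T N t tol \<Delta>t Nq \<theta> w"
    and tol_le: "tol \<le> min (1 / 3 * omega (1 - \<alpha>) T) (\<alpha> * omega (2 - \<alpha>) 1)"
    and max_step_le: "max_step N t \<le> 1 / (6 * Gamma (2 - \<alpha>)) powr (1 / \<alpha>)"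
begin

abbreviation A :: "nat \<Rightarrow> nat \<Rightarrow> real" where "A \<equiv> fast_kernel \<alpha> t Nq \<theta> w"

lemma tol_pos: "0 < tol"
  using soe by (simp add: soe_approximation_def)

lemma G1: "0 < Gamma (1 - \<alpha>)" and G2: "0 < Gamma (2 - \<alpha>)"
  using alpha by (auto intro!: Gamma_real_pos)

lemma t_0: "t 0 = 0"
  using mesh by (simp add: time_mesh_def)

lemma step_pos: "n \<in> {1..N} \<Longrightarrow> 0 < step t n"
  using time_mesh_less[OF mesh, of "n - 1" n] by (auto simp: step_def)

lemma step_le_max_step: "n \<in> {1..N} \<Longrightarrow> step t n \<le> max_step N t"
  unfolding max_step_def by (intro Max_ge) auto

text \<open>The tolerance is compared with \<open>\<alpha> * omega (2 - \<alpha>) 1\<close>, so it matters that the steps do not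
  exceed \<open>1\<close>.\<close>

lemma max_step_le_1: "max_step N t \<le> 1"
proof -
  have "1 powr (1 / \<alpha>) \<le> (6 * Gamma (2 - \<alpha>)) powr (1 / \<alpha>)"
    using alpha Gamma_two_minus_ge[OF alpha] by (intro powr_mono2) auto
  then have "1 / (6 * Gamma (2 - \<alpha>)) powr (1 / \<alpha>) \<le> 1" by (simp add: divide_le_eq_1)
  with max_step_le show ?thesis by simp
qed

lemma kernel_0: "n \<in> {1..N} \<Longrightarrow> A n 0 = step t n powr (- \<alpha>) / Gamma (2 - \<alpha>)"
  using L1_kernel_diag[OF alpha, of t n] step_pos[of n] by (simp add: fast_kernel_def step_def)

lemma kernel_0_ge: 
  assumes n: "n \<in> {1..N}"
  shows "6 \<le> A n 0"
proof -
  have G: "0 < 6 * Gamma (2 - \<alpha>)" using G2 by simp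
  have "step t n \<le> (6 * Gamma (2 - \<alpha>)) powr (- (1 / \<alpha>))"
    using step_le_max_step[OF n] max_step_le by (simp add: powr_minus_divide)
  then have "((6 * Gamma (2 - \<alpha>)) powr (- (1 / \<alpha>))) powr (- \<alpha>) \<le> step t n powr (- \<alpha>)"
    using step_pos[OF n] alpha by (intro powr_mono2') auto
  moreover have "((6 * Gamma (2 - \<alpha>)) powr (- (1 / \<alpha>))) powr (- \<alpha>) = (6 * Gamma (2 - \<alpha>)) powr 1"
    unfolding powr_powr using alpha by simp
  ultimately have "6 * Gamma (2 - \<alpha>) \<le> step t n powr (- \<alpha>)" using G by simp
  then show ?thesis using G2 by (simp add: kernel_0[OF n] field_simps)
qed

lemma kernel_history:
  "\<lbrakk>1 \<le> k; k < n\<rbrakk> \<Longrightarrow>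
    A n (n - k) = 1 / (t k - t (k - 1)) * integral {t (k - 1)..t k} (\<lambda>s. soe Nq \<theta> w (t n - s))"
  by (simp add: fast_kernel_def step_def)

lemma soe_pos: "0 < soe Nq \<theta> w s"
  using soe unfolding soe_def soe_approximation_def by (intro sum_pos) auto

lemma soe_antimono: "r \<le> s \<Longrightarrow> soe Nq \<theta> w s \<le> soe Nq \<theta> w r"
  using soe unfolding soe_def soe_approximation_def
  by (intro sum_mono mult_left_mono) (auto intro: less_imp_le)

lemma soe_error:
  assumes "n \<in> {1..N}" "s \<le> t (n - 1)" "0 \<le> s"
  shows "\<bar>omega (1 - \<alpha>) (t n - s) - soe Nq \<theta> w (t n - s)\<bar> \<le> tol"
proof -
  have "\<Delta>t \<le> step t n" using soe assms by (simp add: soe_approximation_def)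
  then have "t n - s \<in> {\<Delta>t..T}" using assms time_mesh_le_T[OF mesh, of n] by (auto simp: step_def)
  then show ?thesis using soe by (simp add: soe_approximation_def)
qed

lemma kernel_history_le:
  assumes "n \<in> {1..N}" "1 \<le> k" "k < n"
  shows "A n (n - k) \<le> soe Nq \<theta> w (t n - t k)"
  unfolding kernel_history[OF assms(2,3)] using time_mesh_less[OF mesh, of "k - 1" k] assms
  by (intro average_le soe_integrable soe_antimono) auto

lemma kernel_history_ge:
  assumes "n \<in> {1..N}" "1 \<le> k" "k < n"
  shows "soe Nq \<theta> w (t n - t (k - 1)) \<le> A n (n - k)"
  unfolding kernel_history[OF assms(2,3)] using time_mesh_less[OF mesh, of "k - 1" k] assms
  by (intro average_ge soe_integrable soe_antimono) auto

lemma omega_le_omega_diag: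
  assumes n: "n \<in> {1..N}"
  shows "omega (1 - \<alpha>) (step t n) + \<alpha> * (step t n powr (- \<alpha>) / Gamma (2 - \<alpha>)) = A n 0"
proof -
  have "x / g + \<alpha> * (x / ((1 - \<alpha>) * g)) = x / ((1 - \<alpha>) * g)" if "0 < g" for x g :: real
    using that alpha by (simp add: divide_simps) (simp add: algebra_simps)
  from this[OF G1] show ?thesis using alpha by (simp add: kernel_0[OF n] omega_one_minus Gamma_two_minus)
qed

text \<open>The exponentials decrease, so the history part of the kernel is monotone. Only the first
  comparison involves both kernels; there the diagonal weight, the mean of the singular kernel
  over the last step, exceeds the value of that kernel at the distance of one step by at least the
  tolerance, since the step is at most \<open>1\<close>.\<close>

sublocale caputo_kernel A N \<alpha> T \<rho> t
proof
  show "6 \<le> A n 0" if "n \<in> {1..N}" for n using kernel_0_ge[OF that] .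
  show "0 < A n k" if n: "n \<in> {1..N}" and k: "k < n" for n k
  proof (cases "k = 0")
    case False
    have "0 < soe Nq \<theta> w (t n - t (n - k - 1))" by (rule soe_pos)
    also have "\<dots> \<le> A n (n - (n - k))" using n k False by (intro kernel_history_ge) auto
    finally show ?thesis using k by simp
  qed (use kernel_0_ge[OF n] in simp)
  show "A n k \<le> A n (k - 1)" if n: "n \<in> {1..N}" and k: "1 \<le> k" "k < n" for n k
  proof -
    have "A n (n - (n - k)) \<le> soe Nq \<theta> w (t n - t (n - k))"
      using k by (intro kernel_history_le[OF n]) auto
    then have le: "A n k \<le> soe Nq \<theta> w (t n - t (n - k))" using k by simp
    show ?thesis
    proof (cases "k = 1")
      case True
      have s1: "step t n powr (- 0) \<le> step t n powr (- \<alpha>)"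
        using step_pos[OF n] step_le_max_step[OF n] max_step_le_1 alpha by (intro powr_mono') auto
      have "\<alpha> * omega (2 - \<alpha>) 1 = \<alpha> * (1 / Gamma (2 - \<alpha>))" by (simp add: omega_def)
      also have "\<dots> \<le> \<alpha> * (step t n powr (- \<alpha>) / Gamma (2 - \<alpha>))"
        using s1 alpha G2 step_pos[OF n] by (intro mult_left_mono divide_right_mono) auto
      finally have "tol \<le> \<alpha> * (step t n powr (- \<alpha>) / Gamma (2 - \<alpha>))" using tol_le by simp
      moreover have "\<bar>omega (1 - \<alpha>) (t n - t (n - 1)) - soe Nq \<theta> w (t n - t (n - 1))\<bar> \<le> tol"
        using time_mesh_nonneg[OF mesh, of "n - 1"] n by (intro soe_error) auto
      ultimately show ?thesis using le True omega_le_omega_diag[OF n] by (simp add: step_def)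
    next
      case False
      have eq: "n - (n - k + 1) = k - 1" using k by simp
      have "soe Nq \<theta> w (t n - t (n - k + 1 - 1)) \<le> A n (n - (n - k + 1))"
        using k False by (intro kernel_history_ge[OF n]) auto
      then show ?thesis using le unfolding eq by simp
    qed
  qed
  show "2 / 3 * omega (1 - \<alpha>) (t n - t (k - 1)) \<le> A n (n - k)"
    if n: "n \<in> {1..N}" and k: "1 \<le> k" "k \<le> n" for n k
  proof (cases "k = n")
    case True
    have "0 \<le> omega (1 - \<alpha>) (step t n)" using G1 by (simp add: omega_one_minus)
    moreover have "0 \<le> \<alpha> * (step t n powr (- \<alpha>) / Gamma (2 - \<alpha>))" using G2 alpha by simp
    ultimately show ?thesis using omega_le_omega_diag[OF n] True by (simp add: step_def)
  next
    case False
    have pos: "0 < t n - t (k - 1)" using time_mesh_less[OF mesh, of "k - 1" n] n k by auto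
    have "0 \<le> t (k - 1)" by (rule time_mesh_nonneg[OF mesh]) (use n k in auto)
    then have le: "t n - t (k - 1) \<le> T" using time_mesh_le_T[OF mesh, of n] n by auto
    have "tol \<le> 1 / 3 * omega (1 - \<alpha>) T" using tol_le by simp
    also have "\<dots> \<le> 1 / 3 * omega (1 - \<alpha>) (t n - t (k - 1))"
      using omega_antimono[OF alpha pos le] by simp
    finally have "tol \<le> 1 / 3 * omega (1 - \<alpha>) (t n - t (k - 1))" .
    moreover have "\<bar>omega (1 - \<alpha>) (t n - t (k - 1)) - soe Nq \<theta> w (t n - t (k - 1))\<bar> \<le> tol"
      using time_mesh_nonneg[OF mesh, of "k - 1"] time_mesh_le[OF mesh, of "k - 1" "n - 1"] n k False
      by (intro soe_error) auto
    moreover have "soe Nq \<theta> w (t n - t (k - 1)) \<le> A n (n - k)"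
      using k False by (intro kernel_history_ge[OF n]) auto
    ultimately show ?thesis by simp
  qed
qed (use alpha mesh ratio in auto)

lemma kernel_L1_error:
  assumes n: "n \<in> {1..N}" and k: "1 \<le> k" "k \<le> n"
  shows "\<bar>L1_kernel \<alpha> t n (n - k) - A n (n - k)\<bar> \<le> (if k = n then 0 else tol)"
proof (cases "k = n")
  case True
  then show ?thesis by (simp add: fast_kernel_def)
next
  case False
  define I where "I = {t (k - 1)..t k}"
  have lt: "t (k - 1) < t k" using time_mesh_less[OF mesh, of "k - 1" k] n k by auto
  have tk: "t k \<le> t (n - 1)" using time_mesh_le[OF mesh, of k "n - 1"] n k False by auto
  have tn: "t (n - 1) \<le> t n" using time_mesh_le[OF mesh, of "n - 1" n] n by auto
  have io: "(\<lambda>s. omega (1 - \<alpha>) (t n - s)) integrable_on I"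
    unfolding I_def using omega_has_integral[OF alpha, of "t (k - 1)" "t k" "t n"] lt tk tn
    by (auto simp: integrable_on_def)
  have iso: "(\<lambda>s. soe Nq \<theta> w (t n - s)) integrable_on I" unfolding I_def by (rule soe_integrable)
  have "0 \<le> t (k - 1)" by (rule time_mesh_nonneg[OF mesh]) (use n k in auto)
  then have err: "\<bar>omega (1 - \<alpha>) (t n - s) - soe Nq \<theta> w (t n - s)\<bar> \<le> tol" if "s \<in> I" for s
    using that tk n by (intro soe_error) (auto simp: I_def)
  have "L1_kernel \<alpha> t n (n - k) - A n (n - k)
      = 1 / (t k - t (k - 1)) * integral I (\<lambda>s. omega (1 - \<alpha>) (t n - s) - soe Nq \<theta> w (t n - s))"
    using k False io iso unfolding I_def
    by (simp add: kernel_history L1_kernel_def step_def integral_diff diff_divide_distrib)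
  moreover have "1 / (t k - t (k - 1)) * integral I (\<lambda>s. omega (1 - \<alpha>) (t n - s) - soe Nq \<theta> w (t n - s)) \<le> tol"
    unfolding I_def using err io iso lt
    by (intro average_le integrable_diff) (auto simp: I_def abs_le_iff)
  moreover have "- tol \<le> 1 / (t k - t (k - 1)) * integral I (\<lambda>s. omega (1 - \<alpha>) (t n - s) - soe Nq \<theta> w (t n - s))"
    unfolding I_def using err io iso lt
    by (intro average_ge integrable_diff) (fastforce simp: I_def abs_le_iff)+
  ultimately show ?thesis using False unfolding abs_le_iff by simp
qed

end

section \<open>Interpolation of weakly singular functions\<close>

text \<open>A primitive of \<open>1 + s powr (\<sigma> - 1)\<close>, the admissible growth of the first derivative.\<close>

definition sing_primitive :: "real \<Rightarrow> real \<Rightarrow> real" where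
  "sing_primitive \<sigma> s = s + s powr \<sigma> / \<sigma>"

definition interp_error :: "(real \<Rightarrow> real) \<Rightarrow> real \<Rightarrow> real \<Rightarrow> real \<Rightarrow> real" where
  "interp_error v p q s = v s - v p - (s - p) / (q - p) * (v q - v p)"

text \<open>A bound for the interpolation error on the step from \<open>p\<close> to \<open>q\<close>. The first argument of the
  minimum uses the first derivative only; its sum over all steps telescopes. The second one has the
  full order but is useless at the initial time, where the second derivative is not
  integrable.\<close>

definition interp_bound :: "real \<Rightarrow> real \<Rightarrow> real \<Rightarrow> real \<Rightarrow> real" where
  "interp_bound C \<sigma> p q =
    (if p = 0 then 2 * C * (sing_primitive \<sigma> q - sing_primitive \<sigma> p)
     else min (2 * C * (sing_primitive \<sigma> q - sing_primitive \<sigma> p)) (C * (1 + p powr (\<sigma> - 2)) * (q - p)\<^sup>2))"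

lemma sing_primitive_deriv:
  assumes "0 < \<sigma>" "0 < s"
  shows "(sing_primitive \<sigma> has_real_derivative (1 + s powr (\<sigma> - 1))) (at s)"
  unfolding sing_primitive_def[abs_def] using assms by (auto intro!: derivative_eq_intros)

lemma sing_primitive_continuous: "0 < \<sigma> \<Longrightarrow> continuous_on {0..} (sing_primitive \<sigma>)"
  unfolding sing_primitive_def[abs_def]
  by (intro continuous_on_add continuous_on_divide continuous_on_powr' continuous_intros) auto

lemma sing_primitive_mono:
  assumes "0 < \<sigma>" "0 \<le> r" "r \<le> s"
  shows "sing_primitive \<sigma> r \<le> sing_primitive \<sigma> s"
  unfolding sing_primitive_def using assms by (intro add_mono divide_right_mono powr_mono2) auto

text \<open>The slopes of a concave function decrease.\<close>

lemma sing_primitive_concave: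
  assumes \<sigma>: "0 < \<sigma>" "\<sigma> < 1" and "0 \<le> p" "p < q" "p \<le> s" "s \<le> q"
  shows "sing_primitive \<sigma> q - sing_primitive \<sigma> s
    \<le> (sing_primitive \<sigma> q - sing_primitive \<sigma> p) / (q - p) * (q - s)"
proof -
  define P where "P = sing_primitive \<sigma>"
  have cont: "continuous_on {x..y} P" if "0 \<le> x" for x y
    unfolding P_def using that by (intro continuous_on_subset[OF sing_primitive_continuous[OF \<sigma>(1)]]) auto
  have mvt: "\<exists>z. x < z \<and> z < y \<and> P y - P x = (y - x) * (1 + z powr (\<sigma> - 1))" if "0 \<le> x" "x < y" for x y
  proof -
    have "(P has_real_derivative (1 + z powr (\<sigma> - 1))) (at z)" if "x < z" for z
      using sing_primitive_deriv[OF \<sigma>(1), of z] that \<open>0 \<le> x\<close> by (simp add: P_def)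
    then have "\<exists>l z. x < z \<and> z < y \<and> DERIV P z :> l \<and> P y - P x = (y - x) * l"
      using that cont by (intro MVT) (auto simp: real_differentiable_def)
    then obtain l z where "x < z" "z < y" "DERIV P z :> l" "P y - P x = (y - x) * l" by blast
    moreover have "l = 1 + z powr (\<sigma> - 1)"
      using DERIV_unique[OF \<open>DERIV P z :> l\<close>] \<open>x < z\<close> sing_primitive_deriv[OF \<sigma>(1), of z] that
      by (simp add: P_def)
    ultimately show ?thesis by blast
  qed
  have "(P q - P s) * (q - p) \<le> (P q - P p) * (q - s)"
  proof (cases "p = s \<or> s = q")
    case False
    then obtain y z where y: "p < y" "y < s" "P s - P p = (s - p) * (1 + y powr (\<sigma> - 1))"
      and z: "s < z" "z < q" "P q - P s = (q - s) * (1 + z powr (\<sigma> - 1))"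
      using mvt[of p s] mvt[of s q] assms by auto
    have "z powr (\<sigma> - 1) \<le> y powr (\<sigma> - 1)" using y z assms by (intro powr_mono2') auto
    then have "(P q - P s) * (s - p) \<le> (q - s) * (1 + y powr (\<sigma> - 1)) * (s - p)"
      unfolding z(3) using assms by (intro mult_right_mono mult_left_mono) auto
    then have "(P q - P s) * (s - p) \<le> (q - s) * (P s - P p)" by (simp add: y(3) mult_ac)
    then show ?thesis by (simp add: algebra_simps)
  qed auto
  then show ?thesis using assms by (simp add: P_def field_simps)
qed

lemma interp_bound_le_singular: "interp_bound C \<sigma> p q \<le> 2 * C * (sing_primitive \<sigma> q - sing_primitive \<sigma> p)"
  by (simp add: interp_bound_def)

lemma interp_bound_nonneg: "\<lbrakk>0 < \<sigma>; 0 \<le> C; 0 \<le> p; p \<le> q\<rbrakk> \<Longrightarrow> 0 \<le> interp_bound C \<sigma> p q"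
  using sing_primitive_mono[of \<sigma> p q] by (auto simp: interp_bound_def)

text \<open>The bound on the second derivative takes the form of a Lipschitz condition for the first one,
  because the second derivative is controlled for almost every time only.\<close>

locale weakly_singular_function =
  fixes T C \<sigma> :: real and v v' :: "real \<Rightarrow> real"
  assumes sigma: "0 < \<sigma>" "\<sigma> < 1"
    and C_nonneg: "0 \<le> C"
    and cont: "continuous_on {0..T} v"
    and deriv: "\<lbrakk>0 < s; s < T\<rbrakk> \<Longrightarrow> (v has_real_derivative v' s) (at s)"
    and deriv_bound: "\<lbrakk>0 < s; s < T\<rbrakk> \<Longrightarrow> \<bar>v' s\<bar> \<le> C * (1 + s powr (\<sigma> - 1))"
    and deriv_lipschitz: "\<lbrakk>0 < r; r \<le> s; s < T\<rbrakk> \<Longrightarrow> \<bar>v' s - v' r\<bar> \<le> C * (1 + r powr (\<sigma> - 2)) * (s - r)"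
begin

abbreviation P :: "real \<Rightarrow> real" where "P \<equiv> sing_primitive \<sigma>"
abbreviation Err :: "real \<Rightarrow> real \<Rightarrow> real \<Rightarrow> real" where "Err \<equiv> interp_error v"
abbreviation Bd :: "real \<Rightarrow> real \<Rightarrow> real" where "Bd \<equiv> interp_bound C \<sigma>"

text \<open>Adding or subtracting the function from \<open>C\<close> times the primitive gives monotone functions.\<close>

lemma increment_bound:
  assumes "0 \<le> r" "r \<le> s" "s \<le> T"
  shows "\<bar>v s - v r\<bar> \<le> C * (P s - P r)"
proof -
  have *: "C * P r + e * v r \<le> C * P s + e * v s" if e: "\<bar>e\<bar> = 1" for e
  proof (rule DERIV_nonneg_imp_increasing_open[OF assms(2)])
    fix x assume x: "r < x" "x < s"
    have "((\<lambda>x. C * P x + e * v x) has_real_derivative (C * (1 + x powr (\<sigma> - 1)) + e * v' x)) (at x)"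
      using x assms sigma by (intro DERIV_add DERIV_cmult sing_primitive_deriv deriv) auto
    moreover have "\<bar>e * v' x\<bar> \<le> C * (1 + x powr (\<sigma> - 1))"
      using deriv_bound[of x] x assms e by (simp add: abs_mult)
    then have "0 \<le> C * (1 + x powr (\<sigma> - 1)) + e * v' x" by linarith
    ultimately show "\<exists>y. ((\<lambda>x. C * P x + e * v x) has_real_derivative y) (at x) \<and> 0 \<le> y" by blast
  next
    show "continuous_on {r..s} (\<lambda>x. C * P x + e * v x)" using assms sigma
      by (intro continuous_intros continuous_on_subset[OF cont]
          continuous_on_subset[OF sing_primitive_continuous]) auto
  qed
  from *[of 1] *[of "-1"] show ?thesis by (simp add: algebra_simps abs_le_iff)
qed

lemma interp_error_singular:
  assumes "0 \<le> p" "p < q" "q \<le> T" "p \<le> s" "s \<le> q"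
  shows "\<bar>Err p q s\<bar> \<le> 2 * C * (P q - P p) / (q - p) * (q - s)"
proof -
  have "Err p q s = (q - s) / (q - p) * (v q - v p) - (v q - v s)"
    using assms by (simp add: interp_error_def field_simps)
  then have "\<bar>Err p q s\<bar> \<le> (q - s) / (q - p) * \<bar>v q - v p\<bar> + \<bar>v q - v s\<bar>"
    using assms abs_triangle_ineq4[of "(q - s) / (q - p) * (v q - v p)" "v q - v s"]
    by (simp add: abs_mult)
  also have "\<dots> \<le> (q - s) / (q - p) * (C * (P q - P p)) + C * (P q - P s)"
    using assms increment_bound[of p q] increment_bound[of s q]
    by (intro add_mono mult_left_mono) auto
  also have "\<dots> \<le> (q - s) / (q - p) * (C * (P q - P p)) + C * ((P q - P p) / (q - p) * (q - s))"
    using assms sing_primitive_concave[OF sigma, of p q s] C_nonneg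
    by (intro add_left_mono mult_left_mono) auto
  finally show ?thesis by (simp add: field_simps)
qed

text \<open>The derivative of the error vanishes somewhere by the mean value theorem, so its Lipschitz
  constant bounds it everywhere; one more integration from the right end gives the second
  factor.\<close>

lemma interp_error_smooth:
  assumes "0 < p" "p < q" "q \<le> T" "p \<le> s" "s \<le> q"
  shows "\<bar>Err p q s\<bar> \<le> C * (1 + p powr (\<sigma> - 2)) * (q - p) * (q - s)"
proof (cases "s = q")
  case True
  then show ?thesis using assms by (simp add: interp_error_def)
next
  case False
  define D where "D = (v q - v p) / (q - p)"
  define M where "M = C * (1 + p powr (\<sigma> - 2))"
  have M: "0 \<le> M" using C_nonneg by (simp add: M_def)
  have mvt: "\<exists>z. x < z \<and> z < y \<and> v y - v x = (y - x) * v' z" if "p \<le> x" "x < y" "y \<le> q" for x y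
  proof -
    have "\<exists>l z. x < z \<and> z < y \<and> DERIV v z :> l \<and> v y - v x = (y - x) * l"
    proof (rule MVT[OF that(2)])
      show "continuous_on {x..y} v" using that assms by (intro continuous_on_subset[OF cont]) auto
      show "v differentiable at z" if "x < z" "z < y" for z
        using deriv[of z] that \<open>p \<le> x\<close> \<open>y \<le> q\<close> assms by (auto simp: real_differentiable_def)
    qed
    then obtain l z where z: "x < z" "z < y" "DERIV v z :> l" "v y - v x = (y - x) * l" by blast
    moreover have "l = v' z" using DERIV_unique[OF z(3) deriv] z that assms by auto
    ultimately show ?thesis by blast
  qed
  obtain \<xi> where \<xi>: "p < \<xi>" "\<xi> < q" "v q - v p = (q - p) * v' \<xi>" using mvt[of p q] assms by auto
  obtain \<eta> where \<eta>: "s < \<eta>" "\<eta> < q" "v q - v s = (q - s) * v' \<eta>" using mvt[of s q] assms False by auto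
  have lip: "\<bar>v' y - v' x\<bar> \<le> M * (q - p)" if "p < x" "x \<le> y" "y < q" for x y
  proof -
    have "\<bar>v' y - v' x\<bar> \<le> C * (1 + x powr (\<sigma> - 2)) * (y - x)"
      using that assms by (intro deriv_lipschitz) auto
    also have "\<dots> \<le> C * (1 + p powr (\<sigma> - 2)) * (q - p)"
      using that assms sigma C_nonneg by (intro mult_mono add_left_mono powr_mono2') auto
    finally show ?thesis by (simp add: M_def)
  qed
  have "\<bar>v' \<xi> - v' \<eta>\<bar> \<le> M * (q - p)"
    using lip[of \<xi> \<eta>] lip[of \<eta> \<xi>] \<xi> \<eta> assms by (cases "\<xi> \<le> \<eta>") (auto simp: abs_minus_commute)
  moreover have "Err p q s = (q - s) * (v' \<xi> - v' \<eta>)"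
  proof -
    have "Err p q s = (v q - v p) - (v q - v s) - (s - p) * ((v q - v p) / (q - p))"
      by (simp add: interp_error_def)
    also have "(v q - v p) / (q - p) = v' \<xi>" using assms \<xi>(3) by simp
    also have "(v q - v p) - (v q - v s) - (s - p) * v' \<xi> = (q - s) * (v' \<xi> - v' \<eta>)"
      unfolding \<xi>(3) \<eta>(3) by (simp add: algebra_simps)
    finally show ?thesis .
  qed
  ultimately have "\<bar>Err p q s\<bar> \<le> (q - s) * (M * (q - p))"
    using assms by (simp add: abs_mult mult_left_mono)
  then show ?thesis by (simp add: M_def mult_ac)
qed

lemma interp_error_le:
  assumes "0 \<le> p" "p < q" "q \<le> T" "p \<le> s" "s \<le> q"
  shows "\<bar>Err p q s\<bar> \<le> Bd p q / (q - p) * (q - s)"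
proof (cases "p = 0 \<or> 2 * C * (P q - P p) \<le> C * (1 + p powr (\<sigma> - 2)) * (q - p)\<^sup>2")
  case True
  then show ?thesis using interp_error_singular[OF assms] by (auto simp: interp_bound_def min_def)
next
  case False
  then have "Bd p q / (q - p) = C * (1 + p powr (\<sigma> - 2)) * (q - p)"
    using assms by (simp add: interp_bound_def min_def power2_eq_square)
  then show ?thesis using interp_error_smooth[of p q s] assms False by auto
qed

lemma interp_error_le_bound:
  assumes "0 \<le> p" "p < q" "q \<le> T" "p \<le> s" "s \<le> q"
  shows "\<bar>Err p q s\<bar> \<le> Bd p q"
proof -
  have "Bd p q / (q - p) * (q - s) \<le> Bd p q / (q - p) * (q - p)"
    using assms interp_bound_nonneg[OF sigma(1) C_nonneg, of p q] by (intro mult_left_mono divide_nonneg_pos) auto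
  then show ?thesis using interp_error_le[OF assms] assms by simp
qed

lemma interp_error_continuous:
  assumes "0 \<le> p" "p < q" "q \<le> T"
  shows "continuous_on {p..q} (Err p q)"
  unfolding interp_error_def[abs_def] using assms
  by (intro continuous_intros continuous_on_subset[OF cont]) auto

text \<open>Integration by parts moves the derivative from the interpolation error, which vanishes at
  both ends, to the kernel. Thus the error itself is all that enters, and the integrability of
  the singular derivative against the kernel comes out as a by-product.\<close>

lemma kernel_integral_by_parts:
  fixes \<alpha> r :: real
  defines "\<kappa> \<equiv> \<lambda>s. \<alpha> * (r - s) powr (- \<alpha> - 1) / Gamma (1 - \<alpha>)"
  assumes alpha: "0 < \<alpha>" "\<alpha> < 1" and pq: "0 \<le> p" "p < q" "q \<le> T" "q \<le> r"
    and F: "continuous_on {p..q} (\<lambda>s. omega (1 - \<alpha>) (r - s) * Err p q s)"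
    and J: "((\<lambda>s. \<kappa> s * Err p q s) has_integral J) {p..q}"
  shows "((\<lambda>s. omega (1 - \<alpha>) (r - s) * v' s) has_integral
    ((v q - v p) / (q - p) * (omega (2 - \<alpha>) (r - p) - omega (2 - \<alpha>) (r - q)) - J)) {p..q}"
proof -
  define D where "D = (v q - v p) / (q - p)"
  have G: "Gamma (1 - \<alpha>) \<noteq> 0" using less_imp_neq[OF Gamma_real_pos[of "1 - \<alpha>"]] alpha by auto
  have ends: "Err p q p = 0" "Err p q q = 0" using pq by (auto simp: interp_error_def)
  have "((\<lambda>s. \<kappa> s * Err p q s + omega (1 - \<alpha>) (r - s) * (v' s - D)) has_integral
      (omega (1 - \<alpha>) (r - q) * Err p q q - omega (1 - \<alpha>) (r - p) * Err p q p)) {p..q}"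
  proof (rule fundamental_theorem_of_calculus_interior[OF _ F])
    fix s assume s: "s \<in> {p<..<q}"
    have 1: "((\<lambda>s. omega (1 - \<alpha>) (r - s)) has_real_derivative \<kappa> s) (at s)"
      unfolding omega_one_minus \<kappa>_def using s pq G by (auto intro!: derivative_eq_intros)
    have "Err p q = (\<lambda>s. v s - v p - (s - p) * D)" by (auto simp: interp_error_def D_def)
    then have 2: "(Err p q has_real_derivative (v' s - D)) (at s)"
      using deriv[of s] s pq by (auto intro!: derivative_eq_intros)
    show "((\<lambda>s. omega (1 - \<alpha>) (r - s) * Err p q s) has_vector_derivative
        (\<kappa> s * Err p q s + omega (1 - \<alpha>) (r - s) * (v' s - D))) (at s)"
      using DERIV_mult[OF 1 2] by (simp add: has_real_derivative_iff_has_vector_derivative[symmetric] mult_ac)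
  qed (use pq in auto)
  then have "((\<lambda>s. \<kappa> s * Err p q s + omega (1 - \<alpha>) (r - s) * (v' s - D)) has_integral 0) {p..q}"
    by (simp add: ends)
  from has_integral_diff[OF this J]
  have "((\<lambda>s. omega (1 - \<alpha>) (r - s) * (v' s - D)) has_integral (- J)) {p..q}" by simp
  from has_integral_add[OF has_integral_mult_right[OF omega_has_integral[OF alpha, of p q r], of D] this]
  show ?thesis using pq by (simp add: D_def algebra_simps)
qed

lemma kernel_integral_history:
  fixes \<alpha> r :: real
  assumes alpha: "0 < \<alpha>" "\<alpha> < 1" and pq: "0 \<le> p" "p < q" "q \<le> T" "q < r"
  shows "\<exists>J. ((\<lambda>s. omega (1 - \<alpha>) (r - s) * v' s) has_integral
      ((v q - v p) / (q - p) * (omega (2 - \<alpha>) (r - p) - omega (2 - \<alpha>) (r - q)) - J)) {p..q} \<and>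
    \<bar>J\<bar> \<le> Bd p q * (omega (1 - \<alpha>) (r - q) - omega (1 - \<alpha>) (r - p))"
proof -
  define \<kappa> where "\<kappa> s = \<alpha> * (r - s) powr (- \<alpha> - 1) / Gamma (1 - \<alpha>)" for s
  have G: "0 < Gamma (1 - \<alpha>)" using alpha by (intro Gamma_real_pos) auto
  then have G0: "Gamma (1 - \<alpha>) \<noteq> 0" by simp
  have \<kappa>_cont: "continuous_on {p..q} \<kappa>"
    unfolding \<kappa>_def[abs_def] using pq G0 by (intro continuous_intros) auto
  have om_cont: "continuous_on {p..q} (\<lambda>s. omega (1 - \<alpha>) (r - s))"
    unfolding omega_one_minus using pq G0 by (intro continuous_intros) auto
  have err_cont: "continuous_on {p..q} (Err p q)" using pq by (intro interp_error_continuous) auto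
  have \<kappa>_int: "(\<kappa> has_integral (omega (1 - \<alpha>) (r - q) - omega (1 - \<alpha>) (r - p))) {p..q}"
  proof (rule fundamental_theorem_of_calculus_interior[OF _ om_cont])
    fix s assume s: "s \<in> {p<..<q}"
    have "((\<lambda>s. omega (1 - \<alpha>) (r - s)) has_real_derivative \<kappa> s) (at s)"
      unfolding omega_one_minus \<kappa>_def using s pq G0 by (auto intro!: derivative_eq_intros)
    then show "((\<lambda>s. omega (1 - \<alpha>) (r - s)) has_vector_derivative \<kappa> s) (at s)"
      by (simp add: has_real_derivative_iff_has_vector_derivative)
  qed (use pq in auto)
  define J where "J = integral {p..q} (\<lambda>s. \<kappa> s * Err p q s)"
  have int: "(\<lambda>s. \<kappa> s * Err p q s) integrable_on {p..q}"
    by (intro integrable_continuous_real continuous_intros \<kappa>_cont err_cont)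
  then have J: "((\<lambda>s. \<kappa> s * Err p q s) has_integral J) {p..q}"
    by (simp add: J_def integrable_integral)
  have "norm J \<le> integral {p..q} (\<lambda>s. Bd p q * \<kappa> s)" unfolding J_def
  proof (rule integral_norm_bound_integral[OF int])
    show "(\<lambda>s. Bd p q * \<kappa> s) integrable_on {p..q}"
      using has_integral_mult_right[OF \<kappa>_int] by (auto simp: integrable_on_def)
    fix s assume s: "s \<in> {p..q}"
    have "0 \<le> \<kappa> s" using G alpha by (simp add: \<kappa>_def)
    then show "norm (\<kappa> s * Err p q s) \<le> Bd p q * \<kappa> s"
      using interp_error_le_bound[of p q s] s pq by (simp add: abs_mult mult_left_mono mult.commute[of "Bd p q"])
  qed
  also have "\<dots> = Bd p q * (omega (1 - \<alpha>) (r - q) - omega (1 - \<alpha>) (r - p))"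
    using has_integral_mult_right[OF \<kappa>_int] by (rule integral_unique)
  finally have "\<bar>J\<bar> \<le> Bd p q * (omega (1 - \<alpha>) (r - q) - omega (1 - \<alpha>) (r - p))" by simp
  moreover have "((\<lambda>s. omega (1 - \<alpha>) (r - s) * v' s) has_integral
      ((v q - v p) / (q - p) * (omega (2 - \<alpha>) (r - p) - omega (2 - \<alpha>) (r - q)) - J)) {p..q}"
    using J pq unfolding \<kappa>_def
    by (intro kernel_integral_by_parts[OF alpha] continuous_intros om_cont err_cont) auto
  ultimately show ?thesis by blast
qed

text \<open>On the last interval the kernel is singular at the right end, where the error vanishes
  linearly; the derivative of the kernel against the error is then still integrable.\<close>

lemma kernel_integral_last:
  fixes \<alpha> :: real
  assumes alpha: "0 < \<alpha>" "\<alpha> < 1" and pq: "0 \<le> p" "p < q" "q \<le> T"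
  shows "\<exists>J. ((\<lambda>s. omega (1 - \<alpha>) (q - s) * v' s) has_integral
      ((v q - v p) / (q - p) * (omega (2 - \<alpha>) (q - p) - omega (2 - \<alpha>) (q - q)) - J)) {p..q} \<and>
    \<bar>J\<bar> \<le> Bd p q * ((q - p) powr (- \<alpha>) / Gamma (2 - \<alpha>))"
proof -
  define \<kappa> where "\<kappa> s = \<alpha> * (q - s) powr (- \<alpha> - 1) / Gamma (1 - \<alpha>)" for s
  define L where "L = Bd p q / (q - p)"
  have L: "0 \<le> L" using interp_bound_nonneg[OF sigma(1) C_nonneg, of p q] pq by (simp add: L_def)
  have G: "0 < Gamma (1 - \<alpha>)" using alpha by (intro Gamma_real_pos) auto
  then have G0: "Gamma (1 - \<alpha>) \<noteq> 0" by simp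
  have err_cont: "continuous_on {p..q} (Err p q)" using pq by (intro interp_error_continuous) auto
  have \<kappa>_err: "\<bar>\<kappa> s * Err p q s\<bar> \<le> \<alpha> * L * omega (1 - \<alpha>) (q - s)" if "s \<in> {p..q}" for s
  proof (cases "s = q")
    case True
    (* both sides vanish, as 0 powr x = 0 *)
    then show ?thesis by (simp add: \<kappa>_def omega_one_minus)
  next
    case False
    have \<kappa>: "0 \<le> \<kappa> s" using G alpha by (simp add: \<kappa>_def)
    have "\<bar>\<kappa> s * Err p q s\<bar> \<le> \<kappa> s * (L * (q - s))" unfolding abs_mult abs_of_nonneg[OF \<kappa>] L_def
      using interp_error_le[of p q s] that pq \<kappa> by (intro mult_left_mono) auto
    also have "\<dots> = \<alpha> * L * ((q - s) powr (- \<alpha> - 1) * (q - s) / Gamma (1 - \<alpha>))" by (simp add: \<kappa>_def)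
    also have "(q - s) powr (- \<alpha> - 1) * (q - s) = (q - s) powr (- \<alpha>)"
      using False that powr_mult_base[of "q - s" "- \<alpha> - 1"] by (simp add: mult.commute)
    finally show ?thesis by (simp add: omega_one_minus)
  qed
  have bound_int: "((\<lambda>s. \<alpha> * L * omega (1 - \<alpha>) (q - s)) has_integral (\<alpha> * L * omega (2 - \<alpha>) (q - p))) {p..q}"
    using has_integral_mult_right[OF omega_has_integral[OF alpha, of p q q], of "\<alpha> * L"] pq
    by (simp add: omega_def)
  define J where "J = integral {p..q} (\<lambda>s. \<kappa> s * Err p q s)"
  have int: "(\<lambda>s. \<kappa> s * Err p q s) integrable_on {p..q}"
  proof (rule measurable_bounded_by_integrable_imp_integrable_real)
    have "\<kappa> \<in> borel_measurable borel" unfolding \<kappa>_def[abs_def] by measurable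
    then have "\<kappa> \<in> borel_measurable (lebesgue_on {p..q})"
      by (intro measurable_restrict_space1 measurable_completion) simp
    moreover have "Err p q \<in> borel_measurable (lebesgue_on {p..q})"
      using err_cont by (intro continuous_imp_measurable_on_sets_lebesgue) auto
    ultimately show "(\<lambda>s. \<kappa> s * Err p q s) \<in> borel_measurable (lebesgue_on {p..q})" by measurable
    show "(\<lambda>s. \<alpha> * L * omega (1 - \<alpha>) (q - s)) integrable_on {p..q}"
      using bound_int by (auto simp: integrable_on_def)
  qed (use \<kappa>_err in auto)
  then have J: "((\<lambda>s. \<kappa> s * Err p q s) has_integral J) {p..q}"
    by (simp add: J_def integrable_integral)
  have "norm J \<le> integral {p..q} (\<lambda>s. \<alpha> * L * omega (1 - \<alpha>) (q - s))"
    unfolding J_def using \<kappa>_err bound_int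
    by (intro integral_norm_bound_integral int) (auto simp: integrable_on_def)
  also have "\<dots> = \<alpha> * (Bd p q * ((q - p) powr (- \<alpha>) / Gamma (2 - \<alpha>)))"
  proof -
    have "omega (2 - \<alpha>) (q - p) = (q - p) * ((q - p) powr (- \<alpha>) / Gamma (2 - \<alpha>))"
      using pq powr_mult_base[of "q - p" "- \<alpha>"] by (simp add: omega_def)
    then show ?thesis using integral_unique[OF bound_int] pq by (simp add: L_def)
  qed
  also have "\<dots> \<le> 1 * (Bd p q * ((q - p) powr (- \<alpha>) / Gamma (2 - \<alpha>)))"
    using alpha interp_bound_nonneg[OF sigma(1) C_nonneg, of p q] pq Gamma_real_pos[of "2 - \<alpha>"]
    by (intro mult_right_mono mult_nonneg_nonneg divide_nonneg_pos) auto
  finally have "\<bar>J\<bar> \<le> Bd p q * ((q - p) powr (- \<alpha>) / Gamma (2 - \<alpha>))" by simp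
  moreover have "continuous_on {p..q} (\<lambda>s. omega (1 - \<alpha>) (q - s) * Err p q s)"
    unfolding continuous_on_eq_continuous_within
  proof
    fix s assume s: "s \<in> {p..q}"
    show "continuous (at s within {p..q}) (\<lambda>s. omega (1 - \<alpha>) (q - s) * Err p q s)"
    proof (cases "s = q")
      case False
      then have "continuous (at s within {p..q}) (\<lambda>s. omega (1 - \<alpha>) (q - s))"
        unfolding omega_one_minus using G0 s by (intro continuous_intros) auto
      moreover have "continuous (at s within {p..q}) (Err p q)"
        using err_cont s by (simp add: continuous_on_eq_continuous_within)
      ultimately show ?thesis by (intro continuous_intros)
    next
      case True
      have "continuous_on {p..q} (\<lambda>s. L * ((q - s) powr (1 - \<alpha>) / Gamma (1 - \<alpha>)))" using alpha G0
        by (intro continuous_on_mult continuous_on_divide continuous_on_powr' continuous_intros) auto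
      then have lim: "((\<lambda>s. L * ((q - s) powr (1 - \<alpha>) / Gamma (1 - \<alpha>))) \<longlongrightarrow> 0) (at q within {p..q})"
        using pq by (auto simp: continuous_on_def dest!: bspec[of _ _ q])
      have le: "norm (omega (1 - \<alpha>) (q - x) * Err p q x) \<le> L * ((q - x) powr (1 - \<alpha>) / Gamma (1 - \<alpha>))"
        if x: "x \<in> {p..q}" for x
      proof -
        have "norm (omega (1 - \<alpha>) (q - x) * Err p q x) \<le> omega (1 - \<alpha>) (q - x) * (L * (q - x))"
          unfolding real_norm_def abs_mult L_def using interp_error_le[of p q x] x pq G
          by (intro mult_mono) (auto simp: omega_one_minus)
        also have "\<dots> = L * ((q - x) powr (1 - \<alpha>) / Gamma (1 - \<alpha>))"
          using powr_mult_base[of "q - x" "- \<alpha>"] x by (simp add: omega_one_minus mult_ac)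
        finally show ?thesis .
      qed
      have "((\<lambda>s. omega (1 - \<alpha>) (q - s) * Err p q s) \<longlongrightarrow> 0) (at q within {p..q})"
        by (rule Lim_null_comparison[OF _ lim]) (use le in \<open>simp add: eventually_at_filter\<close>)
      then show ?thesis using True by (simp add: continuous_within omega_one_minus)
    qed
  qed
  then have "((\<lambda>s. omega (1 - \<alpha>) (q - s) * v' s) has_integral
      ((v q - v p) / (q - p) * (omega (2 - \<alpha>) (q - p) - omega (2 - \<alpha>) (q - q)) - J)) {p..q}"
    using J pq unfolding \<kappa>_def by (intro kernel_integral_by_parts[OF alpha]) auto
  ultimately show ?thesis by blast
qed

end

section \<open>Consistency in time\<close>

lemma has_integral_time_mesh:
  fixes f :: "real \<Rightarrow> real"
  assumes "time_mesh T N t" "n \<le> N"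
    and "\<And>k. k \<in> {1..n} \<Longrightarrow> (f has_integral J k) {t (k - 1)..t k}"
  shows "(f has_integral (\<Sum>k=1..n. J k)) {0..t n}"
  using assms(2,3)
proof (induction n)
  case 0
  have "t 0 = 0" using assms(1) by (simp add: time_mesh_def)
  then show ?case using has_integral_refl(2)[of f 0] by simp
next
  case (Suc n)
  have "(f has_integral (\<Sum>k=1..n. J k)) {0..t n}" using Suc by auto
  moreover have "(f has_integral J (Suc n)) {t n..t (Suc n)}" using Suc.prems(2)[of "Suc n"] by simp
  ultimately have "(f has_integral (\<Sum>k=1..n. J k) + J (Suc n)) {0..t (Suc n)}"
    using time_mesh_nonneg[OF assms(1), of n] time_mesh_le[OF assms(1), of n "Suc n"] Suc.prems(1)
    by (intro has_integral_combine[of 0 "t n" "t (Suc n)"]) auto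
  then show ?case by simp
qed

text \<open>The graph of the convex kernel lies below its chord (Hermite--Hadamard).\<close>

lemma omega_average_le_trapezoid:
  assumes alpha: "0 < \<alpha>" "\<alpha> < 1" and pq: "p < q" "q < r"
  shows "1 / (q - p) * integral {p..q} (\<lambda>s. omega (1 - \<alpha>) (r - s))
    \<le> (omega (1 - \<alpha>) (r - p) + omega (1 - \<alpha>) (r - q)) / 2"
proof -
  define f where "f s = omega (1 - \<alpha>) (r - s)" for s
  define D where "D = (f q - f p) / (q - p)"
  have G: "0 < Gamma (1 - \<alpha>)" using alpha by (intro Gamma_real_pos) auto
  have "convex_on {p..q} f"
  proof (rule convex_on_realI)
    fix s assume "s \<in> {p..q}"
    then show "(f has_real_derivative \<alpha> * (r - s) powr (- \<alpha> - 1) / Gamma (1 - \<alpha>)) (at s)"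
      unfolding f_def[abs_def] omega_one_minus using pq less_imp_neq[OF G]
      by (auto intro!: derivative_eq_intros)
  next
    fix x y assume "x \<in> {p..q}" "y \<in> {p..q}" "x \<le> y"
    then show "\<alpha> * (r - x) powr (- \<alpha> - 1) / Gamma (1 - \<alpha>)
        \<le> \<alpha> * (r - y) powr (- \<alpha> - 1) / Gamma (1 - \<alpha>)"
      using alpha pq G by (intro divide_right_mono mult_left_mono powr_mono2') auto
  qed auto
  then have chord: "f s \<le> D * (s - p) + f p" if "s \<in> {p..q}" for s
    using convex_onD_Icc'[of p q f s] that by (simp add: D_def)
  have *: "((\<lambda>s. D * (s - p) + f p) has_integral
      ((D * (q - p)\<^sup>2 / 2 + f p * q) - (D * (p - p)\<^sup>2 / 2 + f p * p))) {p..q}"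
    using pq by (intro fundamental_theorem_of_calculus)
      (auto intro!: derivative_eq_intros simp flip: has_real_derivative_iff_has_vector_derivative)
  have f: "(f has_integral integral {p..q} f) {p..q}"
    using omega_has_integral[OF alpha, of p q r] pq
    by (intro integrable_integral) (auto simp: f_def[abs_def] integrable_on_def)
  have "integral {p..q} f \<le> (D * (q - p)\<^sup>2 / 2 + f p * q) - (D * (p - p)\<^sup>2 / 2 + f p * p)"
    by (rule has_integral_le[OF f *]) (rule chord)
  also have "\<dots> = (q - p) * ((f p + f q) / 2)"
  proof -
    have "D * (q - p)\<^sup>2 = (f q - f p) * (q - p)" using pq by (simp add: D_def power2_eq_square)
    then show ?thesis by (simp add: field_simps)
  qed
  finally show ?thesis using pq by (simp add: f_def[abs_def] field_simps)
qed

definition interp_bounds :: "real \<Rightarrow> real \<Rightarrow> (nat \<Rightarrow> real) \<Rightarrow> nat \<Rightarrow> real" where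
  "interp_bounds C \<sigma> t k = (if k = 0 then 0 else interp_bound C \<sigma> (t (k - 1)) (t k))"

context fast_L1_mesh
begin

text \<open>The mean of the singular kernel over a step is at most the average of its two end values,
  and the mean over the next step is at least the larger of them. Both means differ from the fast
  kernel by at most the tolerance.\<close>

lemma omega_variation_le:
  assumes n: "n \<in> {1..N}" and k: "1 \<le> k" "k < n"
  shows "omega (1 - \<alpha>) (t n - t k) - omega (1 - \<alpha>) (t n - t (k - 1))
    \<le> 2 * (A n (n - k - 1) - A n (n - k)) + 4 * tol"
proof -
  have lt: "t (k - 1) < t k" "t k < t n" "t k < t (Suc k)" "t (Suc k) \<le> t n"
    using time_mesh_less[OF mesh, of "k - 1" k] time_mesh_less[OF mesh, of k n]
      time_mesh_less[OF mesh, of k "Suc k"] time_mesh_le[OF mesh, of "Suc k" n] n k by auto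
  have "L1_kernel \<alpha> t n (n - k) \<le> (omega (1 - \<alpha>) (t n - t (k - 1)) + omega (1 - \<alpha>) (t n - t k)) / 2"
    using omega_average_le_trapezoid[OF alpha lt(1,2)] k by (simp add: L1_kernel_def step_def)
  moreover have "omega (1 - \<alpha>) (t n - t k) \<le> L1_kernel \<alpha> t n (n - Suc k)"
  proof (cases "Suc k = n")
    case True
    have "0 \<le> \<alpha> * (step t n powr (- \<alpha>) / Gamma (2 - \<alpha>))" using alpha G2 by simp
    then have "omega (1 - \<alpha>) (step t n) \<le> A n 0" using omega_le_omega_diag[OF n] by linarith
    then show ?thesis using kernel_L1_error[OF n, of n] n True by (auto simp: step_def)
  next
    case False
    then have lt': "t (Suc k) < t n" using time_mesh_less[OF mesh, of "Suc k" n] n k by auto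
    have "omega (1 - \<alpha>) (t n - t k)
        \<le> 1 / (t (Suc k) - t k) * integral {t k..t (Suc k)} (\<lambda>s. omega (1 - \<alpha>) (t n - s))"
      using lt lt' omega_has_integral[OF alpha, of "t k" "t (Suc k)" "t n"]
      by (intro average_ge omega_antimono[OF alpha]) (auto simp: integrable_on_def)
    then show ?thesis using k by (simp add: L1_kernel_def step_def)
  qed
  moreover have "\<bar>L1_kernel \<alpha> t n (n - k) - A n (n - k)\<bar> \<le> tol"
    using kernel_L1_error[OF n, of k] k by simp
  moreover have "\<bar>L1_kernel \<alpha> t n (n - Suc k) - A n (n - Suc k)\<bar> \<le> tol"
    using kernel_L1_error[OF n, of "Suc k"] k tol_pos by (auto split: if_splits)
  moreover have "n - k - 1 = n - Suc k" by simp
  ultimately show ?thesis by (simp add: abs_le_iff field_simps)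
qed

lemma sum_interp_bounds_le:
  assumes \<sigma>: "0 < \<sigma>" and C: "0 \<le> C" and n: "n \<le> N"
  shows "(\<Sum>k=1..n. interp_bounds C \<sigma> t k) \<le> 2 * C * sing_primitive \<sigma> T"
proof -
  define P where "P = sing_primitive \<sigma>"
  have "(\<Sum>k=1..n. interp_bounds C \<sigma> t k) \<le> (\<Sum>k=1..n. 2 * C * (P (t k) - P (t (k - 1))))"
  proof (rule sum_mono)
    fix k assume "k \<in> {1..n}"
    then show "interp_bounds C \<sigma> t k \<le> 2 * C * (P (t k) - P (t (k - 1)))"
      using interp_bound_le_singular by (auto simp: interp_bounds_def P_def)
  qed
  also have "\<dots> = 2 * C * (P (t n) - P (t 0))"
    using sum_telescope''[of 0 n "\<lambda>k. P (t k)"] by (simp flip: sum_distrib_left)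
  also have "\<dots> \<le> 2 * C * P T"
    using sing_primitive_mono[OF \<sigma>, of "t n" T] time_mesh_nonneg[OF mesh, of n]
      time_mesh_le_T[OF mesh, of n] n C
    by (intro mult_left_mono) (auto simp: t_0 sing_primitive_def P_def)
  finally show ?thesis by (simp add: P_def)
qed

lemma interp_bounds_nonneg:
  assumes "0 < \<sigma>" "0 \<le> C" "k \<le> N"
  shows "0 \<le> interp_bounds C \<sigma> t k"
  using interp_bound_nonneg[of \<sigma> C "t (k - 1)" "t k"] time_mesh_nonneg[OF mesh, of "k - 1"]
    time_mesh_le[OF mesh, of "k - 1" k] assms by (auto simp: interp_bounds_def)

text \<open>Integration by parts on every step bounds the error of the piecewise linear interpolation
  under the fractional integral by the variation of the kernel. The weights of the interpolation
  errors then are those of the discrete derivative, so that summation by parts applies. The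
  tolerance is multiplied by the total variation of the function and by the sum of the
  interpolation bounds, both of which are controlled by the primitive at \<open>T\<close>.\<close>

lemma fast_L1_consistency:
  assumes wsf: "weakly_singular_function T C \<sigma> v v'" and n: "n \<in> {1..N}"
  shows "\<bar>caputo \<alpha> v (t n) - fast_L1 \<alpha> t Nq \<theta> w (\<lambda>k. v (t k)) n\<bar>
    \<le> 3 * A n 0 * interp_bounds C \<sigma> t n - 2 * discrete_caputo A (interp_bounds C \<sigma> t) n
      + 9 * C * sing_primitive \<sigma> T * tol"
proof -
  interpret weakly_singular_function T C \<sigma> v v' by fact
  define B where "B = interp_bounds C \<sigma> t"
  define X where "X k = (if k = n then A n 0 else
      omega (1 - \<alpha>) (t n - t k) - omega (1 - \<alpha>) (t n - t (k - 1)))" for k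
  have nodes: "0 \<le> t (k - 1)" "t (k - 1) < t k" "t k \<le> T" "t k \<le> t n" if "k \<in> {1..n}" for k
    using that n time_mesh_nonneg[OF mesh, of "k - 1"] time_mesh_less[OF mesh, of "k - 1" k]
      time_mesh_le_T[OF mesh, of k] time_mesh_le[OF mesh, of k n] by auto
  have "\<exists>J. ((\<lambda>s. omega (1 - \<alpha>) (t n - s) * deriv v s) has_integral
      (L1_kernel \<alpha> t n (n - k) * (v (t k) - v (t (k - 1))) - J)) {t (k - 1)..t k} \<and>
      \<bar>J\<bar> \<le> X k * B k" if k: "k \<in> {1..n}" for k
  proof -
    define I where "I = (v (t k) - v (t (k - 1))) / (t k - t (k - 1)) *
        (omega (2 - \<alpha>) (t n - t (k - 1)) - omega (2 - \<alpha>) (t n - t k))"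
    have "\<exists>J. ((\<lambda>s. omega (1 - \<alpha>) (t n - s) * v' s) has_integral (I - J)) {t (k - 1)..t k} \<and>
      \<bar>J\<bar> \<le> X k * B k"
    proof (cases "k = n")
      case True
      then show ?thesis using kernel_integral_last[OF alpha nodes(1-3)[OF k]] kernel_0[OF n] k
        by (simp add: I_def X_def B_def interp_bounds_def step_def mult.commute)
    next
      case False
      then have "t k < t n" using time_mesh_less[OF mesh, of k n] n k by auto
      then show ?thesis using kernel_integral_history[OF alpha nodes(1-3)[OF k], of "t n"] k False
        by (simp add: I_def X_def B_def interp_bounds_def mult.commute)
    qed
    then obtain J where J: "((\<lambda>s. omega (1 - \<alpha>) (t n - s) * v' s) has_integral (I - J)) {t (k - 1)..t k}"
      "\<bar>J\<bar> \<le> X k * B k" by blast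
    have "((\<lambda>s. omega (1 - \<alpha>) (t n - s) * deriv v s) has_integral (I - J)) (cbox (t (k - 1)) (t k))"
    proof (rule has_integral_spike_interior)
      fix s assume "s \<in> box (t (k - 1)) (t k)"
      then have "(v has_real_derivative v' s) (at s)" using nodes[OF k] by (intro deriv) auto
      then show "omega (1 - \<alpha>) (t n - s) * deriv v s = omega (1 - \<alpha>) (t n - s) * v' s"
        by (simp add: DERIV_imp_deriv)
    qed (use J in simp)
    moreover have "I = L1_kernel \<alpha> t n (n - k) * (v (t k) - v (t (k - 1)))"
      using integral_unique[OF omega_has_integral[OF alpha, of "t (k - 1)" "t k" "t n"]] nodes[OF k] k
      by (simp add: I_def L1_kernel_def step_def)
    ultimately show ?thesis using J by auto
  qed
  then have "\<forall>k\<in>{1..n}. \<exists>J. ((\<lambda>s. omega (1 - \<alpha>) (t n - s) * deriv v s) has_integral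
      (L1_kernel \<alpha> t n (n - k) * (v (t k) - v (t (k - 1))) - J)) {t (k - 1)..t k} \<and>
      \<bar>J\<bar> \<le> X k * B k" by blast
  from bchoice[OF this] obtain J where J: "\<And>k. k \<in> {1..n} \<Longrightarrow> ((\<lambda>s. omega (1 - \<alpha>) (t n - s) * deriv v s) has_integral
      (L1_kernel \<alpha> t n (n - k) * (v (t k) - v (t (k - 1))) - J k)) {t (k - 1)..t k}"
    and J_le: "\<And>k. k \<in> {1..n} \<Longrightarrow> \<bar>J k\<bar> \<le> X k * B k"
    by blast
  have "caputo \<alpha> v (t n) = (\<Sum>k=1..n. L1_kernel \<alpha> t n (n - k) * (v (t k) - v (t (k - 1))) - J k)"
    unfolding caputo_def using J n by (intro integral_unique has_integral_time_mesh[OF mesh]) auto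
  then have eq: "caputo \<alpha> v (t n) - fast_L1 \<alpha> t Nq \<theta> w (\<lambda>k. v (t k)) n
      = (\<Sum>k=1..n. (L1_kernel \<alpha> t n (n - k) - A n (n - k)) * (v (t k) - v (t (k - 1))) - J k)"
    by (simp add: fast_L1_def algebra_simps flip: sum_subtractf)
  have "\<bar>caputo \<alpha> v (t n) - fast_L1 \<alpha> t Nq \<theta> w (\<lambda>k. v (t k)) n\<bar>
      \<le> (\<Sum>k=1..n. tol * (C * (P (t k) - P (t (k - 1)))) + X k * B k)"
    unfolding eq
  proof (rule order_trans[OF sum_abs], rule sum_mono)
    fix k assume k: "k \<in> {1..n}"
    have "\<bar>(L1_kernel \<alpha> t n (n - k) - A n (n - k)) * (v (t k) - v (t (k - 1)))\<bar>
        \<le> tol * (C * (P (t k) - P (t (k - 1))))"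
      unfolding abs_mult
      using kernel_L1_error[OF n, of k] k tol_pos increment_bound[of "t (k - 1)" "t k"] nodes[OF k]
      by (intro mult_mono) (auto split: if_splits)
    then show "\<bar>(L1_kernel \<alpha> t n (n - k) - A n (n - k)) * (v (t k) - v (t (k - 1))) - J k\<bar>
        \<le> tol * (C * (P (t k) - P (t (k - 1)))) + X k * B k"
      using J_le[OF k] by linarith
  qed
  also have "\<dots> = tol * (C * (\<Sum>k=1..n. P (t k) - P (t (k - 1)))) + (\<Sum>k=1..n. X k * B k)"
    by (simp only: sum.distrib flip: sum_distrib_left)
  finally have total: "\<bar>caputo \<alpha> v (t n) - fast_L1 \<alpha> t Nq \<theta> w (\<lambda>k. v (t k)) n\<bar>
      \<le> tol * (C * (\<Sum>k=1..n. P (t k) - P (t (k - 1)))) + (\<Sum>k=1..n. X k * B k)" .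
  have "(\<Sum>k=1..n. P (t k) - P (t (k - 1))) = P (t n) - P (t 0)"
    using sum_telescope''[of 0 n "\<lambda>k. P (t k)"] by simp
  also have "\<dots> \<le> P T"
    using sing_primitive_mono[OF sigma(1), of "t n" T] nodes[of n] n time_mesh_nonneg[OF mesh, of n]
    by (auto simp: t_0 sing_primitive_def)
  finally have "tol * (C * (\<Sum>k=1..n. P (t k) - P (t (k - 1)))) \<le> tol * (C * P T)"
    using tol_pos C_nonneg by (intro mult_left_mono) auto
  moreover have "(\<Sum>k=1..n. X k * B k)
      \<le> A n 0 * B n + (\<Sum>k=1..<n. (2 * (A n (n - k - 1) - A n (n - k)) + 4 * tol) * B k)"
  proof -
    have "{1..n} = insert n {1..<n}" using n by auto
    then have "(\<Sum>k=1..n. X k * B k) = X n * B n + (\<Sum>k=1..<n. X k * B k)" by simp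
    also have "\<dots> \<le> A n 0 * B n + (\<Sum>k=1..<n. (2 * (A n (n - k - 1) - A n (n - k)) + 4 * tol) * B k)"
    proof (intro add_mono sum_mono mult_right_mono)
      fix k assume k: "k \<in> {1..<n}"
      then show "X k \<le> 2 * (A n (n - k - 1) - A n (n - k)) + 4 * tol"
        using omega_variation_le[OF n, of k] by (simp add: X_def)
      show "0 \<le> B k" using k n interp_bounds_nonneg[OF sigma(1) C_nonneg, of k] by (simp add: B_def)
    qed (use n interp_bounds_nonneg[OF sigma(1) C_nonneg, of n] in \<open>simp_all add: X_def B_def\<close>)
    finally show ?thesis .
  qed
  moreover have "(\<Sum>k=1..<n. (2 * (A n (n - k - 1) - A n (n - k)) + 4 * tol) * B k)
      = 2 * (A n 0 * B n - discrete_caputo A B n) + 4 * tol * (\<Sum>k=1..<n. B k)"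
  proof -
    have "B 0 = 0" by (simp add: B_def interp_bounds_def)
    then have "(\<Sum>k=1..<n. (A n (n - k - 1) - A n (n - k)) * B k) = A n 0 * B n - discrete_caputo A B n"
      using discrete_caputo_by_parts[of n A B] n by simp
    then show ?thesis by (simp only: distrib_right sum.distrib mult.assoc flip: sum_distrib_left)
  qed
  moreover have "4 * tol * (\<Sum>k=1..<n. B k) \<le> 4 * tol * (2 * C * P T)"
  proof -
    have "{1..<n} = {1..n - 1}" using n by auto
    then have "(\<Sum>k=1..<n. B k) \<le> 2 * C * P T"
      using sum_interp_bounds_le[OF sigma(1) C_nonneg, of "n - 1"] n unfolding B_def by (metis atLeastAtMost_iff diff_le_self order_trans)
    then show ?thesis using tol_pos by (intro mult_left_mono) auto
  qed
  ultimately show ?thesis using total by (simp add: B_def algebra_simps)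
qed

end

section \<open>Pointwise regularity in time for almost every point\<close>

lemma AE_lborel_imp_negligible:
  fixes Z :: "'a::euclidean_space set"
  assumes "AE x in lborel. x \<notin> Z"
  shows "negligible Z"
proof -
  obtain M where "{x \<in> space lborel. \<not> x \<notin> Z} \<subseteq> M" "emeasure lborel M = 0" "M \<in> sets lborel"
    using AE_E[OF assms] .
  then have "Z \<subseteq> M" "M \<in> null_sets lborel" by auto
  then show ?thesis
    using negligible_subset[of M Z] by (simp add: negligible_iff_null_sets null_sets_completionI)
qed

lemma AE_imp_all_if_open:
  fixes S :: "'a::euclidean_space set"
  assumes "AE x in lborel. x \<in> S \<longrightarrow> P x" and "open {x \<in> S. \<not> P x}" and "x \<in> S"
  shows "P x"
proof -
  have "negligible {x \<in> S. \<not> P x}"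
    using assms(1) by (intro AE_lborel_imp_negligible) (auto elim: eventually_mono)
  then have "{x \<in> S. \<not> P x} = {}" using open_not_negligible[OF assms(2)] by auto
  then show ?thesis using assms(3) by auto
qed

lemma Linf_norm_AE:
  assumes "Linf_norm (rect a b c d) f \<le> ereal B"
  shows "AE z in lborel. z \<in> rect a b c d \<longrightarrow> \<bar>f z\<bar> \<le> B"
proof -
  have "rect a b c d \<in> sets lebesgue" by (simp add: rect_def borel_open open_Times)
  moreover have "AE z in lebesgue_on (rect a b c d). ereal \<bar>f z\<bar> \<le> ereal B"
    using esssup_AE[of "\<lambda>z. ereal \<bar>f z\<bar>" "lebesgue_on (rect a b c d)"]
    by eventually_elim (rule order_trans[OF _ assms[unfolded Linf_norm_def]])
  ultimately have "AE z in lebesgue. z \<in> rect a b c d \<longrightarrow> \<bar>f z\<bar> \<le> B"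
    by (simp add: AE_restrict_space_iff)
  then show ?thesis by (simp add: AE_completion_iff)
qed

text \<open>A function of \<open>z\<close> and \<open>t\<close> that is obtained pointwise as a limit of difference quotients
  in \<open>t\<close> of a Borel function is Borel. The increments shrink with the distance to \<open>T\<close>, so that
  the quotients stay within the time interval.\<close>

lemma borel_measurable_time_derivative:
  fixes f f' :: "'a::euclidean_space \<Rightarrow> real \<Rightarrow> real"
  assumes X: "open R"
    and f: "(\<lambda>p. indicator (R \<times> {0<..<T}) p * f (fst p) (snd p)) \<in> borel_measurable borel"
    and deriv: "\<And>z t. z \<in> R \<Longrightarrow> 0 < t \<Longrightarrow> t < T \<Longrightarrow> (f z has_real_derivative f' z t) (at t)"
  shows "(\<lambda>p. indicator (R \<times> {0<..<T}) p * f' (fst p) (snd p)) \<in> borel_measurable borel"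
proof -
  define X where "X = R \<times> {0<..<T}"
  (* the divisor n + 2 keeps t + h n t below T for every n *)
  define h where "h n t = (T - t) / real (n + 2)" for n t
  define F where "F p = indicator X p * f (fst p) (snd p)" for p
  define Q where "Q n p = indicator X p * ((F (fst p, snd p + h n (snd p)) - F p) / h n (snd p))" for n p
  have X_borel: "X \<in> sets borel" unfolding X_def using assms(1) by (intro borel_open open_Times) auto
  have F: "F \<in> borel_measurable borel" using f by (simp add: F_def[abs_def] X_def)
  have Q: "Q n \<in> borel_measurable borel" for n
  proof -
    have "(\<lambda>p :: 'a \<times> real. (fst p, snd p + h n (snd p))) \<in> borel_measurable borel"
      unfolding h_def by (intro borel_measurable_continuous_onI continuous_intros) auto
    from measurable_compose[OF this F]
    have "(\<lambda>p. F (fst p, snd p + h n (snd p))) \<in> borel_measurable borel" .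
    moreover have "(\<lambda>p :: 'a \<times> real. h n (snd p)) \<in> borel_measurable borel"
      unfolding h_def by (intro borel_measurable_continuous_onI continuous_intros) auto
    ultimately show ?thesis
      unfolding Q_def[abs_def] using F X_borel by (intro borel_measurable_times borel_measurable_divide
        borel_measurable_diff borel_measurable_indicator) auto
  qed
  have "(\<lambda>n. Q n p) \<longlonglongrightarrow> indicator X p * f' (fst p) (snd p)" for p
  proof (cases "p \<in> X")
    case False
    then show ?thesis by (simp add: Q_def)
  next
    case True
    then obtain z t where p: "p = (z, t)" "z \<in> R" "0 < t" "t < T" by (auto simp: X_def)
    have h: "0 < h n t" "h n t < T - t" for n using p by (auto simp: h_def divide_less_eq)
    have "(\<lambda>n. (T - t) / real (n + 2)) \<longlonglongrightarrow> 0"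
      by (intro LIMSEQ_ignore_initial_segment[OF lim_const_over_n])
    then have "(\<lambda>n. t + h n t) \<longlonglongrightarrow> t + 0" unfolding h_def by (intro tendsto_intros)
    then have "filterlim (\<lambda>n. t + h n t) (at t) sequentially"
      using h(1) by (auto simp: filterlim_at less_imp_neq[THEN not_sym])
    moreover have "((\<lambda>y. (f z y - f z t) / (y - t)) \<longlongrightarrow> f' z t) (at t)"
      using deriv[OF p(2-4)] by (simp add: has_field_derivative_iff)
    ultimately have "(\<lambda>n. (f z (t + h n t) - f z t) / (t + h n t - t)) \<longlonglongrightarrow> f' z t"
      by (rule filterlim_compose[rotated])
    moreover have "(z, t + h n t) \<in> X" for n using h[of n] p by (auto simp: X_def)
    ultimately show ?thesis using True by (simp add: Q_def F_def p)
  qed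
  then show ?thesis
    using borel_measurable_LIMSEQ_real[of borel Q "\<lambda>p. indicator X p * f' (fst p) (snd p)"] Q by (simp add: X_def)
qed

text \<open>The hypotheses bound the time derivatives at each time for almost every point. Fubini's
  theorem exchanges the quantifiers.\<close>

lemma AE_time_bound:
  fixes w :: "real \<times> real \<Rightarrow> real \<Rightarrow> real"
  assumes R: "open R"
    and w: "(\<lambda>p. indicator (R \<times> {0<..<T}) p * w (fst p) (snd p)) \<in> borel_measurable borel"
    and \<beta>: "\<beta> \<in> borel_measurable borel"
    and bound: "\<And>t. 0 < t \<Longrightarrow> t < T \<Longrightarrow> AE z in lborel. z \<in> R \<longrightarrow> \<bar>w z t\<bar> \<le> \<beta> t"
  shows "AE z in lborel. z \<in> R \<longrightarrow> (AE t in lborel. t \<in> {0<..<T} \<longrightarrow> \<bar>w z t\<bar> \<le> \<beta> t)"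
proof -
  define X where "X = R \<times> {0<..<T}"
  define W where "W p = indicator X p * w (fst p) (snd p)" for p
  define P where "P z t \<longleftrightarrow> ((z, t) \<in> X \<longrightarrow> \<bar>W (z, t)\<bar> \<le> \<beta> t)" for z t
  have X_borel: "X \<in> sets borel" unfolding X_def using R by (intro borel_open open_Times) auto
  have W: "W \<in> borel_measurable borel" using w by (simp add: W_def[abs_def] X_def)
  have snd: "(\<lambda>p :: (real \<times> real) \<times> real. \<beta> (snd p)) \<in> borel_measurable borel"
    by (rule measurable_compose[OF _ \<beta>]) (intro borel_measurable_continuous_onI continuous_intros)
  have "{p. P (fst p) (snd p)} = (UNIV - X) \<union> {p \<in> space borel. \<bar>W p\<bar> \<le> \<beta> (snd p)}"
    by (auto simp: P_def)
  also have "\<dots> \<in> sets borel"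
    using X_borel W snd by (intro sets.Un sets.Diff borel_measurable_le borel_measurable_abs) auto
  finally have "{p \<in> space (lborel \<Otimes>\<^sub>M lborel). P (fst p) (snd p)} \<in> sets (lborel \<Otimes>\<^sub>M lborel)"
    unfolding lborel_prod by simp
  from lborel_pair.AE_commute[OF this]
  have comm: "(AE z in lborel. AE t in lborel. P z t) \<longleftrightarrow> (AE t in lborel. AE z in lborel. P z t)" .
  have "AE z in lborel. P z t" for t
  proof (cases "0 < t \<and> t < T")
    case True
    then have "AE z in lborel. z \<in> R \<longrightarrow> \<bar>w z t\<bar> \<le> \<beta> t" by (intro bound) auto
    then show ?thesis by eventually_elim (auto simp: P_def W_def X_def)
  qed (auto simp: P_def X_def)
  then have "AE z in lborel. AE t in lborel. P z t" unfolding comm by simp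
  then show ?thesis
  proof eventually_elim
    case (elim z)
    show ?case
    proof
      assume "z \<in> R"
      then show "AE t in lborel. t \<in> {0<..<T} \<longrightarrow> \<bar>w z t\<bar> \<le> \<beta> t"
        by (intro eventually_mono[OF elim]) (auto simp: P_def W_def X_def)
    qed
  qed
qed

lemma AE_bound_imp_lipschitz:
  fixes f f' :: "real \<Rightarrow> real"
  assumes rs: "r \<le> s" and deriv: "\<And>t. t \<in> {r..s} \<Longrightarrow> (f has_real_derivative f' t) (at t)"
    and bound: "AE t in lborel. t \<in> {r..s} \<longrightarrow> \<bar>f' t\<bar> \<le> M" and M: "0 \<le> M"
  shows "\<bar>f s - f r\<bar> \<le> M * (s - r)"
proof -
  define Z where "Z = {t \<in> {r..s}. \<not> \<bar>f' t\<bar> \<le> M}"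
  have "negligible Z"
    using bound by (intro AE_lborel_imp_negligible) (auto simp: Z_def elim: eventually_mono)
  have "(f' has_integral (f s - f r)) {r..s}"
    using deriv by (intro fundamental_theorem_of_calculus[OF rs])
      (auto simp: has_real_derivative_iff_has_vector_derivative[symmetric] intro: DERIV_subset)
  then have I: "(f' has_integral (f s - f r)) (cbox r s)" by simp
  have J: "((\<lambda>t. if t \<in> Z then 0 else f' t) has_integral (f s - f r)) (cbox r s)"
    by (rule has_integral_spike[OF \<open>negligible Z\<close> _ I]) auto
  have "norm (f s - f r) \<le> M * measure lborel (cbox r s)"
    by (rule has_integral_bound[OF M J]) (use M in \<open>auto simp: Z_def\<close>)
  then show ?thesis using rs by simp
qed

text \<open>The first time derivative is continuous in time, so its bound extends from almost every time
  to every time. The second one need not be, but its bound integrates to the Lipschitz condition.\<close>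

lemma AE_weakly_singular_function:
  fixes u u' u'' :: "real \<times> real \<Rightarrow> real \<Rightarrow> real"
  assumes \<sigma>: "0 < \<sigma>" "\<sigma> < 1" and C: "0 \<le> C"
    and u: "continuous_on (UNIV \<times> {0..T}) (\<lambda>(z, t). u z t)"
    and d1: "\<And>z t. z \<in> rect a b c d \<Longrightarrow> t \<in> {0<..T} \<Longrightarrow> (u z has_real_derivative u' z t) (at t within {0<..T})"
    and d2: "\<And>z t. z \<in> rect a b c d \<Longrightarrow> t \<in> {0<..T} \<Longrightarrow> (u' z has_real_derivative u'' z t) (at t within {0<..T})"
    and b1: "\<And>t. t \<in> {0<..T} \<Longrightarrow> Linf_norm (rect a b c d) (\<lambda>z. u' z t) \<le> ereal (C * (1 + t powr (\<sigma> - 1)))"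
    and b2: "\<And>t. t \<in> {0<..T} \<Longrightarrow> Linf_norm (rect a b c d) (\<lambda>z. u'' z t) \<le> ereal (C * (1 + t powr (\<sigma> - 2)))"
  shows "AE z in lborel. z \<in> rect a b c d \<longrightarrow> weakly_singular_function T C \<sigma> (u z) (u' z)"
proof -
  define R where "R = rect a b c d"
  have R: "open R" by (simp add: R_def rect_def open_Times)
  have interior: "at t within {0<..T} = at t" if "0 < t" "t < T" for t :: real
    using that by (intro at_within_interior) auto
  have d1': "(u z has_real_derivative u' z t) (at t)" if "z \<in> R" "0 < t" "t < T" for z t
    using d1[of z t] that interior by (simp add: R_def)
  have d2': "(u' z has_real_derivative u'' z t) (at t)" if "z \<in> R" "0 < t" "t < T" for z t
    using d2[of z t] that interior by (simp add: R_def)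
  have "continuous_on (R \<times> {0<..<T}) (\<lambda>p. u (fst p) (snd p))"
    using u unfolding split_beta by (rule continuous_on_subset) auto
  then have m0: "(\<lambda>p. indicator (R \<times> {0<..<T}) p * u (fst p) (snd p)) \<in> borel_measurable borel"
    using borel_measurable_continuous_on_indicator[of "R \<times> {0<..<T}" "\<lambda>p. u (fst p) (snd p)"] R
    by (auto simp: borel_open open_Times)
  note m1 = borel_measurable_time_derivative[OF R m0 d1']
  note m2 = borel_measurable_time_derivative[OF R m1 d2']
  have "AE z in lborel. z \<in> R \<longrightarrow> (AE t in lborel. t \<in> {0<..<T} \<longrightarrow> \<bar>u' z t\<bar> \<le> C * (1 + t powr (\<sigma> - 1)))"
    using Linf_norm_AE[OF b1] by (intro AE_time_bound[OF R m1]) (auto simp: R_def)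
  moreover have "AE z in lborel. z \<in> R \<longrightarrow> (AE t in lborel. t \<in> {0<..<T} \<longrightarrow> \<bar>u'' z t\<bar> \<le> C * (1 + t powr (\<sigma> - 2)))"
    using Linf_norm_AE[OF b2] by (intro AE_time_bound[OF R m2]) (auto simp: R_def)
  ultimately show ?thesis
  proof eventually_elim
    case (elim z)
    show ?case
    proof
      assume "z \<in> rect a b c d"
      then have z: "z \<in> R" by (simp add: R_def)
      show "weakly_singular_function T C \<sigma> (u z) (u' z)"
      proof
        show "continuous_on {0..T} (u z)"
        proof -
          have "continuous_on {0..T} (\<lambda>t. (z, t))" by (intro continuous_intros)
          from continuous_on_compose2[OF u this] show ?thesis by auto
        qed
        show "(u z has_real_derivative u' z s) (at s)" if "0 < s" "s < T" for s
          by (rule d1'[OF z that])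
        have cont: "continuous_on {0<..<T} (u' z)"
          by (intro continuous_at_imp_continuous_on ballI DERIV_isCont[OF d2'[OF z]]) auto
        have "open {t \<in> {0<..<T}. \<not> \<bar>u' z t\<bar> \<le> C * (1 + t powr (\<sigma> - 1))}"
        proof -
          have "continuous_on {0<..<T} (\<lambda>t. \<bar>u' z t\<bar> - C * (1 + t powr (\<sigma> - 1)))"
            using cont by (intro continuous_intros) auto
          then have "open ((\<lambda>t. \<bar>u' z t\<bar> - C * (1 + t powr (\<sigma> - 1))) -` {0<..} \<inter> {0<..<T})"
            by (intro continuous_on_open_vimage[THEN iffD1, rule_format]) auto
          moreover have "(\<lambda>t. \<bar>u' z t\<bar> - C * (1 + t powr (\<sigma> - 1))) -` {0<..} \<inter> {0<..<T}
              = {t \<in> {0<..<T}. \<not> \<bar>u' z t\<bar> \<le> C * (1 + t powr (\<sigma> - 1))}" by auto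
          ultimately show ?thesis by simp
        qed
        then show "\<bar>u' z s\<bar> \<le> C * (1 + s powr (\<sigma> - 1))" if "0 < s" "s < T" for s
          using elim(1) z that by (intro AE_imp_all_if_open[of "{0<..<T}" "\<lambda>t. \<bar>u' z t\<bar> \<le> C * (1 + t powr (\<sigma> - 1))"]) auto
        show "\<bar>u' z s - u' z r\<bar> \<le> C * (1 + r powr (\<sigma> - 2)) * (s - r)" if "0 < r" "r \<le> s" "s < T" for r s
        proof (rule AE_bound_imp_lipschitz[OF that(2)])
          show "(u' z has_real_derivative u'' z t) (at t)" if "t \<in> {r..s}" for t
            using that \<open>0 < r\<close> \<open>s < T\<close> by (intro d2'[OF z]) auto
          have "AE t in lborel. t \<in> {0<..<T} \<longrightarrow> \<bar>u'' z t\<bar> \<le> C * (1 + t powr (\<sigma> - 2))"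
            using elim(2) z by simp
          then show "AE t in lborel. t \<in> {r..s} \<longrightarrow> \<bar>u'' z t\<bar> \<le> C * (1 + r powr (\<sigma> - 2))"
          proof eventually_elim
            case (elim t)
            show ?case
            proof
              assume t: "t \<in> {r..s}"
              then have "\<bar>u'' z t\<bar> \<le> C * (1 + t powr (\<sigma> - 2))" using elim that by auto
              also have "\<dots> \<le> C * (1 + r powr (\<sigma> - 2))"
                using t that \<sigma> C by (intro mult_left_mono add_left_mono powr_mono2') auto
              finally show "\<bar>u'' z t\<bar> \<le> C * (1 + r powr (\<sigma> - 2))" .
            qed
          qed
        qed (use C in simp)
      qed (use \<sigma> C in auto)
    qed
  qed
qed

section \<open>Trigonometric test functions\<close>

text \<open>Trigonometric polynomials serve as test functions: they are closed under partial derivatives and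
  reflections, and they contain periodic approximations of the identity.\<close>

inductive_set trig_fun :: "(real \<times> real \<Rightarrow> real) set" where
  const: "(\<lambda>_. c) \<in> trig_fun"
| cos_fst: "(\<lambda>z. cos (w * fst z + c)) \<in> trig_fun"
| cos_snd: "(\<lambda>z. cos (w * snd z + c)) \<in> trig_fun"
| add: "\<lbrakk>f \<in> trig_fun; g \<in> trig_fun\<rbrakk> \<Longrightarrow> (\<lambda>z. f z + g z) \<in> trig_fun"
| mult: "\<lbrakk>f \<in> trig_fun; g \<in> trig_fun\<rbrakk> \<Longrightarrow> (\<lambda>z. f z * g z) \<in> trig_fun"

lemma trig_fun_power: "f \<in> trig_fun \<Longrightarrow> (\<lambda>z. f z ^ n) \<in> trig_fun"
  by (induction n) (auto intro: trig_fun.intros)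

lemma trig_fun_has_derivative: "f \<in> trig_fun \<Longrightarrow> f differentiable (at z)"
proof (induction rule: trig_fun.induct)
  case (cos_fst w c)
  have "((\<lambda>z. cos (w * fst z + c)) has_derivative (\<lambda>h. - sin (w * fst z + c) * (w * fst h))) (at z)"
    by (auto intro!: derivative_eq_intros)
  then show ?case by (rule differentiableI)
next
  case (cos_snd w c)
  have "((\<lambda>z. cos (w * snd z + c)) has_derivative (\<lambda>h. - sin (w * snd z + c) * (w * snd h))) (at z)"
    by (auto intro!: derivative_eq_intros)
  then show ?case by (rule differentiableI)
qed auto

lemma trig_fun_continuous: "f \<in> trig_fun \<Longrightarrow> continuous_on S f"
  by (intro differentiable_imp_continuous_on differentiable_at_imp_differentiable_on trig_fun_has_derivative)

lemma trig_fun_compose_continuous: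
  "f \<in> trig_fun \<Longrightarrow> continuous_on S g \<Longrightarrow> continuous_on S (\<lambda>x. f (g x))"
  by (rule continuous_on_compose2[OF trig_fun_continuous[of f UNIV]]) auto

lemma cos_quarter_shift: "cos (x + (y + pi / 2)) = - sin (x + y)" for x y :: real
  using cos_add[of "x + y" "pi / 2"] by (simp add: add.assoc)

lemma trig_fun_partial:
  assumes "f \<in> trig_fun" and e: "e = (1, 0) \<or> e = (0, 1)"
  shows "\<exists>g\<in>trig_fun. \<forall>z s. ((\<lambda>s. f (z + s *\<^sub>R e)) has_real_derivative g (z + s *\<^sub>R e)) (at s)"
  using assms(1)
proof (induction rule: trig_fun.induct)
  case (const c)
  show ?case by (rule bexI[OF _ trig_fun.const[of 0]]) auto
next
  case (cos_fst w c)
  have "(\<lambda>z. w * fst e * cos (w * fst z + (c + pi / 2))) \<in> trig_fun"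
    by (intro trig_fun.mult trig_fun.const trig_fun.cos_fst)
  then show ?case by (rule rev_bexI)
      (auto intro!: derivative_eq_intros simp: cos_quarter_shift)
next
  case (cos_snd w c)
  have "(\<lambda>z. w * snd e * cos (w * snd z + (c + pi / 2))) \<in> trig_fun"
    by (intro trig_fun.mult trig_fun.const trig_fun.cos_snd)
  then show ?case by (rule rev_bexI)
      (auto intro!: derivative_eq_intros simp: cos_quarter_shift)
next
  case (add f g)
  then obtain f' g' where "f' \<in> trig_fun" "g' \<in> trig_fun"
    "\<And>z s. ((\<lambda>s. f (z + s *\<^sub>R e)) has_real_derivative f' (z + s *\<^sub>R e)) (at s)"
    "\<And>z s. ((\<lambda>s. g (z + s *\<^sub>R e)) has_real_derivative g' (z + s *\<^sub>R e)) (at s)" by blast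
  then show ?case by (intro bexI[of _ "\<lambda>z. f' z + g' z"] allI DERIV_add trig_fun.add) auto
next
  case (mult f g)
  then obtain f' g' where "f' \<in> trig_fun" "g' \<in> trig_fun"
    "\<And>z s. ((\<lambda>s. f (z + s *\<^sub>R e)) has_real_derivative f' (z + s *\<^sub>R e)) (at s)"
    "\<And>z s. ((\<lambda>s. g (z + s *\<^sub>R e)) has_real_derivative g' (z + s *\<^sub>R e)) (at s)" by blast
  then show ?case using mult(1,2)
    by (intro bexI[of _ "\<lambda>z. f' z * g z + g' z * f z"] allI DERIV_mult trig_fun.add trig_fun.mult) auto
qed

text \<open>The partial derivative in the direction \<open>e\<close>; both coordinate derivatives are instances.\<close>

definition partial :: "real \<times> real \<Rightarrow> (real \<times> real \<Rightarrow> real) \<Rightarrow> real \<times> real \<Rightarrow> real" where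
  "partial e f z = deriv (\<lambda>s. f (z + s *\<^sub>R e)) 0"

lemma deriv_shift: "deriv f x = deriv (\<lambda>s. f (x + s)) (0 :: real)"
  unfolding deriv_def using DERIV_shift[of f _ 0 x] by (simp add: add.commute)

lemma px_eq_partial: "px = partial (1, 0)"
proof (intro ext)
  fix v and z :: "real \<times> real"
  show "px v z = partial (1, 0) v z"
    using deriv_shift[of "\<lambda>s. v (s, snd z)" "fst z"] by (cases z) (simp add: px_def partial_def)
qed

lemma py_eq_partial: "py = partial (0, 1)"
proof (intro ext)
  fix v and z :: "real \<times> real"
  show "py v z = partial (0, 1) v z"
    using deriv_shift[of "\<lambda>s. v (fst z, s)" "snd z"] by (cases z) (simp add: py_def partial_def)
qed

lemma
  assumes "f \<in> trig_fun" and "e = (1, 0) \<or> e = (0, 1)"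
  shows partial_trig_fun: "partial e f \<in> trig_fun"
    and DERIV_partial: "((\<lambda>s. f (z + s *\<^sub>R e)) has_real_derivative partial e f (z + s *\<^sub>R e)) (at s)"
proof -
  obtain g where g: "g \<in> trig_fun"
    "\<And>z s. ((\<lambda>s. f (z + s *\<^sub>R e)) has_real_derivative g (z + s *\<^sub>R e)) (at s)"
    using trig_fun_partial[OF assms] by blast
  have "partial e f = g"
    unfolding partial_def using g(2)[of _ 0] by (intro ext DERIV_imp_deriv) simp
  with g show "partial e f \<in> trig_fun"
    "((\<lambda>s. f (z + s *\<^sub>R e)) has_real_derivative partial e f (z + s *\<^sub>R e)) (at s)" by auto
qed

lemma smooth_fun_trig:
  assumes "f \<in> trig_fun"
  shows "smooth_fun f"
proof -
  have "foldr (\<lambda>e. if e then px else py) ds f \<in> trig_fun" for ds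
    using assms by (induction ds) (auto simp: px_eq_partial py_eq_partial intro: partial_trig_fun)
  then show ?thesis unfolding smooth_fun_def
    by (auto intro: differentiable_at_imp_differentiable_on trig_fun_has_derivative)
qed

lemma trig_fun_reflect: "f \<in> trig_fun \<Longrightarrow> (\<lambda>y. f (z - y)) \<in> trig_fun"
proof (induction rule: trig_fun.induct)
  case (cos_fst w c)
  show ?case using trig_fun.cos_fst[of "- w" "w * fst z + c"] by (simp add: algebra_simps)
next
  case (cos_snd w c)
  show ?case using trig_fun.cos_snd[of "- w" "w * snd z + c"] by (simp add: algebra_simps)
qed (auto intro: trig_fun.intros)

lemma partial_reflect:
  assumes "f \<in> trig_fun" "e = (1, 0) \<or> e = (0, 1)"
  shows "partial e (\<lambda>y. c * f (z - y)) = (\<lambda>y. - c * partial e f (z - y))"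
proof
  fix y
  have "((\<lambda>r. f (z - y + r *\<^sub>R e)) has_real_derivative partial e f (z - y)) (at (- 0))"
    using DERIV_partial[OF assms, of "z - y" 0] by simp
  then have "((\<lambda>s. f (z - y + (- s) *\<^sub>R e)) has_real_derivative - partial e f (z - y)) (at 0)"
    unfolding DERIV_mirror .
  from DERIV_cmult[OF this, of c]
  have "((\<lambda>s. c * f (z - (y + s *\<^sub>R e))) has_real_derivative - c * partial e f (z - y)) (at 0)"
    by (simp add: algebra_simps)
  then show "partial e (\<lambda>y. c * f (z - y)) y = - c * partial e f (z - y)"
    unfolding partial_def[of e "\<lambda>y. c * f (z - y)"] by (rule DERIV_imp_deriv)
qed

lemma partial_pow_trig_fun:
  assumes "f \<in> trig_fun" "e = (1, 0) \<or> e = (0, 1)"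
  shows "(partial e ^^ n) f \<in> trig_fun"
  using assms by (induction n) (auto intro: partial_trig_fun)

lemma partial_pow_reflect:
  assumes "f \<in> trig_fun" "e = (1, 0) \<or> e = (0, 1)"
  shows "(partial e ^^ n) (\<lambda>y. f (z - y)) = (\<lambda>y. (-1) ^ n * (partial e ^^ n) f (z - y))"
proof (induction n)
  case (Suc n)
  then show ?case
    using partial_reflect[OF partial_pow_trig_fun[OF assms, of n] assms(2), of "(-1) ^ n" z] by simp
qed simp

section \<open>Periodic mollifiers\<close>

text \<open>High powers of a function concentrate at the points where it is maximal.\<close>

lemma integral_power_concentration:
  fixes H q :: "'a::euclidean_space \<Rightarrow> real"
  assumes box: "box a b \<noteq> {}"
    and H: "continuous_on (cbox a b) H" and q: "continuous_on (cbox a b) q"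
    and q0: "\<And>z. z \<in> cbox a b \<Longrightarrow> 0 \<le> q z" and qQ: "\<And>z. z \<in> cbox a b \<Longrightarrow> q z \<le> Q"
    and Q: "0 < Q" and z0: "z0 \<in> cbox a b" "q z0 = Q"
    and pos: "\<And>z. z \<in> cbox a b \<Longrightarrow> q z = Q \<Longrightarrow> 0 < H z"
  shows "\<forall>\<^sub>F m in sequentially. 0 < integral (cbox a b) (\<lambda>z. H z * q z ^ m)"
proof -
  define S where "S = {z \<in> cbox a b. H z \<le> 0}"
  have S: "compact S"
  proof -
    have "S = cbox a b \<inter> H -` {..0}" by (auto simp: S_def)
    moreover have "closed (cbox a b \<inter> H -` {..0})"
      using H by (intro continuous_closed_preimage) auto
    moreover have "bounded S" by (rule bounded_subset[OF bounded_cbox[of a b]]) (auto simp: S_def)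
    ultimately show ?thesis by (simp add: compact_eq_bounded_closed)
  qed
  obtain r0 where r0: "0 \<le> r0" "r0 < Q" "\<And>z. z \<in> S \<Longrightarrow> q z \<le> r0"
  proof (cases "S = {}")
    case True
    then show ?thesis using that[of 0] Q by auto
  next
    case False
    have "continuous_on S q" using q by (rule continuous_on_subset) (auto simp: S_def)
    from continuous_attains_sup[OF S False this]
    obtain s where s: "s \<in> S" "\<forall>z\<in>S. q z \<le> q s" by blast
    then have "q s \<noteq> Q" "s \<in> cbox a b" using pos[of s] by (auto simp: S_def)
    then show ?thesis using that[of "q s"] s q0[of s] qQ[of s] by auto
  qed
  define r1 where "r1 = (r0 + Q) / 2"
  have r1: "r0 < r1" "r1 < Q" using r0 by (auto simp: r1_def)
  define \<eta> where "\<eta> = H z0 / 2"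
  have \<eta>: "0 < \<eta>" using pos[OF z0] by (simp add: \<eta>_def)
  obtain d1 where d1: "0 < d1" "\<And>z. z \<in> cbox a b \<Longrightarrow> dist z z0 < d1 \<Longrightarrow> dist (H z) (H z0) < \<eta>"
    using H z0(1) \<eta> unfolding continuous_on_iff by metis
  obtain d2 where d2: "0 < d2" "\<And>z. z \<in> cbox a b \<Longrightarrow> dist z z0 < d2 \<Longrightarrow> dist (q z) (q z0) < Q - r1"
    using q z0(1) r1 unfolding continuous_on_iff by (metis diff_gt_0_iff_gt)
  define U where "U = ball z0 (min d1 d2) \<inter> box a b"
  have near: "\<eta> \<le> H z \<and> r1 \<le> q z" if "z \<in> U" for z
  proof -
    have "z \<in> cbox a b" "dist z z0 < d1" "dist z z0 < d2"
      using that box_subset_cbox[of a b] by (auto simp: U_def dist_commute)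
    from d1(2)[OF this(1,2)] d2(2)[OF this(1,3)] show ?thesis
      unfolding dist_real_def \<eta>_def z0(2) by (intro conjI) linarith+
  qed
  have "z0 \<in> closure (box a b)" using z0(1) box by (simp add: closure_box)
  then obtain y where "y \<in> U" using d1(1) d2(1) unfolding U_def closure_approachable
    by (metis IntI dist_commute mem_ball min_less_iff_conj)
  moreover have "open U" by (auto simp: U_def)
  ultimately obtain c d where cd: "y \<in> box c d" "cbox c d \<subseteq> U" by (metis open_contains_cbox)
  have W: "0 < measure lborel (cbox c d)"
    using cd(1) by (metis content_pos_lt_eq empty_iff box_ne_empty(2))
  have sub: "cbox c d \<subseteq> cbox a b" using cd(2) box_subset_cbox[of a b] by (auto simp: U_def)
  have "bounded (H ` cbox a b)" using H by (intro compact_imp_bounded compact_continuous_image) auto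
  then obtain M where M: "\<And>z. z \<in> cbox a b \<Longrightarrow> \<bar>H z\<bar> \<le> M" "0 < M" unfolding bounded_pos by auto
  define V where "V = measure lborel (cbox a b)"
  have V: "0 \<le> V" by (simp add: V_def)
  have lower: "\<eta> * r1 ^ m * measure lborel (cbox c d) - M * r0 ^ m * V \<le> integral (cbox a b) (\<lambda>z. H z * q z ^ m)" for m
  proof -
    have int: "(\<lambda>z. H z * q z ^ m) integrable_on cbox a b"
      using H q by (intro integrable_continuous continuous_intros)
    have int': "(\<lambda>z. H z * q z ^ m) integrable_on cbox c d"
      by (rule integrable_on_subcbox[OF int sub])
    have nonneg: "0 \<le> H z * q z ^ m + M * r0 ^ m" if z: "z \<in> cbox a b" for z
    proof (cases "z \<in> S")
      case True
      have "- (H z * q z ^ m) \<le> M * r0 ^ m" using M(1)[OF z] M(2) r0(3)[OF True] q0[OF z]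
        by (subst minus_mult_left, intro mult_mono power_mono) auto
      then show ?thesis by simp
    next
      case False
      then show ?thesis using z q0[OF z] M(2) r0(1) by (simp add: S_def)
    qed
    have "integral (cbox c d) (\<lambda>_. \<eta> * r1 ^ m) \<le> integral (cbox c d) (\<lambda>z. H z * q z ^ m + M * r0 ^ m)"
    proof (rule integral_le)
      fix z assume "z \<in> cbox c d"
      then have "\<eta> * r1 ^ m \<le> H z * q z ^ m"
        using near[of z] cd(2) \<eta> r0(1) r1(1) by (intro mult_mono power_mono) auto
      then show "\<eta> * r1 ^ m \<le> H z * q z ^ m + M * r0 ^ m" using M(2) r0(1) by (simp add: add_increasing2)
    qed (auto intro!: integrable_add int')
    also have "\<dots> \<le> integral (cbox a b) (\<lambda>z. H z * q z ^ m + M * r0 ^ m)"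
      using nonneg by (intro integral_subset_le[OF sub] integrable_add int int') auto
    also have "\<dots> = integral (cbox a b) (\<lambda>z. H z * q z ^ m) + M * r0 ^ m * V"
      using int by (subst integral_add) (auto simp: V_def)
    finally show ?thesis by (simp add: algebra_simps)
  qed
  have "(\<lambda>m. M * V * (r0 / r1) ^ m) \<longlonglongrightarrow> M * V * 0"
    using r0 r1 by (intro tendsto_mult_left LIMSEQ_power_zero) auto
  then have "\<forall>\<^sub>F m in sequentially. M * V * (r0 / r1) ^ m < \<eta> * measure lborel (cbox c d)"
    using \<eta> W by (intro order_tendstoD(2)) auto
  then show ?thesis
  proof eventually_elim
    case (elim m)
    have "0 < r1 ^ m" using r0 r1 by simp
    then have "M * V * r0 ^ m < \<eta> * measure lborel (cbox c d) * r1 ^ m"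
      using elim by (simp add: power_divide field_simps)
    then show ?case using lower[of m] by (simp add: mult_ac)
  qed
qed

text \<open>The normalized powers of this function are an approximate identity on the torus; in one
  variable these are the de la Vallee-Poussin kernels.\<close>

definition bump :: "real \<Rightarrow> real \<Rightarrow> real \<times> real \<Rightarrow> real" where
  "bump L1 L2 z = (1 + cos (2 * pi / L1 * fst z + 0)) * (1 + cos (2 * pi / L2 * snd z + 0))"

lemma bump_power_trig_fun: "(\<lambda>z. bump L1 L2 z ^ m) \<in> trig_fun"
  unfolding bump_def by (intro trig_fun_power trig_fun.intros)

lemma one_plus_cos: "0 \<le> 1 + cos x" "1 + cos x \<le> 2" for x :: real
  using cos_ge_minus_one[of x] cos_le_one[of x] by linarith+

lemma bump_bounds: "0 \<le> bump L1 L2 z" "bump L1 L2 z \<le> 4"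
proof -
  show "0 \<le> bump L1 L2 z" unfolding bump_def by (intro mult_nonneg_nonneg one_plus_cos)
  have "bump L1 L2 z \<le> 2 * 2" unfolding bump_def by (intro mult_mono one_plus_cos) auto
  then show "bump L1 L2 z \<le> 4" by simp
qed

lemma bump_eq_4:
  assumes "bump L1 L2 (x, y) = 4" "L1 \<noteq> 0" "L2 \<noteq> 0"
  shows "\<exists>k l :: int. x = of_int k * L1 \<and> y = of_int l * L2"
proof -
  define X where "X = 1 + cos (2 * pi / L1 * x)"
  define Y where "Y = 1 + cos (2 * pi / L2 * y)"
  have XY: "X * Y = 4" "0 \<le> X" "X \<le> 2" "0 \<le> Y" "Y \<le> 2"
    using assms(1) one_plus_cos by (auto simp: bump_def X_def Y_def)
  have "X * Y \<le> X * 2" by (intro mult_left_mono XY)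
  moreover have "X * Y \<le> 2 * Y" by (intro mult_right_mono XY)
  ultimately have "X = 2" "Y = 2" using XY by linarith+
  then have "cos (2 * pi / L1 * x) = 1" "cos (2 * pi / L2 * y) = 1" by (auto simp: X_def Y_def)
  then obtain k l :: int where "2 * pi / L1 * x = of_int k * 2 * pi" "2 * pi / L2 * y = of_int l * 2 * pi"
    unfolding cos_one_2pi_int by blast
  then have "x = of_int k * L1" "y = of_int l * L2" using assms by (auto simp: field_simps)
  then show ?thesis by blast
qed

text \<open>The derivative of the mean with respect to the shift is a boundary term, which vanishes by
  periodicity.\<close>

lemma periodic_mean_const:
  fixes k k' :: "real \<Rightarrow> real"
  assumes "a \<le> b" and k: "\<And>x. (k has_real_derivative k' x) (at x)" and k': "continuous_on UNIV k'"
    and periodic: "\<And>x. k (x + (b - a)) = k x"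
  shows "integral {a..b} (\<lambda>s. k (x - s)) = integral {a..b} (\<lambda>s. k (0 - s))"
proof -
  have kc: "continuous_on UNIV k" by (intro continuous_at_imp_continuous_on ballI DERIV_isCont[OF k])
  have comp: "continuous_on S (\<lambda>x. f (g x))" if "continuous_on UNIV f" "continuous_on S g"
    for f :: "real \<Rightarrow> real" and g :: "'b::topological_space \<Rightarrow> real" and S
    using that by (rule continuous_on_compose2) auto
  have "((\<lambda>x. integral (cbox a b) (\<lambda>s. k (x - s))) has_real_derivative 0) (at x)" for x
  proof -
    have "((\<lambda>x. integral (cbox a b) (\<lambda>s. k (x - s))) has_real_derivative
        integral (cbox a b) (\<lambda>s. k' (x - s))) (at x within UNIV)"
    proof (rule leibniz_rule_field_derivative[where U = UNIV and f = "\<lambda>x s. k (x - s)" and fx = "\<lambda>x s. k' (x - s)"])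
      show "((\<lambda>x. k (x - s)) has_real_derivative k' (x - s)) (at x within UNIV)" for x s
      proof -
        have "((\<lambda>x. x - s) has_real_derivative 1) (at x)" by (auto intro!: derivative_eq_intros)
        from DERIV_chain2[where f = k and g = "\<lambda>x. x - s", OF k this] show ?thesis by simp
      qed
      show "(\<lambda>s. k (x - s)) integrable_on cbox a b" for x
        by (intro integrable_continuous comp[OF kc] continuous_intros)
      show "continuous_on (UNIV \<times> cbox a b) (\<lambda>(x, s). k' (x - s))"
        unfolding split_beta by (intro comp[OF k'] continuous_intros)
    qed auto
    moreover have "((\<lambda>s. k' (x - s)) has_integral (- k (x - b) - (- k (x - a)))) {a..b}"
    proof (rule fundamental_theorem_of_calculus[OF assms(1)])
      fix s
      have "((\<lambda>s. - k (x - s)) has_real_derivative k' (x - s)) (at s within {a..b})"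
      proof -
        have "((\<lambda>s. x - s) has_real_derivative -1) (at s within {a..b})" by (auto intro!: derivative_eq_intros)
        from DERIV_minus[OF DERIV_chain2[where f = k and g = "\<lambda>s. x - s", OF k this]] show ?thesis by simp
      qed
      then show "((\<lambda>s. - k (x - s)) has_vector_derivative k' (x - s)) (at s within {a..b})"
        by (simp add: has_real_derivative_iff_has_vector_derivative)
    qed
    moreover have "k (x - a) = k (x - b)" using periodic[of "x - b"] by (simp add: algebra_simps)
    ultimately show ?thesis by (simp add: integral_unique)
  qed
  then show ?thesis using DERIV_isconst_all[of "\<lambda>x. integral {a..b} (\<lambda>s. k (x - s))" x 0] by simp
qed

lemma bump_mean_const:
  assumes "a < b" "c < d"
  shows "integral (cbox (a, c) (b, d)) (\<lambda>y. bump (b - a) (d - c) (z - y) ^ m)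
    = integral (cbox (a, c) (b, d)) (\<lambda>y. bump (b - a) (d - c) (0 - y) ^ m)"
proof -
  define k where "k w x = (1 + cos (w * x + 0)) ^ m" for w x :: real
  define k' where "k' w x = real m * (1 + cos (w * x + 0)) ^ (m - 1) * (- sin (w * x) * w)" for w x :: real
  have k: "(k w has_real_derivative k' w x) (at x)" for w x
    unfolding k_def[abs_def] k'_def by (auto intro!: derivative_eq_intros)
  have k': "continuous_on UNIV (k' w)" for w unfolding k'_def[abs_def] by (intro continuous_intros)
  have kc: "continuous_on S (\<lambda>x. k w (f x))" if "continuous_on S f" for w S and f :: "real \<times> real \<Rightarrow> real"
    unfolding k_def using that by (intro continuous_intros)
  have per: "k (2 * pi / L) (x + L) = k (2 * pi / L) x" if "0 < L" for L x
  proof -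
    have "2 * pi / L * (x + L) = 2 * pi / L * x + 2 * pi" using that by (simp add: field_simps)
    then show ?thesis by (simp add: k_def)
  qed
  define k1 k2 where "k1 = k (2 * pi / (b - a))" and "k2 = k (2 * pi / (d - c))"
  have prod: "integral (cbox (a, c) (b, d)) (\<lambda>y. bump (b - a) (d - c) (z - y) ^ m)
      = integral {a..b} (\<lambda>s. k1 (fst z - s)) * integral {c..d} (\<lambda>s. k2 (snd z - s))" for z
  proof -
    have b: "bump (b - a) (d - c) (z - y) ^ m = k1 (fst z - fst y) * k2 (snd z - snd y)" for y
      by (simp add: bump_def k1_def k2_def k_def power_mult_distrib)
    show ?thesis
      unfolding b by (subst integral_prod_continuous) (auto intro!: continuous_intros kc simp: k1_def k2_def)
  qed
  have "integral {a..b} (\<lambda>s. k1 (fst z - s)) = integral {a..b} (\<lambda>s. k1 (0 - s))"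
    unfolding k1_def using assms by (intro periodic_mean_const[OF _ k k'] per) auto
  moreover have "integral {c..d} (\<lambda>s. k2 (snd z - s)) = integral {c..d} (\<lambda>s. k2 (0 - s))"
    unfolding k2_def using assms by (intro periodic_mean_const[OF _ k k'] per) auto
  ultimately show ?thesis unfolding prod by simp
qed

text \<open>The maximum \<open>4\<close> of the shifted bump is attained exactly at the translates of \<open>z\<close> by
  the periods, and at least one of them lies in the closed rectangle.\<close>

lemma bump_concentration:
  assumes ab: "a < b" "c < d" and H: "continuous_on (cbox (a, c) (b, d)) H"
    and pos: "\<And>y. y \<in> cbox (a, c) (b, d) \<Longrightarrow> bump (b - a) (d - c) (z - y) = 4 \<Longrightarrow> 0 < H y"
  shows "\<forall>\<^sub>F m in sequentially.
    0 < integral (cbox (a, c) (b, d)) (\<lambda>y. H y * bump (b - a) (d - c) (z - y) ^ m)"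
proof -
  define K where "K = cbox (a, c) (b, d)"
  define q where "q y = bump (b - a) (d - c) (z - y)" for y
  have qc: "continuous_on K q" unfolding q_def bump_def by (intro continuous_intros)
  (* z0 is a translate of z in the rectangle *)
  define k where "k = \<lfloor>(fst z - a) / (b - a)\<rfloor>"
  define l where "l = \<lfloor>(snd z - c) / (d - c)\<rfloor>"
  define z0 where "z0 = (fst z - of_int k * (b - a), snd z - of_int l * (d - c))"
  have rem: "0 \<le> x - of_int \<lfloor>x / L\<rfloor> * L \<and> x - of_int \<lfloor>x / L\<rfloor> * L \<le> L" if "0 < L" for x L :: real
    using that floor_divide_lower[OF that, of x] floor_divide_upper[OF that, of x] by (simp add: algebra_simps)
  have z0K: "z0 \<in> K" using rem[of "b - a" "fst z - a"] rem[of "d - c" "snd z - c"] ab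
    by (simp add: K_def z0_def k_def l_def cbox_Pair_eq)
  have arg: "2 * pi / L * (of_int k * L) = of_int k * (2 * pi)" if "L \<noteq> 0" for L and k :: int
    using that by simp
  have cos1: "cos (of_int k * (2 * pi)) = 1" for k :: int
    using cos_one_2pi_int[of "of_int k * (2 * pi)"] by (auto simp: mult.assoc)
  have qz0: "q z0 = 4"
    using ab by (simp add: q_def z0_def bump_def arg cos1 del: times_divide_eq_left times_divide_eq_right)
  have ne: "box (a, c) (b, d) \<noteq> {}" using ab by (simp add: box_ne_empty Basis_prod_def)
  have "\<forall>\<^sub>F m in sequentially. 0 < integral (cbox (a, c) (b, d)) (\<lambda>y. H y * q y ^ m)"
    by (rule integral_power_concentration[OF ne H, where Q = 4 and ?z0.0 = z0])
      (use qc z0K qz0 pos in \<open>simp_all add: K_def q_def bump_bounds\<close>)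
  then show ?thesis by (simp add: q_def)
qed

lemma rect_periodic_int:
  assumes "rect_periodic a b c d v"
  shows "v (x + of_int k * (b - a), y + of_int l * (d - c)) = v (x, y)"
proof -
  have per: "f (x + of_int k * L) = f x" if "\<And>x. f (x + L) = f x" for f :: "real \<Rightarrow> real" and x L and k :: int
  proof -
    have n: "f (x + real n * L) = f x" for n x
    proof (induction n)
      case (Suc n)
      then show ?case using that[of "x + real n * L"] by (simp add: algebra_simps)
    qed simp
    show ?thesis
    proof (cases "0 \<le> k")
      case True
      then show ?thesis using n[of x "nat k"] by simp
    next
      case False
      then show ?thesis using n[of "x + of_int k * L" "nat (- k)"] by (simp add: algebra_simps)
    qed
  qed
  have "v (x + of_int k * (b - a), y + of_int l * (d - c)) = v (x, y + of_int l * (d - c))"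
    using assms by (intro per[of "\<lambda>x. v (x, y + of_int l * (d - c))"]) (simp add: rect_periodic_def)
  also have "\<dots> = v (x, y)"
    using assms by (intro per[of "\<lambda>y. v (x, y)"]) (simp add: rect_periodic_def)
  finally show ?thesis .
qed

text \<open>A continuous periodic function is the limit of its means with respect to the normalized
  powers of the bump.\<close>

lemma periodic_mollification:
  assumes ab: "a < b" "c < d" and v: "continuous_on UNIV v" "rect_periodic a b c d v" and \<eta>: "0 < \<eta>"
  shows "\<forall>\<^sub>F m in sequentially.
    \<bar>integral (cbox (a, c) (b, d)) (\<lambda>y. v y * bump (b - a) (d - c) (z - y) ^ m)
      - v z * integral (cbox (a, c) (b, d)) (\<lambda>y. bump (b - a) (d - c) (0 - y) ^ m)\<bar>
    \<le> \<eta> * integral (cbox (a, c) (b, d)) (\<lambda>y. bump (b - a) (d - c) (0 - y) ^ m)"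
proof -
  define K where "K = cbox (a, c) (b, d)"
  define q where "q y = bump (b - a) (d - c) (z - y)" for y
  have qc: "continuous_on K q" unfolding q_def bump_def by (intro continuous_intros)
  have vc: "continuous_on K v" by (rule continuous_on_subset[OF v(1)]) auto
  have max: "v y = v z" if "q y = 4" for y
  proof -
    obtain x1 x2 y1 y2 where zy: "z = (x1, x2)" "y = (y1, y2)" by (cases z, cases y)
    then have "bump (b - a) (d - c) (x1 - y1, x2 - y2) = 4" using that by (simp add: q_def)
    from bump_eq_4[OF this] ab obtain k l :: int
      where "x1 - y1 = of_int k * (b - a)" "x2 - y2 = of_int l * (d - c)" by auto
    then have "z = (y1 + of_int k * (b - a), y2 + of_int l * (d - c))" by (simp add: zy algebra_simps)
    then show ?thesis using rect_periodic_int[OF v(2)] zy by simp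
  qed
  have conc: "\<forall>\<^sub>F m in sequentially. 0 < integral K (\<lambda>y. H y * q y ^ m)"
    if "continuous_on K H" "\<And>y. q y = 4 \<Longrightarrow> 0 < H y" for H
    using bump_concentration[OF ab, of H z] that by (simp add: K_def q_def)
  have "\<forall>\<^sub>F m in sequentially. 0 < integral K (\<lambda>y. (\<eta> - v z + v y) * q y ^ m)"
    using \<eta> max by (intro conc continuous_intros vc) auto
  moreover have "\<forall>\<^sub>F m in sequentially. 0 < integral K (\<lambda>y. (\<eta> + v z - v y) * q y ^ m)"
    using \<eta> max by (intro conc continuous_intros vc) auto
  ultimately show ?thesis
  proof eventually_elim
    case (elim m)
    have i1: "(\<lambda>y. v y * q y ^ m) integrable_on K" unfolding K_def
      by (rule integrable_continuous) (intro continuous_intros vc[unfolded K_def] qc[unfolded K_def])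
    have i2: "(\<lambda>y. r * q y ^ m) integrable_on K" for r unfolding K_def
      by (rule integrable_continuous) (intro continuous_intros qc[unfolded K_def])
    have N: "integral K (\<lambda>y. q y ^ m) = integral K (\<lambda>y. bump (b - a) (d - c) (0 - y) ^ m)"
      unfolding K_def q_def by (rule bump_mean_const[OF ab])
    have "integral K (\<lambda>y. (\<eta> - v z + v y) * q y ^ m)
        = (\<eta> - v z) * integral K (\<lambda>y. q y ^ m) + integral K (\<lambda>y. v y * q y ^ m)"
      using integral_add[OF i2[of "\<eta> - v z"] i1] by (simp add: distrib_right)
    moreover have "integral K (\<lambda>y. (\<eta> + v z - v y) * q y ^ m)
        = (\<eta> + v z) * integral K (\<lambda>y. q y ^ m) - integral K (\<lambda>y. v y * q y ^ m)"
      using integral_diff[OF i2[of "\<eta> + v z"] i1] by (simp add: left_diff_distrib)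
    ultimately have "0 < (\<eta> - v z) * integral K (\<lambda>y. q y ^ m) + integral K (\<lambda>y. v y * q y ^ m)"
      "0 < (\<eta> + v z) * integral K (\<lambda>y. q y ^ m) - integral K (\<lambda>y. v y * q y ^ m)"
      using elim by auto
    then show ?case
      unfolding abs_le_iff K_def[symmetric] N[symmetric] q_def[symmetric] by (simp add: algebra_simps)
  qed
qed

section \<open>Second differences under a bound on the weak fourth derivative\<close>

definition second_diff :: "real \<times> real \<Rightarrow> real \<Rightarrow> (real \<times> real \<Rightarrow> real) \<Rightarrow> real \<times> real \<Rightarrow> real" where
  "second_diff e h v z = (v (z + h *\<^sub>R e) - 2 * v z + v (z - h *\<^sub>R e)) / h\<^sup>2"

lemma second_difference_taylor:
  fixes F :: "nat \<Rightarrow> real \<Rightarrow> real"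
  assumes F: "\<And>j s. (F j has_real_derivative F (Suc j) s) (at s)" and B: "\<And>s. \<bar>F 4 s\<bar> \<le> B" and h: "h \<noteq> 0"
  shows "\<bar>(F 0 h - 2 * F 0 0 + F 0 (- h)) / h\<^sup>2 - F 2 0\<bar> \<le> B / 12 * h\<^sup>2"
proof -
  have tay: "\<exists>t. F 0 x = F 0 0 + F 1 0 * x + F 2 0 / 2 * x\<^sup>2 + F 3 0 / 6 * x ^ 3 + F 4 t / 24 * x ^ 4" for x
  proof -
    obtain t where "F 0 x = (\<Sum>m<4. F m 0 / fact m * x ^ m) + F 4 t / fact 4 * x ^ 4"
      using Maclaurin_all_le[of F "F 0" x 4] F by auto
    then show ?thesis by (auto simp: eval_nat_numeral)
  qed
  obtain t1 where t1: "F 0 h = F 0 0 + F 1 0 * h + F 2 0 / 2 * h\<^sup>2 + F 3 0 / 6 * h ^ 3 + F 4 t1 / 24 * h ^ 4"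
    using tay[of h] by blast
  obtain t2 where t2: "F 0 (- h) = F 0 0 + F 1 0 * (- h) + F 2 0 / 2 * (- h)\<^sup>2 + F 3 0 / 6 * (- h) ^ 3
      + F 4 t2 / 24 * (- h) ^ 4"
    using tay[of "- h"] by blast
  have "F 0 h - 2 * F 0 0 + F 0 (- h) = F 2 0 * h\<^sup>2 + (F 4 t1 + F 4 t2) / 24 * h ^ 4"
    unfolding t1 t2 by (simp add: algebra_simps)
  moreover have "h ^ 4 = h\<^sup>2 * h\<^sup>2" by (simp add: eval_nat_numeral)
  ultimately have "F 0 h - 2 * F 0 0 + F 0 (- h) = (F 2 0 + (F 4 t1 + F 4 t2) / 24 * h\<^sup>2) * h\<^sup>2"
    by (simp only: distrib_right mult.assoc)
  then have "(F 0 h - 2 * F 0 0 + F 0 (- h)) / h\<^sup>2 - F 2 0 = (F 4 t1 + F 4 t2) / 24 * h\<^sup>2"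
    using h by simp
  moreover have "\<bar>F 4 t1 + F 4 t2\<bar> / 24 * h\<^sup>2 \<le> 2 * B / 24 * h\<^sup>2"
    using B[of t1] B[of t2] by (intro mult_right_mono divide_right_mono) auto
  moreover have "\<bar>(F 4 t1 + F 4 t2) / 24 * h\<^sup>2\<bar> = \<bar>F 4 t1 + F 4 t2\<bar> / 24 * h\<^sup>2" by (simp add: abs_mult)
  moreover have "2 * B / 24 * h\<^sup>2 = B / 12 * h\<^sup>2" by simp
  ultimately show ?thesis by (simp only:)
qed

lemma rect_eq_box: "rect a b c d = box (a, c) (b, d)"
  by (auto simp: rect_def box_def Basis_prod_def)

lemma set_integrable_rect:
  fixes f :: "real \<times> real \<Rightarrow> real"
  assumes "continuous_on (cbox (a, c) (b, d)) f"
  shows "set_integrable lebesgue (rect a b c d) f"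
  using absolutely_integrable_continuous[OF assms] box_subset_cbox[of "(a, c)" "(b, d)"]
  unfolding rect_eq_box by (auto intro: set_integrable_subset)

lemma set_lebesgue_integral_rect:
  fixes f :: "real \<times> real \<Rightarrow> real"
  assumes "continuous_on (cbox (a, c) (b, d)) f"
  shows "(LINT z:rect a b c d|lebesgue. f z) = integral (cbox (a, c) (b, d)) f"
  using set_integrable_rect[OF assms]
  by (simp add: set_lebesgue_integral_eq_integral rect_eq_box integral_open_interval)

lemma set_lebesgue_integral_bound:
  fixes g \<phi> :: "real \<times> real \<Rightarrow> real"
  assumes \<phi>: "continuous_on (cbox (a, c) (b, d)) \<phi>" "\<And>z. 0 \<le> \<phi> z"
    and g: "AE z in lebesgue_on (rect a b c d). \<bar>g z\<bar> \<le> B" and B: "0 \<le> B"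
  shows "\<bar>LINT z:rect a b c d|lebesgue. g z * \<phi> z\<bar> \<le> B * integral (cbox (a, c) (b, d)) \<phi>"
proof -
  define R where "R = rect a b c d"
  have R: "R \<in> sets lebesgue" unfolding R_def rect_eq_box by (simp add: borel_open)
  have int: "integrable lebesgue (\<lambda>z. indicator R z *\<^sub>R (B * \<phi> z))"
    unfolding R_def set_integrable_def[symmetric]
    by (intro set_integrable_rect continuous_intros \<phi>(1))
  have ae: "AE z in lebesgue. z \<in> R \<longrightarrow> \<bar>g z\<bar> \<le> B"
    using g R by (simp add: AE_restrict_space_iff R_def)
  have nonneg: "AE z in lebesgue. 0 \<le> indicator R z *\<^sub>R (B * \<phi> z)"
    using \<phi>(2) B by (auto simp: indicator_def)
  have le: "(LINT z:R|lebesgue. s * (g z * \<phi> z)) \<le> (LINT z:R|lebesgue. B * \<phi> z)" if s: "\<bar>s\<bar> = 1" for s :: real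
    unfolding set_lebesgue_integral_def
  proof (rule integral_mono_AE'[OF int _ nonneg])
    show "AE z in lebesgue. indicator R z *\<^sub>R (s * (g z * \<phi> z)) \<le> indicator R z *\<^sub>R (B * \<phi> z)"
      using ae
    proof eventually_elim
      case (elim z)
      have "s * (g z * \<phi> z) \<le> \<bar>s * (g z * \<phi> z)\<bar>" by simp
      also have "\<dots> = \<bar>g z\<bar> * \<phi> z" using s \<phi>(2)[of z] by (simp add: abs_mult)
      finally show ?case using elim \<phi>(2)[of z] by (auto simp: indicator_def intro: order_trans mult_right_mono)
    qed
  qed
  have "(LINT z:R|lebesgue. \<phi> z) = integral (cbox (a, c) (b, d)) \<phi>"
    unfolding R_def by (rule set_lebesgue_integral_rect[OF \<phi>(1)])
  moreover have "(LINT z:R|lebesgue. - (g z * \<phi> z)) = - (LINT z:R|lebesgue. g z * \<phi> z)"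
    by (simp add: set_lebesgue_integral_def)
  ultimately show ?thesis using le[of 1] le[of "-1"] by (simp add: R_def abs_le_iff)
qed

text \<open>Convolution with a trigonometric kernel turns the weak fourth derivative in the direction
  \<open>e\<close> into a classical one with the same bound.\<close>

locale weak_fourth_derivative =
  fixes a b c d B :: real and e :: "real \<times> real" and v g :: "real \<times> real \<Rightarrow> real"
  assumes ab: "a < b" "c < d" and e: "e = (1, 0) \<or> e = (0, 1)"
    and v_cont: "continuous_on UNIV v" and v_periodic: "rect_periodic a b c d v"
    and B_nonneg: "0 \<le> B" and g_bound: "AE z in lebesgue_on (rect a b c d). \<bar>g z\<bar> \<le> B"
    and weak: "\<And>\<phi>. \<phi> \<in> trig_fun \<Longrightarrow> rect_periodic a b c d \<phi> \<Longrightarrow>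
      (LINT z:rect a b c d|lebesgue. v z * (partial e ^^ 4) \<phi> z) = (LINT z:rect a b c d|lebesgue. g z * \<phi> z)"
begin

definition kernel :: "nat \<Rightarrow> real \<times> real \<Rightarrow> real" where
  "kernel m z = bump (b - a) (d - c) z ^ m"

definition mass :: "nat \<Rightarrow> real" where
  "mass m = integral (cbox (a, c) (b, d)) (\<lambda>y. kernel m (0 - y))"

definition mollified :: "nat \<Rightarrow> nat \<Rightarrow> real \<times> real \<Rightarrow> real" where
  "mollified m j z = integral (cbox (a, c) (b, d)) (\<lambda>y. v y * (partial e ^^ j) (kernel m) (z - y))"

lemma kernel_trig_fun: "kernel m \<in> trig_fun"
  unfolding kernel_def[abs_def] by (rule bump_power_trig_fun)

lemma partial_kernel_trig_fun: "(partial e ^^ j) (kernel m) \<in> trig_fun"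
  by (rule partial_pow_trig_fun[OF kernel_trig_fun e])

lemma v_cont_on: "continuous_on S v"
  by (rule continuous_on_subset[OF v_cont]) auto

lemma mollified_DERIV:
  "((\<lambda>s. mollified m j (z + s *\<^sub>R e)) has_real_derivative mollified m (Suc j) (z + s *\<^sub>R e)) (at s)"
proof -
  define f where "f = (partial e ^^ j) (kernel m)"
  have f: "f \<in> trig_fun" unfolding f_def by (rule partial_kernel_trig_fun)
  have f': "partial e f \<in> trig_fun" by (rule partial_trig_fun[OF f e])
  have "((\<lambda>s. integral (cbox (a, c) (b, d)) (\<lambda>y. v y * f (z + s *\<^sub>R e - y))) has_real_derivative
      integral (cbox (a, c) (b, d)) (\<lambda>y. v y * partial e f (z + s *\<^sub>R e - y))) (at s within UNIV)"
  proof (rule leibniz_rule_field_derivative[where U = UNIV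
        and f = "\<lambda>s y. v y * f (z + s *\<^sub>R e - y)" and fx = "\<lambda>s y. v y * partial e f (z + s *\<^sub>R e - y)"])
    show "((\<lambda>s. v y * f (z + s *\<^sub>R e - y)) has_real_derivative v y * partial e f (z + s *\<^sub>R e - y))
        (at s within UNIV)" for s y
      using DERIV_cmult[OF DERIV_partial[OF f e, of "z - y" s], of "v y"] by (simp add: algebra_simps)
    show "(\<lambda>y. v y * f (z + s *\<^sub>R e - y)) integrable_on cbox (a, c) (b, d)" for s
      by (intro integrable_continuous continuous_intros v_cont_on trig_fun_compose_continuous[OF f])
    have "continuous_on (UNIV \<times> cbox (a, c) (b, d)) (\<lambda>p. v (snd p))"
      by (rule continuous_on_compose2[OF v_cont]) (auto intro!: continuous_intros)
    then show "continuous_on (UNIV \<times> cbox (a, c) (b, d)) (\<lambda>(s, y). v y * partial e f (z + s *\<^sub>R e - y))"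
      unfolding split_beta
      by (intro continuous_on_mult trig_fun_compose_continuous[OF f'] continuous_intros)
  qed auto
  then show ?thesis by (simp add: mollified_def f_def)
qed

lemma kernel_reflect_periodic: "rect_periodic a b c d (\<lambda>y. kernel m (z - y))"
proof -
  have shift: "cos (2 * pi / L * (x - (y + L)) + 0) = cos (2 * pi / L * (x - y) + 0)" if "0 < L" for L x y :: real
  proof -
    have "2 * pi / L * (x - y) = 2 * pi / L * (x - (y + L)) + 2 * pi" using that by (simp add: field_simps)
    then show ?thesis by simp
  qed
  show ?thesis using ab shift[of "b - a"] shift[of "d - c"]
    by (cases z) (simp add: rect_periodic_def kernel_def bump_def)
qed

text \<open>Four integrations by parts in the definition of the weak derivative move the derivatives
  from the kernel to the function.\<close>

lemma mollified_4_bound: "\<bar>mollified m 4 z\<bar> \<le> B * mass m"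
proof -
  define \<phi> where "\<phi> y = kernel m (z - y)" for y
  have \<phi>: "\<phi> \<in> trig_fun" unfolding \<phi>_def[abs_def] by (rule trig_fun_reflect[OF kernel_trig_fun])
  have D: "(partial e ^^ 4) \<phi> = (\<lambda>y. (partial e ^^ 4) (kernel m) (z - y))"
    using partial_pow_reflect[OF kernel_trig_fun e, of 4 m z] by (simp add: \<phi>_def[abs_def])
  have "mollified m 4 z = (LINT y:rect a b c d|lebesgue. v y * (partial e ^^ 4) \<phi> y)"
    unfolding mollified_def D by (subst set_lebesgue_integral_rect)
      (auto intro!: continuous_intros v_cont_on trig_fun_compose_continuous[OF partial_kernel_trig_fun])
  also have "\<dots> = (LINT y:rect a b c d|lebesgue. g y * \<phi> y)"
    using kernel_reflect_periodic[of m z] by (intro weak \<phi>) (simp add: \<phi>_def[abs_def])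
  also have "\<bar>\<dots>\<bar> \<le> B * integral (cbox (a, c) (b, d)) \<phi>" using bump_bounds(1)
    by (intro set_lebesgue_integral_bound trig_fun_continuous \<phi> g_bound B_nonneg) (auto simp: \<phi>_def kernel_def)
  also have "integral (cbox (a, c) (b, d)) \<phi> = mass m"
    unfolding mass_def \<phi>_def[abs_def] kernel_def using bump_mean_const[OF ab] by simp
  finally show ?thesis .
qed

lemma mass_pos: "\<forall>\<^sub>F m in sequentially. 0 < mass m"
  using bump_concentration[OF ab, of "\<lambda>_. 1" 0] by (simp add: mass_def kernel_def)

text \<open>Taylor's formula compares both second differences of the mollified function with the same
  second derivative; the mollified functions converge to \<open>v\<close>.\<close>

lemma second_diff_cauchy:
  assumes h: "h \<noteq> 0" and k: "k \<noteq> 0"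
  shows "\<bar>second_diff e h v z - second_diff e k v z\<bar> \<le> B / 12 * (h\<^sup>2 + k\<^sup>2)"
proof -
  define w where "w m y = mollified m 0 y / mass m" for m y
  have lim: "(\<lambda>m. w m y) \<longlonglongrightarrow> v y" for y
  proof (rule metric_LIMSEQ_I)
    fix r :: real assume r: "0 < r"
    have "\<forall>\<^sub>F m in sequentially. \<bar>mollified m 0 y - v y * mass m\<bar> \<le> r / 2 * mass m"
      using periodic_mollification[OF ab v_cont v_periodic, of "r / 2" y] r
      by (simp add: mollified_def mass_def kernel_def)
    with mass_pos have "\<forall>\<^sub>F m in sequentially. dist (w m y) (v y) < r"
    proof eventually_elim
      case (elim m)
      then have "w m y - v y = (mollified m 0 y - v y * mass m) / mass m"
        by (simp add: w_def field_simps)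
      then have "\<bar>w m y - v y\<bar> \<le> r / 2" using elim by (simp add: abs_divide pos_divide_le_eq)
      then show ?case using r by (simp add: dist_real_def)
    qed
    then show "\<exists>n0. \<forall>m\<ge>n0. dist (w m y) (v y) < r" by (simp add: eventually_sequentially)
  qed
  have le: "\<forall>\<^sub>F m in sequentially. \<bar>second_diff e h (w m) z - second_diff e k (w m) z\<bar> \<le> B / 12 * (h\<^sup>2 + k\<^sup>2)"
    using mass_pos
  proof eventually_elim
    case (elim m)
    define F where "F j s = mollified m j (z + s *\<^sub>R e) / mass m" for j s
    have F: "(F j has_real_derivative F (Suc j) s) (at s)" for j s
      unfolding F_def[abs_def] by (rule DERIV_cdivide[OF mollified_DERIV])
    have F4: "\<bar>F 4 s\<bar> \<le> B" for s
      using mollified_4_bound[of m "z + s *\<^sub>R e"] elim by (simp add: F_def abs_divide pos_divide_le_eq)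
    have sd: "second_diff e x (w m) z = (F 0 x - 2 * F 0 0 + F 0 (- x)) / x\<^sup>2" for x
      by (simp add: second_diff_def w_def F_def)
    show ?case using second_difference_taylor[OF F F4 h] second_difference_taylor[OF F F4 k]
      unfolding sd distrib_left by linarith
  qed
  have "(\<lambda>m. \<bar>second_diff e h (w m) z - second_diff e k (w m) z\<bar>)
      \<longlonglongrightarrow> \<bar>second_diff e h v z - second_diff e k v z\<bar>"
    unfolding second_diff_def using h k by (intro tendsto_intros lim) auto
  then show ?thesis using le by (intro tendsto_upperbound) auto
qed

text \<open>Letting the second step size tend to zero gives the classical second derivative where it
  exists.\<close>

lemma second_diff_error:
  assumes "0 < r" and D: "\<And>s. \<bar>s\<bar> < r \<Longrightarrow> ((\<lambda>s. v (z + s *\<^sub>R e)) has_real_derivative D s) (at s)"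
    and D': "(D has_real_derivative D') (at 0)" and h: "h \<noteq> 0"
  shows "\<bar>second_diff e h v z - D'\<bar> \<le> B / 12 * h\<^sup>2"
proof -
  define f where "f s = v (z + s *\<^sub>R e)" for s
  have small: "\<forall>\<^sub>F k in at_right 0. 0 < k \<and> \<bar>k\<bar> < r"
    using eventually_at_right_less[of 0] eventually_at_right_field[of "\<lambda>k. k < r" 0] \<open>0 < r\<close>
    by (auto elim: eventually_elim2)
  have f: "(f has_real_derivative D s) (at s)" if "\<bar>s\<bar> < r" for s
    using D[OF that] by (simp add: f_def[abs_def])
  have fm: "((\<lambda>k. f (- k)) has_real_derivative - D (- k)) (at k)" if "\<bar>k\<bar> < r" for k
    using f[of "- k"] that DERIV_mirror by simp
  have cont: "continuous (at_right 0) f"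
    by (rule continuous_at_imp_continuous_at_within[OF DERIV_isCont[OF f]]) (use \<open>0 < r\<close> in simp)
  have contm: "continuous (at_right 0) (\<lambda>k. f (- k))"
    by (rule continuous_at_imp_continuous_at_within[OF DERIV_isCont[OF fm]]) (use \<open>0 < r\<close> in simp)
  have "((\<lambda>k. (f k - 2 * f 0 + f (- k)) / k\<^sup>2) \<longlongrightarrow> D') (at_right 0)"
  proof (rule lhopital_right_0[where f' = "\<lambda>k. D k - D (- k)" and g' = "\<lambda>k. 2 * k"])
    have "((\<lambda>k. f k - 2 * f 0 + f (- k)) \<longlongrightarrow> f 0 - 2 * f 0 + f (- 0)) (at_right 0)"
      using cont contm unfolding continuous_within by (intro tendsto_intros)
    then show "((\<lambda>k. f k - 2 * f 0 + f (- k)) \<longlongrightarrow> 0) (at_right 0)" by simp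
    have "((\<lambda>k :: real. k\<^sup>2) \<longlongrightarrow> 0\<^sup>2) (at_right 0)" by (intro tendsto_intros)
    then show "((\<lambda>k :: real. k\<^sup>2) \<longlongrightarrow> 0) (at_right 0)" by simp
    show "\<forall>\<^sub>F k in at_right 0. k\<^sup>2 \<noteq> (0 :: real)" "\<forall>\<^sub>F k in at_right 0. 2 * k \<noteq> (0 :: real)"
      using small by (auto elim: eventually_mono)
    show "\<forall>\<^sub>F k in at_right 0. ((\<lambda>k. f k - 2 * f 0 + f (- k)) has_real_derivative D k - D (- k)) (at k)"
      using small
    proof eventually_elim
      case (elim k)
      then show ?case using DERIV_add[OF DERIV_diff[OF f[of k] DERIV_const[of "2 * f 0"]] fm[of k]] by auto
    qed
    show "\<forall>\<^sub>F k in at_right 0. ((\<lambda>k. k\<^sup>2) has_real_derivative 2 * k) (at k)"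
      by (auto intro!: always_eventually derivative_eq_intros)
    have "((\<lambda>k. (D k - D 0) / k) \<longlongrightarrow> D') (at_right 0)"
      using D' unfolding has_field_derivative_iff by (auto intro: tendsto_mono[OF at_le])
    moreover have "((\<lambda>k. (D (- k) - D 0) / - k) \<longlongrightarrow> D') (at_right 0)"
    proof -
      have "((\<lambda>k. (D k - D 0) / k) \<longlongrightarrow> D') (at_left 0)"
        using D' unfolding has_field_derivative_iff by (auto intro: tendsto_mono[OF at_le])
      then show ?thesis by (simp add: at_left_minus filterlim_filtermap)
    qed
    ultimately have "((\<lambda>k. ((D k - D 0) / k + (D (- k) - D 0) / - k) / 2) \<longlongrightarrow> (D' + D') / 2) (at_right 0)"
      by (intro tendsto_intros) auto
    then show "((\<lambda>k. (D k - D (- k)) / (2 * k)) \<longlongrightarrow> D') (at_right 0)"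
      by (simp add: mult.commute add_divide_distrib diff_divide_distrib)
  qed
  then have lim: "((\<lambda>k. second_diff e k v z) \<longlongrightarrow> D') (at_right 0)"
    by (simp add: second_diff_def f_def)
  have "((\<lambda>k. B / 12 * (h\<^sup>2 + k\<^sup>2)) \<longlongrightarrow> B / 12 * (h\<^sup>2 + 0\<^sup>2)) (at_right 0)" by (intro tendsto_intros)
  moreover have "((\<lambda>k. \<bar>second_diff e h v z - second_diff e k v z\<bar>) \<longlongrightarrow> \<bar>second_diff e h v z - D'\<bar>) (at_right 0)"
    by (intro tendsto_intros lim)
  moreover have "\<forall>\<^sub>F k in at_right 0. \<bar>second_diff e h v z - second_diff e k v z\<bar> \<le> B / 12 * (h\<^sup>2 + k\<^sup>2)"
    using small by eventually_elim (use second_diff_cauchy[OF h] in auto)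
  ultimately have "\<bar>second_diff e h v z - D'\<bar> \<le> B / 12 * (h\<^sup>2 + 0\<^sup>2)"
    by (rule tendsto_le[OF trivial_limit_at_right_real])
  then show ?thesis by simp
qed

end

section \<open>The discrete Laplacian\<close>

text \<open>With at least three points the two periodic neighbours of a point are distinct.\<close>

lemma circ_mat_sum:
  assumes "3 \<le> M" "i < M"
  shows "(\<Sum>k<M. circ_mat M h i k * x k) =
    (x (if i = M - 1 then 0 else i + 1) - 2 * x i + x (if i = 0 then M - 1 else i - 1)) / h\<^sup>2"
proof -
  define p where "p = (if i = M - 1 then 0 else i + 1)"
  define q where "q = (if i = 0 then M - 1 else i - 1)"
  have pq: "p < M" "q < M" using assms by (auto simp: p_def q_def)
  have "circ_mat M h i k * x k =
      1 / h\<^sup>2 * ((if k = i then - 2 * x i else 0) + (if k = p then x p else 0) + (if k = q then x q else 0))"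
    if "k < M" for k
  proof -
    have ne: "p \<noteq> i" "q \<noteq> i" "p \<noteq> q" using assms by (auto simp: p_def q_def)
    have "(k = i + 1 \<or> i = k + 1 \<or> (i = 0 \<and> k = M - 1) \<or> (i = M - 1 \<and> k = 0)) \<longleftrightarrow> k = p \<or> k = q"
      using assms that unfolding p_def q_def by (cases "i = 0"; cases "i = M - 1") auto
    then have "circ_mat M h i k = 1 / h\<^sup>2 * (if i = k then - 2 else if k = p \<or> k = q then 1 else 0)"
      by (simp only: circ_mat_def)
    then show ?thesis using ne by auto
  qed
  then have "(\<Sum>k<M. circ_mat M h i k * x k) = (\<Sum>k<M.
      1 / h\<^sup>2 * ((if k = i then - 2 * x i else 0) + (if k = p then x p else 0) + (if k = q then x q else 0)))"
    by (intro sum.cong) auto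
  also have "\<dots> = 1 / h\<^sup>2 * (- 2 * x i + x p + x q)"
    using assms pq unfolding sum_distrib_left[symmetric] sum.distrib by (simp add: sum.delta)
  finally show ?thesis unfolding p_def[symmetric] q_def[symmetric]
    by (simp add: add_divide_distrib diff_divide_distrib)
qed

lemma circ_mat_sum_nonpos:
  assumes "3 \<le> M" "i < M" "\<And>k. k < M \<Longrightarrow> x k \<le> x i"
  shows "(\<Sum>k<M. circ_mat M h i k * x k) \<le> 0"
proof -
  have "x (if i = M - 1 then 0 else i + 1) \<le> x i" by (rule assms(3)) (use assms(1,2) in auto)
  moreover have "x (if i = 0 then M - 1 else i - 1) \<le> x i"
    by (rule assms(3)) (use assms(1,2) in auto)
  ultimately show ?thesis unfolding circ_mat_sum[OF assms(1,2)] by (intro divide_nonpos_nonneg) auto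
qed

lemma circ_mat_sum_periodic:
  assumes M: "3 \<le> M" "i < M" and f: "\<And>x. f (x + (b - a)) = f x"
  defines "h \<equiv> mesh_width a b M"
  shows "(\<Sum>k<M. circ_mat M h i k * f (a + real k * h)) =
    (f (a + real i * h + h) - 2 * f (a + real i * h) + f (a + real i * h - h)) / h\<^sup>2"
proof -
  have Mh: "real M * h = b - a" using M by (simp add: h_def mesh_width_def)
  have up: "f (a + real (if i = M - 1 then 0 else i + 1) * h) = f (a + real i * h + h)"
  proof (cases "i = M - 1")
    case True
    then have "real i * h + h = b - a" using M Mh by (simp add: of_nat_diff algebra_simps)
    then have "a + real i * h + h = a + (b - a)" by linarith
    then show ?thesis using f[of a] True by simp
  qed (simp add: algebra_simps)
  have down: "f (a + real (if i = 0 then M - 1 else i - 1) * h) = f (a + real i * h - h)"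
  proof (cases "i = 0")
    case True
    then have "a + real (M - 1) * h = a + real i * h - h + (b - a)"
      using M Mh by (simp add: of_nat_diff algebra_simps)
    then show ?thesis using f[of "a + real i * h - h"] True by simp
  qed (simp add: of_nat_diff algebra_simps)
  show ?thesis unfolding circ_mat_sum[OF M] up down ..
qed

lemma discrete_laplacian_eq:
  assumes "i < M1" "j < M2"
  shows "discrete_laplacian M1 M2 h1 h2 v i j =
    (\<Sum>k<M1. circ_mat M1 h1 i k * v k j) + (\<Sum>l<M2. circ_mat M2 h2 j l * v i l)"
proof -
  have "discrete_laplacian M1 M2 h1 h2 v i j =
      (\<Sum>l<M2. (\<Sum>k<M1. id_mat j l * (circ_mat M1 h1 i k * v k l)) + (\<Sum>k<M1. circ_mat M2 h2 j l * (id_mat i k * v k l)))"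
    by (simp add: discrete_laplacian_def distrib_right sum.distrib mult.assoc)
  also have "\<dots> = (\<Sum>l<M2. (if l = j then (\<Sum>k<M1. circ_mat M1 h1 i k * v k l) else 0) + circ_mat M2 h2 j l * v i l)"
  proof (rule sum.cong[OF refl])
    fix l
    have "(\<Sum>k<M1. circ_mat M2 h2 j l * (id_mat i k * v k l)) = (\<Sum>k<M1. if k = i then circ_mat M2 h2 j l * v i l else 0)"
      by (intro sum.cong) (auto simp: id_mat_def)
    then show "(\<Sum>k<M1. id_mat j l * (circ_mat M1 h1 i k * v k l)) + (\<Sum>k<M1. circ_mat M2 h2 j l * (id_mat i k * v k l))
        = (if l = j then (\<Sum>k<M1. circ_mat M1 h1 i k * v k l) else 0) + circ_mat M2 h2 j l * v i l"
      using assms by (auto simp: id_mat_def)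
  qed
  also have "\<dots> = (\<Sum>k<M1. circ_mat M1 h1 i k * v k j) + (\<Sum>l<M2. circ_mat M2 h2 j l * v i l)"
    using assms by (simp add: sum.distrib)
  finally show ?thesis .
qed

lemma discrete_laplacian_linear:
  "discrete_laplacian M1 M2 h1 h2 (\<lambda>i j. v i j - w i j) i j =
    discrete_laplacian M1 M2 h1 h2 v i j - discrete_laplacian M1 M2 h1 h2 w i j"
  by (simp add: discrete_laplacian_def right_diff_distrib sum_subtractf)

lemma discrete_laplacian_max_le:
  assumes "3 \<le> M1" "3 \<le> M2" "i < M1" "j < M2"
    and "\<And>k l. k < M1 \<Longrightarrow> l < M2 \<Longrightarrow> s * v k l \<le> s * v i j"
  shows "s * discrete_laplacian M1 M2 h1 h2 v i j \<le> 0"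
proof -
  have "s * discrete_laplacian M1 M2 h1 h2 v i j =
      (\<Sum>k<M1. circ_mat M1 h1 i k * (s * v k j)) + (\<Sum>l<M2. circ_mat M2 h2 j l * (s * v i l))"
    by (simp add: discrete_laplacian_eq assms distrib_left sum_distrib_left mult_ac)
  also have "\<dots> \<le> 0" using assms by (intro add_nonpos_nonpos circ_mat_sum_nonpos) auto
  finally show ?thesis .
qed

definition five_point :: "real \<Rightarrow> real \<Rightarrow> (real \<times> real \<Rightarrow> real) \<Rightarrow> real \<times> real \<Rightarrow> real" where
  "five_point h1 h2 v z = second_diff (1, 0) h1 v z + second_diff (0, 1) h2 v z"

lemma discrete_laplacian_grid_function:
  assumes M: "3 \<le> M1" "3 \<le> M2" "i < M1" "j < M2" and v: "rect_periodic a b c d v"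
  defines "h1 \<equiv> mesh_width a b M1" and "h2 \<equiv> mesh_width c d M2"
  shows "discrete_laplacian M1 M2 h1 h2 (\<lambda>i j. v (grid_point a b c d M1 M2 i j)) i j =
    five_point h1 h2 v (grid_point a b c d M1 M2 i j)"
proof -
  have "(\<Sum>k<M1. circ_mat M1 h1 i k * v (a + real k * h1, c + real j * h2)) =
      (v (a + real i * h1 + h1, c + real j * h2) - 2 * v (a + real i * h1, c + real j * h2)
        + v (a + real i * h1 - h1, c + real j * h2)) / h1\<^sup>2"
    unfolding h1_def
    by (rule circ_mat_sum_periodic[OF M(1,3), where f = "\<lambda>x. v (x, c + real j * h2)"])
      (use v in \<open>simp add: rect_periodic_def\<close>)
  moreover have "(\<Sum>l<M2. circ_mat M2 h2 j l * v (a + real i * h1, c + real l * h2)) =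
      (v (a + real i * h1, c + real j * h2 + h2) - 2 * v (a + real i * h1, c + real j * h2)
        + v (a + real i * h1, c + real j * h2 - h2)) / h2\<^sup>2"
    unfolding h2_def
    by (rule circ_mat_sum_periodic[OF M(2,4), where f = "\<lambda>y. v (a + real i * h1, y)"])
      (use v in \<open>simp add: rect_periodic_def\<close>)
  ultimately show ?thesis
    by (simp add: discrete_laplacian_eq[OF M(3,4)] grid_point_def five_point_def second_diff_def h1_def h2_def)
qed

section \<open>Consistency in space\<close>

text \<open>The norm is an infimum, so the bound for the chosen weak derivatives has to be slightly larger.\<close>

lemma Winf_norm_obtain:
  assumes "Winf_norm a b c d k v \<le> ereal C" "C < B"
  obtains g where "\<And>i j. i + j \<le> k \<Longrightarrow> has_weak_deriv a b c d i j v (g i j)"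
    and "\<And>i j. i + j \<le> k \<Longrightarrow> AE z in lebesgue_on (rect a b c d). \<bar>g i j z\<bar> \<le> B"
proof -
  have "Winf_norm a b c d k v < ereal B" using assms by (simp add: le_less_trans)
  then obtain g where g: "\<forall>i j. i + j \<le> k \<longrightarrow> has_weak_deriv a b c d i j v (g i j)"
    and less: "(SUP (i, j)\<in>{(i, j). i + j \<le> k}. Linf_norm (rect a b c d) (g i j)) < ereal B"
    unfolding Winf_norm_def INF_less_iff by auto
  show ?thesis
  proof (rule that)
    fix i j assume ij: "i + j \<le> k"
    then show "has_weak_deriv a b c d i j v (g i j)" using g by auto
    have "Linf_norm (rect a b c d) (g i j) \<le> (SUP (i, j)\<in>{(i, j). i + j \<le> k}. Linf_norm (rect a b c d) (g i j))"
      using ij by (intro SUP_upper2[of "(i, j)"]) auto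
    then have le: "Linf_norm (rect a b c d) (g i j) \<le> ereal B" using less by simp
    have "AE z in lebesgue_on (rect a b c d). ereal \<bar>g i j z\<bar> \<le> ereal B"
      using esssup_AE[of "\<lambda>z. ereal \<bar>g i j z\<bar>" "lebesgue_on (rect a b c d)"]
      by eventually_elim (rule order_trans[OF _ le[unfolded Linf_norm_def]])
    then show "AE z in lebesgue_on (rect a b c d). \<bar>g i j z\<bar> \<le> B" by simp
  qed
qed

text \<open>The classical derivatives are supplied by the partial differentiability in the open rectangle,
  the bound by the weak derivative on the torus.\<close>

lemma second_diff_partial_error:
  assumes ab: "a < b" "c < d" and e: "e = (1, 0) \<or> e = (0, 1)"
    and v: "continuous_on UNIV v" "rect_periodic a b c d v"
    and g: "AE z in lebesgue_on (rect a b c d). \<bar>g z\<bar> \<le> B" and B: "0 \<le> B"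
    and weak: "\<And>\<phi>. \<phi> \<in> trig_fun \<Longrightarrow> rect_periodic a b c d \<phi> \<Longrightarrow>
      (LINT z:rect a b c d|lebesgue. v z * (partial e ^^ 4) \<phi> z) = (LINT z:rect a b c d|lebesgue. g z * \<phi> z)"
    and diff: "\<And>y. y \<in> rect a b c d \<Longrightarrow> (\<lambda>s. v (y + s *\<^sub>R e)) differentiable (at 0)"
    and diff2: "(\<lambda>s. partial e v (z + s *\<^sub>R e)) differentiable (at 0)"
    and z: "z \<in> rect a b c d" and h: "h \<noteq> 0"
  shows "\<bar>second_diff e h v z - partial e (partial e v) z\<bar> \<le> B / 12 * h\<^sup>2"
proof -
  interpret weak_fourth_derivative a b c d B e v g
    by unfold_locales (use assms in auto)
  have "open (rect a b c d)" by (simp add: rect_def open_Times)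
  then obtain r where r: "0 < r" "ball z r \<subseteq> rect a b c d" using z by (auto simp: open_contains_ball)
  show ?thesis
  proof (rule second_diff_error[OF r(1) _ _ h])
    fix s :: real assume s: "\<bar>s\<bar> < r"
    have "norm e = 1" using e by auto
    then have "z + s *\<^sub>R e \<in> ball z r" using s by (simp add: dist_norm)
    then have "(\<lambda>x. v (z + s *\<^sub>R e + x *\<^sub>R e)) differentiable (at 0)" using r by (intro diff) auto
    then have "((\<lambda>x. v (z + s *\<^sub>R e + x *\<^sub>R e)) has_real_derivative partial e v (z + s *\<^sub>R e)) (at 0)"
      unfolding partial_def by (simp add: DERIV_deriv_iff_real_differentiable)
    then show "((\<lambda>s. v (z + s *\<^sub>R e)) has_real_derivative partial e v (z + s *\<^sub>R e)) (at s)"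
      using DERIV_shift[of "\<lambda>s. v (z + s *\<^sub>R e)" "partial e v (z + s *\<^sub>R e)" 0 s]
      by (simp add: scaleR_left_distrib add_ac)
  next
    show "((\<lambda>s. partial e v (z + s *\<^sub>R e)) has_real_derivative partial e (partial e v) z) (at 0)"
      using diff2 unfolding partial_def[of e "partial e v"] by (simp add: DERIV_deriv_iff_real_differentiable)
  qed
qed

lemma differentiable_shift:
  "(f :: real \<Rightarrow> real) differentiable (at x) \<longleftrightarrow> (\<lambda>s. f (x + s)) differentiable (at 0)"
  unfolding real_differentiable_def using DERIV_shift[of f _ 0 x] by (simp add: add.commute)

lemma discrete_laplacian_consistency:
  assumes ab: "a < b" "c < d" and v: "continuous_on UNIV v" "rect_periodic a b c d v"
    and W: "Winf_norm a b c d 4 v \<le> ereal C" "0 \<le> C"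
    and twice: "twice_partially_differentiable_on (rect a b c d) v"
    and z: "z \<in> rect a b c d" and h: "h1 \<noteq> 0" "h2 \<noteq> 0"
  shows "\<bar>five_point h1 h2 v z - laplacian v z\<bar> \<le> (C + 1) / 12 * (h1\<^sup>2 + h2\<^sup>2)"
proof -
  obtain g where g: "\<And>i j. i + j \<le> 4 \<Longrightarrow> has_weak_deriv a b c d i j v (g i j)"
    "\<And>i j. i + j \<le> 4 \<Longrightarrow> AE z in lebesgue_on (rect a b c d). \<bar>g i j z\<bar> \<le> C + 1"
    using Winf_norm_obtain[OF W(1), of "C + 1"] by auto
  have tw: "(\<lambda>s. v (s, y)) differentiable (at x)" "(\<lambda>s. px v (s, y)) differentiable (at x)"
    "(\<lambda>s. v (x, s)) differentiable (at y)" "(\<lambda>s. py v (x, s)) differentiable (at y)"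
    if "(x, y) \<in> rect a b c d" for x y
    using twice that unfolding twice_partially_differentiable_on_def by auto
  have "\<bar>second_diff (1, 0) h1 v z - partial (1, 0) (partial (1, 0) v) z\<bar> \<le> (C + 1) / 12 * h1\<^sup>2"
  proof (rule second_diff_partial_error[OF ab _ v g(2)[of 4 0]])
    show "(LINT z:rect a b c d|lebesgue. v z * (partial (1, 0) ^^ 4) \<phi> z) = (LINT z:rect a b c d|lebesgue. g 4 0 z * \<phi> z)"
      if "\<phi> \<in> trig_fun" "rect_periodic a b c d \<phi>" for \<phi>
      using g(1)[of 4 0] smooth_fun_trig[OF that(1)] that(2) by (simp add: has_weak_deriv_def px_eq_partial)
    show "(\<lambda>s. v (y + s *\<^sub>R (1, 0))) differentiable (at 0)" if "y \<in> rect a b c d" for y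
      using that tw(1)[of "fst y" "snd y"] differentiable_shift[of "\<lambda>s. v (s, snd y)" "fst y"]
      by (cases y) simp
    show "(\<lambda>s. partial (1, 0) v (z + s *\<^sub>R (1, 0))) differentiable (at 0)"
      using z tw(2)[of "fst z" "snd z"] differentiable_shift[of "\<lambda>s. px v (s, snd z)" "fst z"]
      by (cases z) (simp add: px_eq_partial)
  qed (use W z h in auto)
  moreover have "\<bar>second_diff (0, 1) h2 v z - partial (0, 1) (partial (0, 1) v) z\<bar> \<le> (C + 1) / 12 * h2\<^sup>2"
  proof (rule second_diff_partial_error[OF ab _ v g(2)[of 0 4]])
    show "(LINT z:rect a b c d|lebesgue. v z * (partial (0, 1) ^^ 4) \<phi> z) = (LINT z:rect a b c d|lebesgue. g 0 4 z * \<phi> z)"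
      if "\<phi> \<in> trig_fun" "rect_periodic a b c d \<phi>" for \<phi>
      using g(1)[of 0 4] smooth_fun_trig[OF that(1)] that(2) by (simp add: has_weak_deriv_def py_eq_partial)
    show "(\<lambda>s. v (y + s *\<^sub>R (0, 1))) differentiable (at 0)" if "y \<in> rect a b c d" for y
      using that tw(3)[of "fst y" "snd y"] differentiable_shift[of "\<lambda>s. v (fst y, s)" "snd y"]
      by (cases y) simp
    show "(\<lambda>s. partial (0, 1) v (z + s *\<^sub>R (0, 1))) differentiable (at 0)"
      using z tw(4)[of "fst z" "snd z"] differentiable_shift[of "\<lambda>s. py v (fst z, s)" "snd z"]
      by (cases z) (simp add: py_eq_partial)
  qed (use W z h in auto)
  ultimately show ?thesis
    unfolding five_point_def laplacian_def px_eq_partial py_eq_partial distrib_left by linarith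
qed

section \<open>The error equation\<close>

lemma grid_norm_ge:
  assumes "i < M1" "j < M2"
  shows "\<bar>v i j\<bar> \<le> grid_norm M1 M2 v"
  unfolding grid_norm_def using assms by (intro Max_ge) (auto intro!: image_eqI[of _ _ "(i, j)"])

lemma grid_norm_attained:
  assumes "0 < M1" "0 < M2"
  obtains i j where "i < M1" "j < M2" "grid_norm M1 M2 v = \<bar>v i j\<bar>"
proof -
  have "grid_norm M1 M2 v \<in> (\<lambda>(i, j). \<bar>v i j\<bar>) ` ({..<M1} \<times> {..<M2})"
    unfolding grid_norm_def using assms by (intro Max_in) (auto simp: lessThan_empty_iff)
  then show ?thesis using that by auto
qed

lemma grid_point_in_closure:
  assumes "a < b" "c < d" "i < M1" "j < M2"
  shows "grid_point a b c d M1 M2 i j \<in> closure (rect a b c d)"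
proof -
  have *: "0 \<le> real i * ((q - p) / real M)" "real i * ((q - p) / real M) \<le> q - p" if "p < q" "i < M" for p q :: real and i M
  proof -
    show "0 \<le> real i * ((q - p) / real M)" using that by simp
    have "real i * (q - p) \<le> real M * (q - p)" using that by (intro mult_right_mono) auto
    then show "real i * ((q - p) / real M) \<le> q - p" using that by (simp add: field_simps)
  qed
  have "box (a, c) (b, d) \<noteq> {}" using assms by (simp add: box_ne_empty Basis_prod_def)
  then have "closure (rect a b c d) = cbox (a, c) (b, d)" by (simp add: rect_eq_box closure_box)
  then show ?thesis
    using *[OF assms(1,3)] *[OF assms(2,4)] by (simp add: grid_point_def mesh_width_def cbox_Pair_eq)
qed

definition residual ::
  "real \<Rightarrow> real \<Rightarrow> (nat \<Rightarrow> real) \<Rightarrow> nat \<Rightarrow> (nat \<Rightarrow> real) \<Rightarrow> (nat \<Rightarrow> real) \<Rightarrow> real \<Rightarrow> real \<Rightarrow>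
   (real \<times> real \<Rightarrow> real \<Rightarrow> real) \<Rightarrow> nat \<Rightarrow> real \<times> real \<Rightarrow> real" where
  "residual \<alpha> \<epsilon> t Nq \<theta> w h1 h2 u n z =
     fast_L1 \<alpha> t Nq \<theta> w (\<lambda>k. u z (t k)) n - \<epsilon>\<^sup>2 * five_point h1 h2 (\<lambda>z. u z (t n)) z + AC_f (u z (t n))"

text \<open>The residual of the exact solution in the scheme is continuous in the space variable. This is
  how its bound reaches the grid points, which may lie in a null set or on the boundary.\<close>

lemma AE_bound_extends_to_closure:
  fixes f :: "'a::euclidean_space \<Rightarrow> real"
  assumes "continuous_on UNIV f" "open S" "AE z in lborel. z \<in> S \<longrightarrow> \<bar>f z\<bar> \<le> B" "z \<in> closure S"
  shows "\<bar>f z\<bar> \<le> B"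
proof -
  have "{z \<in> S. \<not> \<bar>f z\<bar> \<le> B} = S \<inter> {z. B < \<bar>f z\<bar>}" by auto
  moreover have "open {z. B < \<bar>f z\<bar>}" by (intro open_Collect_less continuous_intros assms(1))
  ultimately have "open {z \<in> S. \<not> \<bar>f z\<bar> \<le> B}" using assms(2) by (simp add: open_Int)
  then have "S \<subseteq> {z. \<bar>f z\<bar> \<le> B}" using AE_imp_all_if_open[OF assms(3)] by auto
  moreover have "closed {z. \<bar>f z\<bar> \<le> B}" by (intro closed_Collect_le continuous_intros assms(1))
  ultimately have "closure S \<subseteq> {z. \<bar>f z\<bar> \<le> B}" by (rule closure_minimal)
  then show ?thesis using assms(4) by auto
qed

text \<open>The cubic part of the nonlinearity is monotone, so only the linear part contributes.\<close>

lemma AC_f_one_sided_lipschitz: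
  assumes "\<bar>s\<bar> = 1" "s * (x - y) = \<bar>x - y\<bar>"
  shows "- (s * (AC_f x - AC_f y)) \<le> \<bar>x - y\<bar>"
proof -
  have "AC_f x - AC_f y = (x - y) * (x\<^sup>2 + x * y + y\<^sup>2) - (x - y)"
    by (simp add: AC_f_def algebra_simps power2_eq_square power3_eq_cube)
  then have "s * (AC_f x - AC_f y) = \<bar>x - y\<bar> * (x\<^sup>2 + x * y + y\<^sup>2) - \<bar>x - y\<bar>"
    using assms(2) by (metis (no_types, opaque_lifting) mult.assoc right_diff_distrib)
  moreover have "0 \<le> x\<^sup>2 + x * y + y\<^sup>2"
  proof -
    have "x\<^sup>2 + x * y + y\<^sup>2 = (x + y / 2)\<^sup>2 + 3 / 4 * y\<^sup>2" by (simp add: power2_eq_square field_simps)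
    then show ?thesis by simp
  qed
  ultimately show ?thesis by simp
qed

text \<open>At a grid point where the error is largest, the discrete Laplacian and the cubic term have
  the favourable sign.\<close>

lemma error_inequality:
  fixes a b c d T \<alpha> \<epsilon> \<rho> tol \<Delta>t :: real
  assumes fast: "fast_L1_mesh \<alpha> T \<rho> tol \<Delta>t N Nq t \<theta> w"
    and M: "3 \<le> M1" "3 \<le> M2"
    and be: "backward_euler a b c d \<alpha> \<epsilon> u0 N t Nq \<theta> w M1 M2 U"
    and per: "rect_periodic a b c d (\<lambda>z. u z (t n))"
    and n: "n \<in> {1..N}"
    and res: "\<And>i j. i < M1 \<Longrightarrow> j < M2 \<Longrightarrow>
      \<bar>residual \<alpha> \<epsilon> t Nq \<theta> w (mesh_width a b M1) (mesh_width c d M2) u n (grid_point a b c d M1 M2 i j)\<bar> \<le> R"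
  shows "discrete_caputo (fast_kernel \<alpha> t Nq \<theta> w) (max_error a b c d u t M1 M2 U) n
    \<le> max_error a b c d u t M1 M2 U n + R"
proof -
  interpret fast_L1_mesh \<alpha> T \<rho> tol \<Delta>t N Nq t \<theta> w by fact
  define E where "E = max_error a b c d u t M1 M2 U"
  define err where "err k i j = u (grid_point a b c d M1 M2 i j) (t k) - U k i j" for k i j
  have E: "E k = grid_norm M1 M2 (err k)" for k by (simp add: E_def max_error_def err_def[abs_def])
  obtain i j where ij: "i < M1" "j < M2" "E n = \<bar>err n i j\<bar>"
    using grid_norm_attained[of M1 M2 "err n"] M unfolding E by auto
  define s :: real where "s = (if 0 \<le> err n i j then 1 else - 1)"
  have s: "\<bar>s\<bar> = 1" "s * err n i j = E n" using ij(3) by (auto simp: s_def)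
  define z where "z = grid_point a b c d M1 M2 i j"
  define D where "D v = discrete_laplacian M1 M2 (mesh_width a b M1) (mesh_width c d M2) v i j" for v
  have "discrete_caputo A E n \<le> s * discrete_caputo A (\<lambda>k. err k i j) n"
    using grid_norm_ge[OF ij(1,2)] by (intro discrete_caputo_norm_le[OF n]) (auto simp: s E)
  also have "discrete_caputo A (\<lambda>k. err k i j) n
      = fast_L1 \<alpha> t Nq \<theta> w (\<lambda>k. u z (t k)) n - fast_L1 \<alpha> t Nq \<theta> w (\<lambda>k. U k i j) n"
    unfolding fast_L1_eq_discrete_caputo err_def z_def[symmetric] by (rule discrete_caputo_diff)
  also have "fast_L1 \<alpha> t Nq \<theta> w (\<lambda>k. U k i j) n = \<epsilon>\<^sup>2 * D (U n) - AC_f (U n i j)"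
    using be n ij by (auto simp: backward_euler_def D_def)
  finally have le: "discrete_caputo A E n
      \<le> s * (fast_L1 \<alpha> t Nq \<theta> w (\<lambda>k. u z (t k)) n - (\<epsilon>\<^sup>2 * D (U n) - AC_f (U n i j)))" .
  define Du where "Du = five_point (mesh_width a b M1) (mesh_width c d M2) (\<lambda>z. u z (t n)) z"
  have Du: "Du = D (\<lambda>i j. u (grid_point a b c d M1 M2 i j) (t n))"
    using discrete_laplacian_grid_function[OF M ij(1,2) per] by (simp add: Du_def D_def z_def)
  have "D (err n) = Du - D (U n)" unfolding Du D_def err_def by (rule discrete_laplacian_linear)
  moreover have "s * D (err n) \<le> 0" unfolding D_def
  proof (rule discrete_laplacian_max_le[OF M ij(1,2)])
    fix k l assume kl: "k < M1" "l < M2"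
    have "s * err n k l \<le> \<bar>s * err n k l\<bar>" by simp
    also have "\<dots> \<le> E n" using grid_norm_ge[OF kl, of "err n"] s(1) by (simp add: abs_mult E)
    finally show "s * err n k l \<le> s * err n i j" using s by simp
  qed
  ultimately have "s * (Du - D (U n)) \<le> 0" by simp
  then have lap: "\<epsilon>\<^sup>2 * (s * (Du - D (U n))) \<le> 0" by (simp add: mult_nonneg_nonpos)
  define r where "r = fast_L1 \<alpha> t Nq \<theta> w (\<lambda>k. u z (t k)) n - \<epsilon>\<^sup>2 * Du + AC_f (u z (t n))"
  have "\<bar>r\<bar> \<le> R" using res[OF ij(1,2)] by (simp add: residual_def r_def Du_def z_def)
  then have "s * r \<le> R" using s(1) by (auto simp: s_def abs_le_iff split: if_splits)
  moreover have "- (s * (AC_f (u z (t n)) - AC_f (U n i j))) \<le> E n"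
    using AC_f_one_sided_lipschitz[of s "u z (t n)" "U n i j"] s ij(3) by (simp add: err_def z_def)
  moreover have "s * (fast_L1 \<alpha> t Nq \<theta> w (\<lambda>k. u z (t k)) n - (\<epsilon>\<^sup>2 * D (U n) - AC_f (U n i j)))
      = s * r + \<epsilon>\<^sup>2 * (s * (Du - D (U n))) - s * (AC_f (u z (t n)) - AC_f (U n i j))"
    by (simp add: r_def algebra_simps)
  ultimately have "discrete_caputo A E n \<le> E n + R" using le lap by linarith
  then show ?thesis by (simp add: E_def)
qed

text \<open>The consistency errors in time and space add up to the residual of the exact solution; the
  equation itself is used at almost every point of the rectangle.\<close>

lemma residual_bound:
  fixes a b c d T \<alpha> \<epsilon> \<sigma> \<rho> C tol \<Delta>t :: real
  assumes ab: "a < b" "c < d" and \<sigma>: "0 < \<sigma>" "\<sigma> < 1" and C: "0 < C"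
    and sol: "allen_cahn_solution a b c d T \<alpha> \<epsilon> u0 u"
    and reg: "solution_regularity a b c d T \<sigma> C u"
    and fast: "fast_L1_mesh \<alpha> T \<rho> tol \<Delta>t N Nq t \<theta> w"
    and n: "n \<in> {1..N}" and h: "h1 \<noteq> 0" "h2 \<noteq> 0" and z: "z \<in> closure (rect a b c d)"
  shows "\<bar>residual \<alpha> \<epsilon> t Nq \<theta> w h1 h2 u n z\<bar>
    \<le> 3 * fast_kernel \<alpha> t Nq \<theta> w n 0 * interp_bounds C \<sigma> t n
      - 2 * discrete_caputo (fast_kernel \<alpha> t Nq \<theta> w) (interp_bounds C \<sigma> t) n
      + (9 * C * sing_primitive \<sigma> T * tol + \<epsilon>\<^sup>2 * ((C + 1) / 12 * (h1\<^sup>2 + h2\<^sup>2)))"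
proof -
  interpret fast_L1_mesh \<alpha> T \<rho> tol \<Delta>t N Nq t \<theta> w by fact
  have tn: "t n \<in> {0<..T}"
    using time_mesh_pos[OF mesh, of n] time_mesh_le_T[OF mesh, of n] n by auto
  have cont: "continuous_on (UNIV \<times> {0..T}) (\<lambda>(z, t). u z t)"
    using sol by (simp add: allen_cahn_solution_def)
  have cont_z: "continuous_on UNIV (\<lambda>z. u z r)" if "r \<in> {0..T}" for r
  proof -
    have 1: "continuous_on UNIV (\<lambda>z :: real \<times> real. (z, r))" by (intro continuous_intros)
    have 2: "range (\<lambda>z :: real \<times> real. (z, r)) \<subseteq> UNIV \<times> {0..T}" using that by auto
    show ?thesis using continuous_on_compose2[OF cont 1 2] by simp
  qed
  have cont_k: "continuous_on UNIV (\<lambda>z. u z (t k))" if "k \<le> N" for k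
    using time_mesh_nonneg[OF mesh that] time_mesh_le_T[OF mesh that] by (intro cont_z) auto
  have cont_shift: "continuous_on UNIV (\<lambda>z. u (z + y) (t n))" "continuous_on UNIV (\<lambda>z. u (z - y) (t n))" for y
    by (rule continuous_on_compose2[OF cont_k[of n]], use n in \<open>auto intro!: continuous_intros\<close>)+
  define Res where "Res = residual \<alpha> \<epsilon> t Nq \<theta> w h1 h2 u n"
  have Res_cont: "continuous_on UNIV Res"
    unfolding Res_def residual_def[abs_def] five_point_def fast_L1_def second_diff_def AC_f_def
    using n h by (intro continuous_intros cont_shift cont_k) auto
  obtain u' u'' where
    d1: "\<And>z t. z \<in> rect a b c d \<Longrightarrow> t \<in> {0<..T} \<Longrightarrow> (u z has_real_derivative u' z t) (at t within {0<..T})" and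
    d2: "\<And>z t. z \<in> rect a b c d \<Longrightarrow> t \<in> {0<..T} \<Longrightarrow> (u' z has_real_derivative u'' z t) (at t within {0<..T})" and
    b1: "\<And>t. t \<in> {0<..T} \<Longrightarrow> Linf_norm (rect a b c d) (\<lambda>z. u' z t) \<le> ereal (C * (1 + t powr (\<sigma> - 1)))" and
    b2: "\<And>t. t \<in> {0<..T} \<Longrightarrow> Linf_norm (rect a b c d) (\<lambda>z. u'' z t) \<le> ereal (C * (1 + t powr (\<sigma> - 2)))"
    using reg unfolding solution_regularity_def by blast
  define bd where "bd = 3 * A n 0 * interp_bounds C \<sigma> t n - 2 * discrete_caputo A (interp_bounds C \<sigma> t) n
      + (9 * C * sing_primitive \<sigma> T * tol + \<epsilon>\<^sup>2 * ((C + 1) / 12 * (h1\<^sup>2 + h2\<^sup>2)))"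
  have "AE z in lborel. z \<in> rect a b c d \<longrightarrow> weakly_singular_function T C \<sigma> (u z) (u' z)"
    using C by (intro AE_weakly_singular_function[OF \<sigma> _ cont d1 d2 b1 b2]) auto
  then have "AE z in lborel. z \<in> rect a b c d \<longrightarrow> \<bar>Res z\<bar> \<le> bd"
  proof eventually_elim
    case (elim z)
    show ?case
    proof
      assume z: "z \<in> rect a b c d"
      then have wsf: "weakly_singular_function T C \<sigma> (u z) (u' z)" using elim by simp
      have pde: "caputo \<alpha> (u z) (t n) = \<epsilon>\<^sup>2 * laplacian (\<lambda>z. u z (t n)) z - AC_f (u z (t n))"
        using sol z tn by (auto simp: allen_cahn_solution_def)
      define \<delta> where "\<delta> = five_point h1 h2 (\<lambda>z. u z (t n)) z - laplacian (\<lambda>z. u z (t n)) z"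
      have "\<bar>\<delta>\<bar> \<le> (C + 1) / 12 * (h1\<^sup>2 + h2\<^sup>2)" unfolding \<delta>_def using sol reg tn C n
        by (intro discrete_laplacian_consistency[OF ab _ _ _ _ _ z h] cont_k)
          (auto simp: allen_cahn_solution_def solution_regularity_def)
      then have "\<epsilon>\<^sup>2 * \<bar>\<delta>\<bar> \<le> \<epsilon>\<^sup>2 * ((C + 1) / 12 * (h1\<^sup>2 + h2\<^sup>2))" by (rule mult_left_mono) simp
      then have "\<bar>\<epsilon>\<^sup>2 * \<delta>\<bar> \<le> \<epsilon>\<^sup>2 * ((C + 1) / 12 * (h1\<^sup>2 + h2\<^sup>2))" by (simp add: abs_mult)
      moreover have "Res z = - (caputo \<alpha> (u z) (t n) - fast_L1 \<alpha> t Nq \<theta> w (\<lambda>k. u z (t k)) n) - \<epsilon>\<^sup>2 * \<delta>"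
        unfolding Res_def residual_def \<delta>_def pde by (simp add: algebra_simps)
      ultimately show "\<bar>Res z\<bar> \<le> bd"
        using fast_L1_consistency[OF wsf n] unfolding bd_def by linarith
    qed
  qed
  then have "\<bar>Res z\<bar> \<le> bd"
    using z by (intro AE_bound_extends_to_closure[OF Res_cont, of "rect a b c d"]) (auto simp: rect_def open_Times)
  then show ?thesis by (simp add: Res_def bd_def)
qed

section \<open>Error bounds\<close>

lemma mesh_term_ge:
  assumes "k \<in> {2..n}"
  shows "t k powr \<alpha> * t (k - 1) powr (\<sigma> - 2) * step t k powr (2 - \<alpha>) \<le> mesh_term \<alpha> \<sigma> t n"
  unfolding mesh_term_def using assms by (intro Max_ge) auto

lemma mesh_term_nonneg: "0 \<le> mesh_term \<alpha> \<sigma> t n"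
  unfolding mesh_term_def by (intro Max_ge) auto

text \<open>On the first step the interpolation error is bounded through the first derivative only;
  on the later steps the second derivative yields the terms of the maximum, times the factor
  \<open>t n powr (- \<alpha>)\<close> that the smallest weight of the kernel dominates.\<close>

lemma (in fast_L1_mesh) diag_interp_bounds_le:
  assumes \<sigma>: "0 < \<sigma>" "\<sigma> < 1" and C: "0 < C" and m: "m \<in> {1..N}" and n: "n \<in> {1..m}"
  shows "A n 0 * interp_bounds C \<sigma> t n \<le>
    (2 * C * (1 + 1 / \<sigma>) * step t 1 powr \<sigma>
      + 3 / 2 * Gamma (1 - \<alpha>) * C * (1 + T powr (2 - \<sigma>)) / Gamma (2 - \<alpha>) * mesh_term \<alpha> \<sigma> t m) * A n (n - 1)"
proof -
  define Q1 where "Q1 = 2 * C * (1 + 1 / \<sigma>) * step t 1 powr \<sigma>"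
  define c where "c = C * (1 + T powr (2 - \<sigma>)) / Gamma (2 - \<alpha>)"
  define Q2 where "Q2 = 3 / 2 * Gamma (1 - \<alpha>) * c * mesh_term \<alpha> \<sigma> t m"
  have nN: "n \<in> {1..N}" using n m by auto
  have c: "0 \<le> c" unfolding c_def using C G2 by (intro divide_nonneg_pos mult_nonneg_nonneg) auto
  have Q1: "0 \<le> Q1" unfolding Q1_def using C \<sigma> by (intro mult_nonneg_nonneg) auto
  have Q2: "0 \<le> Q2" unfolding Q2_def using c G1 mesh_term_nonneg by (intro mult_nonneg_nonneg) auto
  have A0: "0 < A n (n - 1)" using nN by (intro kernel_pos) auto
  have "A n 0 * interp_bounds C \<sigma> t n \<le> (Q1 + Q2) * A n (n - 1)"
  proof (cases "n = 1")
    case True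
    define s where "s = step t 1"
    have s: "0 < s" "s \<le> 1" "t 1 = s"
      using step_pos[of n] step_le_max_step[of n] max_step_le_1 nN True by (auto simp: s_def step_def t_0)
    have "s powr 1 \<le> s powr \<sigma>" using s \<sigma> by (intro powr_mono') auto
    then have "s + s powr \<sigma> / \<sigma> \<le> (1 + 1 / \<sigma>) * s powr \<sigma>" using s by (simp add: algebra_simps)
    then have "2 * C * (s + s powr \<sigma> / \<sigma>) \<le> 2 * C * ((1 + 1 / \<sigma>) * s powr \<sigma>)"
      using C by (intro mult_left_mono) auto
    moreover have "interp_bounds C \<sigma> t n = 2 * C * (s + s powr \<sigma> / \<sigma>)"
      using s(3) True by (simp add: interp_bounds_def interp_bound_def sing_primitive_def t_0)
    moreover have "Q1 = 2 * C * ((1 + 1 / \<sigma>) * s powr \<sigma>)" by (simp add: Q1_def s_def)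
    ultimately have "interp_bounds C \<sigma> t n \<le> Q1" by (simp only:)
    then have "interp_bounds C \<sigma> t n \<le> Q1 + Q2" using Q2 by simp
    then have "A n 0 * interp_bounds C \<sigma> t n \<le> A n 0 * (Q1 + Q2)"
      using kernel_diag[OF nN] by (intro mult_left_mono) auto
    then show ?thesis using True by (simp add: mult.commute)
  next
    case False
    define p where "p = t (n - 1)"
    define \<tau> where "\<tau> = step t n"
    have \<tau>: "0 < \<tau>" using step_pos[OF nN] by (simp add: \<tau>_def)
    have p: "0 < p" "p \<le> T"
      using time_mesh_pos[OF mesh, of "n - 1"] time_mesh_le_T[OF mesh, of "n - 1"] nN False by (auto simp: p_def)
    have tn: "0 < t n" using time_mesh_pos[OF mesh] nN by auto
    have "1 = p powr (2 - \<sigma>) * p powr (\<sigma> - 2)" using p by (simp flip: powr_add)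
    also have "\<dots> \<le> T powr (2 - \<sigma>) * p powr (\<sigma> - 2)"
      using p \<sigma> by (intro mult_right_mono powr_mono2) auto
    finally have one: "1 + p powr (\<sigma> - 2) \<le> (1 + T powr (2 - \<sigma>)) * p powr (\<sigma> - 2)" by (simp add: algebra_simps)
    have "interp_bounds C \<sigma> t n \<le> C * (1 + p powr (\<sigma> - 2)) * \<tau>\<^sup>2"
      using p False nN by (simp add: interp_bounds_def interp_bound_def p_def \<tau>_def step_def)
    also have "\<dots> \<le> C * ((1 + T powr (2 - \<sigma>)) * p powr (\<sigma> - 2)) * \<tau>\<^sup>2"
      using one C by (intro mult_right_mono mult_left_mono) auto
    finally have "A n 0 * interp_bounds C \<sigma> t n
        \<le> \<tau> powr (- \<alpha>) / Gamma (2 - \<alpha>) * (C * ((1 + T powr (2 - \<sigma>)) * p powr (\<sigma> - 2)) * \<tau>\<^sup>2)"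
      unfolding kernel_0[OF nN] \<tau>_def using G2 by (intro mult_left_mono) auto
    also have "\<dots> = c * (p powr (\<sigma> - 2) * (\<tau> powr (- \<alpha>) * \<tau>\<^sup>2))" by (simp add: c_def)
    also have "\<tau> powr (- \<alpha>) * \<tau>\<^sup>2 = \<tau> powr (2 - \<alpha>)"
    proof -
      have "\<tau>\<^sup>2 = \<tau> powr 2" using \<tau> by simp
      then show ?thesis by (simp only: flip: powr_add) simp
    qed
    also have "p powr (\<sigma> - 2) * \<tau> powr (2 - \<alpha>)
        = t n powr (- \<alpha>) * (t n powr \<alpha> * p powr (\<sigma> - 2) * \<tau> powr (2 - \<alpha>))"
      using tn by (simp add: powr_minus)
    also have "c * \<dots> \<le> c * (t n powr (- \<alpha>) * mesh_term \<alpha> \<sigma> t m)"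
      using mesh_term_ge[of n m t \<alpha> \<sigma>] n False c unfolding p_def \<tau>_def by (intro mult_left_mono) auto
    also have "\<dots> = Q2 * (2 / 3 * (t n powr (- \<alpha>) / Gamma (1 - \<alpha>)))"
      using less_imp_neq[OF G1] by (simp add: Q2_def)
    also have "\<dots> \<le> Q2 * A n (n - 1)" using kernel_last_ge[OF nN] Q2 by (intro mult_left_mono) auto
    also have "\<dots> \<le> (Q1 + Q2) * A n (n - 1)" using Q1 A0 by (intro mult_right_mono) auto
    finally show ?thesis .
  qed
  then show ?thesis by (simp add: Q1_def Q2_def c_def mult_ac)
qed

lemma discrete_setting_fast_L1_mesh:
  assumes "discrete_setting a b c d T \<alpha> \<epsilon> u0 \<rho> N t tol \<Delta>t Nq \<theta> w M1 M2 U" "0 < \<alpha>" "\<alpha> < 1"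
  shows "fast_L1_mesh \<alpha> T \<rho> tol \<Delta>t N Nq t \<theta> w"
  using assms unfolding discrete_setting_def by unfold_locales auto

text \<open>The stability estimate is applied to the maximum norms of the error, with the interpolation
  bounds as the part of the load that carries the memory and with the tolerance and the spatial
  error as the constant load. The constants of the two loads are separated in the result, because
  only the constant load profits from the factor \<open>t n powr \<alpha>\<close>.\<close>

lemma max_error_bound:
  fixes a b c d T \<alpha> \<epsilon> \<sigma> \<rho> C0 :: real
  assumes ab: "a < b" "c < d" and T: "0 < T" and alpha: "0 < \<alpha>" "\<alpha> < 1"
    and \<sigma>: "0 < \<sigma>" "\<sigma> < 1" and C0: "0 < C0"
    and sol: "allen_cahn_solution a b c d T \<alpha> \<epsilon> u0 u"
    and reg: "solution_regularity a b c d T \<sigma> C0 u"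
  shows "\<exists>C>0. \<forall>N t tol \<Delta>t Nq \<theta> w M1 M2 U n.
    discrete_setting a b c d T \<alpha> \<epsilon> u0 \<rho> N t tol \<Delta>t Nq \<theta> w M1 M2 U \<and> n \<in> {1..N} \<longrightarrow>
    max_error a b c d u t M1 M2 U n \<le> C * (step t 1 powr \<sigma> + mesh_term \<alpha> \<sigma> t n + tol * t n powr \<alpha>
      + ((mesh_width a b M1)\<^sup>2 + (mesh_width c d M2)\<^sup>2))"
proof -
  obtain S where S: "0 < S" and stable: "\<forall>A N t E G K Q m. caputo_kernel A N \<alpha> T \<rho> t \<and> m \<in> {1..N} \<and>
      E 0 = 0 \<and> G 0 = 0 \<and> 0 \<le> K \<and> 0 \<le> Q \<and>
      (\<forall>n\<in>{1..m}. 0 \<le> G n \<and> A n 0 * G n \<le> Q * A n (n - 1) \<and>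
         discrete_caputo A E n \<le> E n + 3 * A n 0 * G n - 2 * discrete_caputo A G n + K) \<longrightarrow>
      E m \<le> S * (Q + K * t m powr \<alpha>)"
    using discrete_stability[OF alpha T, of \<rho>] by (elim exE conjE) (rule that)
  define q1 where "q1 = 2 * C0 * (1 + 1 / \<sigma>)"
  define q2 where "q2 = 3 / 2 * Gamma (1 - \<alpha>) * C0 * (1 + T powr (2 - \<sigma>)) / Gamma (2 - \<alpha>)"
  define k1 where "k1 = 9 * C0 * sing_primitive \<sigma> T"
  define k2 where "k2 = \<epsilon>\<^sup>2 * ((C0 + 1) / 12)"
  have G: "0 < Gamma (1 - \<alpha>)" "0 < Gamma (2 - \<alpha>)" using alpha by (auto intro!: Gamma_real_pos)
  have q1: "0 \<le> q1" unfolding q1_def using C0 \<sigma> by (intro mult_nonneg_nonneg) auto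
  have q2: "0 \<le> q2" unfolding q2_def using C0 G by (intro divide_nonneg_pos mult_nonneg_nonneg) auto
  have k1: "0 \<le> k1" unfolding k1_def sing_primitive_def using C0 T \<sigma> by (intro mult_nonneg_nonneg) auto
  have k2: "0 \<le> k2" unfolding k2_def using C0 by simp
  define C where "C = S * (1 + q1 + q2 + k1 + k2 * T powr \<alpha>)"
  have Cpos: "0 < C" unfolding C_def using S q1 q2 k1 k2 by (intro mult_pos_pos add_pos_nonneg) auto
  have "max_error a b c d u t M1 M2 U n \<le> C * (step t 1 powr \<sigma> + mesh_term \<alpha> \<sigma> t n + tol * t n powr \<alpha>
      + ((mesh_width a b M1)\<^sup>2 + (mesh_width c d M2)\<^sup>2))"
    if set: "discrete_setting a b c d T \<alpha> \<epsilon> u0 \<rho> N t tol \<Delta>t Nq \<theta> w M1 M2 U" and n: "n \<in> {1..N}"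
    for N t tol \<Delta>t Nq \<theta> w M1 M2 U n
  proof -
    have fast: "fast_L1_mesh \<alpha> T \<rho> tol \<Delta>t N Nq t \<theta> w"
      by (rule discrete_setting_fast_L1_mesh[OF set alpha])
    interpret fast_L1_mesh \<alpha> T \<rho> tol \<Delta>t N Nq t \<theta> w by fact
    define h where "h = (mesh_width a b M1)\<^sup>2 + (mesh_width c d M2)\<^sup>2"
    define E where "E = max_error a b c d u t M1 M2 U"
    define Gk where "Gk = interp_bounds C0 \<sigma> t"
    define Q where "Q = q1 * step t 1 powr \<sigma> + q2 * mesh_term \<alpha> \<sigma> t n"
    define K where "K = k1 * tol + k2 * h"
    have M: "3 \<le> M1" "3 \<le> M2" and be: "backward_euler a b c d \<alpha> \<epsilon> u0 N t Nq \<theta> w M1 M2 U"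
      using set by (auto simp: discrete_setting_def)
    have hne: "mesh_width a b M1 \<noteq> 0" "mesh_width c d M2 \<noteq> 0"
      using M ab by (auto simp: mesh_width_def)
    have h0: "0 \<le> h" by (simp add: h_def)
    have Q0: "0 \<le> Q" unfolding Q_def using q1 q2 mesh_term_nonneg by (intro add_nonneg_nonneg mult_nonneg_nonneg) auto
    have K0: "0 \<le> K" unfolding K_def using k1 k2 h0 tol_pos by (intro add_nonneg_nonneg mult_nonneg_nonneg) auto
    have E0: "E 0 = 0"
    proof -
      obtain i j where "i < M1" "j < M2"
        "E 0 = \<bar>u (grid_point a b c d M1 M2 i j) (t 0) - U 0 i j\<bar>"
        using grid_norm_attained[of M1 M2 "\<lambda>i j. u (grid_point a b c d M1 M2 i j) (t 0) - U 0 i j"] M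
        by (auto simp: E_def max_error_def)
      moreover have "u z 0 = u0 z" for z using sol unfolding allen_cahn_solution_def by blast
      ultimately show ?thesis using be by (simp add: backward_euler_def t_0)
    qed
    have "E n \<le> S * (Q + K * t n powr \<alpha>)"
    proof (rule stable[rule_format, where A = A and N = N and G = Gk], intro conjI ballI n E0 K0 Q0)
      show "caputo_kernel A N \<alpha> T \<rho> t" by unfold_locales
      show "Gk 0 = 0" by (simp add: Gk_def interp_bounds_def)
      fix k assume k: "k \<in> {1..n}"
      then have kN: "k \<in> {1..N}" using n by auto
      have tk: "t k \<in> {0..T}" using time_mesh_nonneg[OF mesh, of k] time_mesh_le_T[OF mesh, of k] kN by auto
      have "0 \<le> Gk k" using interp_bounds_nonneg[OF \<sigma>(1), of C0 k] C0 kN by (simp add: Gk_def)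
      moreover have "A k 0 * Gk k \<le> Q * A k (k - 1)"
        using diag_interp_bounds_le[OF \<sigma> C0 n k] by (simp add: Gk_def Q_def q1_def q2_def)
      moreover have "discrete_caputo A E k
          \<le> E k + (3 * A k 0 * Gk k - 2 * discrete_caputo A Gk k + K)"
        unfolding E_def
      proof (rule error_inequality[OF fast M be _ kN])
        show "rect_periodic a b c d (\<lambda>z. u z (t k))" using sol tk by (auto simp: allen_cahn_solution_def)
        show "\<bar>residual \<alpha> \<epsilon> t Nq \<theta> w (mesh_width a b M1) (mesh_width c d M2) u k (grid_point a b c d M1 M2 i j)\<bar>
          \<le> 3 * A k 0 * Gk k - 2 * discrete_caputo A Gk k + K" if ij: "i < M1" "j < M2" for i j
          using residual_bound[OF ab \<sigma> C0 sol reg fast kN hne grid_point_in_closure[OF ab ij]]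
          by (simp add: Gk_def K_def k1_def k2_def h_def mult.assoc)
      qed
      ultimately show "0 \<le> Gk k" "A k 0 * Gk k \<le> Q * A k (k - 1)"
        "discrete_caputo A E k \<le> E k + 3 * A k 0 * Gk k - 2 * discrete_caputo A Gk k + K"
        by simp_all
    qed
    also have "\<dots> \<le> C * (step t 1 powr \<sigma> + mesh_term \<alpha> \<sigma> t n + tol * t n powr \<alpha> + h)"
    proof -
      define c where "c = 1 + q1 + q2 + k1 + k2 * T powr \<alpha>"
      have kT: "0 \<le> k2 * T powr \<alpha>" using k2 by simp
      have "Q + K * t n powr \<alpha>
          = q1 * step t 1 powr \<sigma> + q2 * mesh_term \<alpha> \<sigma> t n + k1 * (tol * t n powr \<alpha>) + k2 * t n powr \<alpha> * h"
        by (simp add: Q_def K_def algebra_simps)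
      also have "\<dots> \<le> c * step t 1 powr \<sigma> + c * mesh_term \<alpha> \<sigma> t n + c * (tol * t n powr \<alpha>) + c * h"
      proof (intro add_mono mult_right_mono)
        have "k2 * t n powr \<alpha> \<le> k2 * T powr \<alpha>"
          using time_mesh_nonneg[OF mesh, of n] time_mesh_le_T[OF mesh, of n] n alpha k2
          by (intro mult_left_mono powr_mono2) auto
        then show "k2 * t n powr \<alpha> \<le> c" using q1 q2 k1 by (simp add: c_def)
      qed (use q1 q2 k1 kT tol_pos h0 mesh_term_nonneg in \<open>auto simp: c_def\<close>)
      finally have "S * (Q + K * t n powr \<alpha>) \<le> S * (c * step t 1 powr \<sigma> + c * mesh_term \<alpha> \<sigma> t n
          + c * (tol * t n powr \<alpha>) + c * h)" using S by (intro mult_left_mono) auto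
      then show ?thesis by (simp add: C_def c_def[symmetric] distrib_left mult.assoc)
    qed
    finally show ?thesis by (simp add: E_def h_def)
  qed
  then show ?thesis using Cpos by blast
qed

text \<open>On the meshes of condition AssG, the exponent \<open>\<sigma> - \<beta> / \<gamma>\<close> of the nodes that is left after
  extracting \<open>\<tau> powr \<beta>\<close> is nonnegative, because \<open>\<beta> \<le> \<gamma> * \<sigma>\<close>.\<close>

lemma (in fast_L1_mesh) graded_mesh_bounds:
  assumes \<sigma>: "0 < \<sigma>" "\<sigma> < 1" and \<gamma>: "1 \<le> \<gamma>" and Cg: "0 < Cg" and G: "AssG \<gamma> Cg N t" and n: "n \<in> {1..N}"
  defines "\<beta> \<equiv> min (2 - \<alpha>) (\<gamma> * \<sigma>)"
  shows "step t 1 powr \<sigma> \<le> Cg powr (\<gamma> * \<sigma>) * max_step N t powr \<beta>"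
    and "mesh_term \<alpha> \<sigma> t n \<le> Cg powr (2 - \<sigma>) * Cg powr \<beta> * max 1 T powr \<sigma> * max_step N t powr \<beta>"
proof -
  define \<tau> where "\<tau> = max_step N t"
  have N: "1 \<in> {1..N}" using n by auto
  have \<tau>: "0 < \<tau>" "\<tau> \<le> 1"
    using step_pos[OF N] step_le_max_step[OF N] max_step_le_1 by (auto simp: \<tau>_def)
  have \<beta>: "0 < \<beta>" "\<beta> \<le> 2 - \<alpha>" "\<beta> \<le> \<gamma> * \<sigma>" using alpha \<gamma> \<sigma> by (auto simp: \<beta>_def)
  have grade: "step t k \<le> Cg * \<tau> * t k powr (1 - 1 / \<gamma>)" if "k \<in> {1..N}" for k
  proof -
    have "step t k \<le> Cg * \<tau> * min 1 (t k powr (1 - 1 / \<gamma>))" using G that by (simp add: AssG_def \<tau>_def)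
    also have "\<dots> \<le> Cg * \<tau> * t k powr (1 - 1 / \<gamma>)" using Cg \<tau> by (intro mult_left_mono) auto
    finally show ?thesis .
  qed
  define s where "s = step t 1"
  have s: "0 < s" "t 1 = s" using step_pos[OF N] by (auto simp: s_def step_def t_0)
  have "s powr (1 / \<gamma>) * s powr (1 - 1 / \<gamma>) = s" using s by (simp flip: powr_add)
  then have "s powr (1 / \<gamma>) * s powr (1 - 1 / \<gamma>) \<le> Cg * \<tau> * s powr (1 - 1 / \<gamma>)"
    using grade[OF N] s by (simp add: s_def)
  then have "s powr (1 / \<gamma>) \<le> Cg * \<tau>" using s by simp
  then have "(s powr (1 / \<gamma>)) powr (\<gamma> * \<sigma>) \<le> (Cg * \<tau>) powr (\<gamma> * \<sigma>)"
    using \<gamma> \<sigma> by (intro powr_mono2) auto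
  then have "s powr \<sigma> \<le> Cg powr (\<gamma> * \<sigma>) * \<tau> powr (\<gamma> * \<sigma>)"
    using \<gamma> Cg \<tau> by (simp add: powr_powr powr_mult)
  also have "\<dots> \<le> Cg powr (\<gamma> * \<sigma>) * \<tau> powr \<beta>" using \<tau> \<beta> by (intro mult_left_mono powr_mono') auto
  finally show "step t 1 powr \<sigma> \<le> Cg powr (\<gamma> * \<sigma>) * max_step N t powr \<beta>" by (simp add: s_def \<tau>_def)
  define B where "B = Cg powr (2 - \<sigma>) * Cg powr \<beta> * max 1 T powr \<sigma> * \<tau> powr \<beta>"
  have "t k powr \<alpha> * t (k - 1) powr (\<sigma> - 2) * step t k powr (2 - \<alpha>) \<le> B" if k: "k \<in> {2..n}" for k
  proof -
    define x where "x = t k"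
    have kN: "k \<in> {1..N}" using k n by auto
    have x: "0 < x" "x \<le> T"
      using time_mesh_pos[OF mesh, of k] time_mesh_le_T[OF mesh, of k] kN by (auto simp: x_def)
    have "x / Cg \<le> t (k - 1)" using G k n Cg by (auto simp: AssG_def x_def field_simps)
    then have "t (k - 1) powr (\<sigma> - 2) \<le> (x / Cg) powr (\<sigma> - 2)"
      using x Cg \<sigma> by (intro powr_mono2') auto
    also have "\<dots> = Cg powr (2 - \<sigma>) * x powr (\<sigma> - 2)"
      using x Cg powr_minus_divide[of Cg "\<sigma> - 2"] by (simp add: powr_divide)
    finally have 1: "t (k - 1) powr (\<sigma> - 2) \<le> Cg powr (2 - \<sigma>) * x powr (\<sigma> - 2)" .
    have sk: "0 < step t k" "step t k \<le> x"
      using step_pos[OF kN] time_mesh_nonneg[OF mesh, of "k - 1"] kN by (auto simp: step_def x_def)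
    have "step t k powr (2 - \<alpha>) = step t k powr (2 - \<alpha> - \<beta>) * step t k powr \<beta>"
      by (simp flip: powr_add)
    also have "\<dots> \<le> x powr (2 - \<alpha> - \<beta>) * (Cg * \<tau> * x powr (1 - 1 / \<gamma>)) powr \<beta>"
      using sk \<beta> grade[OF kN] by (intro mult_mono powr_mono2) (auto simp: x_def)
    also have "\<dots> = x powr (2 - \<alpha> - \<beta>) * (Cg powr \<beta> * \<tau> powr \<beta> * x powr ((1 - 1 / \<gamma>) * \<beta>))"
      using Cg \<tau> x by (simp add: powr_mult powr_powr)
    finally have 2: "step t k powr (2 - \<alpha>)
        \<le> x powr (2 - \<alpha> - \<beta>) * (Cg powr \<beta> * \<tau> powr \<beta> * x powr ((1 - 1 / \<gamma>) * \<beta>))" .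
    have "x powr \<alpha> * t (k - 1) powr (\<sigma> - 2) * step t k powr (2 - \<alpha>)
        \<le> x powr \<alpha> * (Cg powr (2 - \<sigma>) * x powr (\<sigma> - 2))
          * (x powr (2 - \<alpha> - \<beta>) * (Cg powr \<beta> * \<tau> powr \<beta> * x powr ((1 - 1 / \<gamma>) * \<beta>)))"
      by (intro mult_mono 1 2) auto
    also have "\<dots> = Cg powr (2 - \<sigma>) * Cg powr \<beta> * \<tau> powr \<beta>
        * (x powr \<alpha> * x powr (\<sigma> - 2) * x powr (2 - \<alpha> - \<beta>) * x powr ((1 - 1 / \<gamma>) * \<beta>))"
      by (simp only: mult_ac)
    also have "x powr \<alpha> * x powr (\<sigma> - 2) * x powr (2 - \<alpha> - \<beta>) * x powr ((1 - 1 / \<gamma>) * \<beta>) = x powr (\<sigma> - \<beta> / \<gamma>)"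
      by (simp add: algebra_simps flip: powr_add)
    also have "x powr (\<sigma> - \<beta> / \<gamma>) \<le> max 1 T powr \<sigma>"
    proof -
      have "0 \<le> \<sigma> - \<beta> / \<gamma>" using \<beta> \<gamma> by (simp add: field_simps)
      then have "x powr (\<sigma> - \<beta> / \<gamma>) \<le> max 1 T powr (\<sigma> - \<beta> / \<gamma>)" using x by (intro powr_mono2) auto
      also have "\<dots> \<le> max 1 T powr \<sigma>" using \<beta> \<gamma> by (intro powr_mono) auto
      finally show ?thesis .
    qed
    finally show ?thesis using Cg \<tau> by (simp add: x_def B_def mult_left_mono mult_ac)
  qed
  moreover have "0 \<le> B" unfolding B_def by simp
  ultimately have "mesh_term \<alpha> \<sigma> t n \<le> B" unfolding mesh_term_def by (subst Max_le_iff) auto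
  then show "mesh_term \<alpha> \<sigma> t n \<le> Cg powr (2 - \<sigma>) * Cg powr \<beta> * max 1 T powr \<sigma> * max_step N t powr \<beta>"
    by (simp add: B_def \<tau>_def)
qed

theorem theorem3p1:
  fixes a b c d T \<alpha> \<epsilon> \<sigma> \<rho> C0 :: real
    and u0 :: "real \<times> real \<Rightarrow> real"
    and u :: "real \<times> real \<Rightarrow> real \<Rightarrow> real"
  assumes "a < b" and "c < d" and "0 < T"
    and "0 < \<alpha>" and "\<alpha> < 1" and "0 < \<epsilon>"
    and "0 < \<sigma>" and "\<sigma> < 1" and "0 < C0"
    and sol: "allen_cahn_solution a b c d T \<alpha> \<epsilon> u0 u"
    and init: "Linf_norm (rect a b c d) u0 \<le> 1"
    and reg: "solution_regularity a b c d T \<sigma> C0 u"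
  shows
    "(\<exists>C>0. \<forall>N t tol \<Delta>t Nq \<theta> w M1 M2 U.
        discrete_setting a b c d T \<alpha> \<epsilon> u0 \<rho> N t tol \<Delta>t Nq \<theta> w M1 M2 U \<longrightarrow>
        (\<forall>n\<in>{1..N}.
           max_error a b c d u t M1 M2 U n
           \<le> C * (step t 1 powr \<sigma> / \<sigma> + 1 / (1 - \<alpha>) * mesh_term \<alpha> \<sigma> t n
                  + tol / \<sigma> * t n powr \<alpha> * (max 1 (t (n - 1)))\<^sup>2
                  + (mesh_width a b M1)\<^sup>2 + (mesh_width c d M2)\<^sup>2))) \<and>
     (\<forall>\<gamma> C\<^sub>\<gamma>. 1 \<le> \<gamma> \<and> 0 < C\<^sub>\<gamma> \<longrightarrow>
       (\<exists>C>0. \<forall>N t tol \<Delta>t Nq \<theta> w M1 M2 U.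
          discrete_setting a b c d T \<alpha> \<epsilon> u0 \<rho> N t tol \<Delta>t Nq \<theta> w M1 M2 U \<and> AssG \<gamma> C\<^sub>\<gamma> N t \<longrightarrow>
          (\<forall>n\<in>{1..N}.
             max_error a b c d u t M1 M2 U n
             \<le> C / (\<sigma> * (1 - \<alpha>)) * (max_step N t powr min (2 - \<alpha>) (\<gamma> * \<sigma>) + tol)
                + C * ((mesh_width a b M1)\<^sup>2 + (mesh_width c d M2)\<^sup>2) \<and>
             (max 1 ((2 - \<alpha>) / \<sigma>) \<le> \<gamma> \<longrightarrow>
                max_error a b c d u t M1 M2 U n
                \<le> C / (\<sigma> * (1 - \<alpha>)) * (max_step N t powr (2 - \<alpha>) + tol)
                   + C * ((mesh_width a b M1)\<^sup>2 + (mesh_width c d M2)\<^sup>2)))))"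
proof -
  have ab: "a < b" "c < d" and T: "0 < T" and alpha: "0 < \<alpha>" "\<alpha> < 1"
    and \<sigma>: "0 < \<sigma>" "\<sigma> < 1" and C0: "0 < C0" by fact+
  let ?D = "discrete_setting a b c d T \<alpha> \<epsilon> u0 \<rho>"
  let ?e = "max_error a b c d u"
  let ?h = "\<lambda>M1 M2. (mesh_width a b M1)\<^sup>2 + (mesh_width c d M2)\<^sup>2"
  obtain C where C: "0 < C" and bound: "\<forall>N t tol \<Delta>t Nq \<theta> w M1 M2 U n.
    ?D N t tol \<Delta>t Nq \<theta> w M1 M2 U \<and> n \<in> {1..N} \<longrightarrow>
    ?e t M1 M2 U n \<le> C * (step t 1 powr \<sigma> + mesh_term \<alpha> \<sigma> t n + tol * t n powr \<alpha> + ?h M1 M2)"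
    using max_error_bound[OF ab T alpha \<sigma> C0 sol reg, of \<rho>] by (elim exE conjE) (rule that)
  have inv: "x \<le> x / r" if "0 \<le> x" "0 < r" "r \<le> 1" for x r :: real
    using that mult_left_mono[of r 1 x] by (simp add: field_simps)
  have general: "?e t M1 M2 U n
      \<le> C * (step t 1 powr \<sigma> / \<sigma> + 1 / (1 - \<alpha>) * mesh_term \<alpha> \<sigma> t n
             + tol / \<sigma> * t n powr \<alpha> * (max 1 (t (n - 1)))\<^sup>2
             + (mesh_width a b M1)\<^sup>2 + (mesh_width c d M2)\<^sup>2)" (is "_ \<le> ?rhs")
    if set: "?D N t tol \<Delta>t Nq \<theta> w M1 M2 U" and n: "n \<in> {1..N}" for N t tol \<Delta>t Nq \<theta> w M1 M2 U n
  proof -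
    interpret fast_L1_mesh \<alpha> T \<rho> tol \<Delta>t N Nq t \<theta> w
      by (rule discrete_setting_fast_L1_mesh[OF set alpha])
    have "step t 1 powr \<sigma> \<le> step t 1 powr \<sigma> / \<sigma>" using \<sigma> by (intro inv) auto
    moreover have "mesh_term \<alpha> \<sigma> t n \<le> 1 / (1 - \<alpha>) * mesh_term \<alpha> \<sigma> t n"
      using inv[of "mesh_term \<alpha> \<sigma> t n" "1 - \<alpha>"] mesh_term_nonneg alpha by simp
    moreover have "tol * t n powr \<alpha> * 1 \<le> tol / \<sigma> * t n powr \<alpha> * (max 1 (t (n - 1)))\<^sup>2"
      using inv[of tol \<sigma>] tol_pos \<sigma> by (intro mult_mono mult_right_mono) (auto intro: one_le_power)
    ultimately have "C * (step t 1 powr \<sigma> + mesh_term \<alpha> \<sigma> t n + tol * t n powr \<alpha> + ?h M1 M2) \<le> ?rhs"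
      using C by (intro mult_left_mono) auto
    with bound[rule_format, OF conjI[OF set n]] show ?thesis by (rule order_trans)
  qed
  have graded: "\<exists>C>0. \<forall>N t tol \<Delta>t Nq \<theta> w M1 M2 U. ?D N t tol \<Delta>t Nq \<theta> w M1 M2 U \<and> AssG \<gamma> C\<^sub>\<gamma> N t \<longrightarrow>
      (\<forall>n\<in>{1..N}.
         ?e t M1 M2 U n \<le> C / (\<sigma> * (1 - \<alpha>)) * (max_step N t powr min (2 - \<alpha>) (\<gamma> * \<sigma>) + tol) + C * ?h M1 M2 \<and>
         (max 1 ((2 - \<alpha>) / \<sigma>) \<le> \<gamma> \<longrightarrow>
            ?e t M1 M2 U n \<le> C / (\<sigma> * (1 - \<alpha>)) * (max_step N t powr (2 - \<alpha>) + tol) + C * ?h M1 M2))"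
    if \<gamma>: "1 \<le> \<gamma> \<and> 0 < C\<^sub>\<gamma>" for \<gamma> C\<^sub>\<gamma>
  proof -
    define \<beta> where "\<beta> = min (2 - \<alpha>) (\<gamma> * \<sigma>)"
    define m1 where "m1 = C\<^sub>\<gamma> powr (\<gamma> * \<sigma>)"
    define m2 where "m2 = C\<^sub>\<gamma> powr (2 - \<sigma>) * C\<^sub>\<gamma> powr \<beta> * max 1 T powr \<sigma>"
    define C' where "C' = C * (1 + m1 + m2 + T powr \<alpha>)"
    have m: "0 \<le> m1" "0 \<le> m2" "0 \<le> T powr \<alpha>" by (auto simp: m1_def m2_def)
    have C': "0 < C'" unfolding C'_def using m by (intro mult_pos_pos C) linarith
    have parts: "C * (m1 + m2) \<le> C'" "C * T powr \<alpha> \<le> C'" "C \<le> C'"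
      unfolding C'_def using C m by (auto simp: algebra_simps intro: add_nonneg_nonneg)
    have le: "?e t M1 M2 U n \<le> C' / (\<sigma> * (1 - \<alpha>)) * (max_step N t powr \<beta> + tol) + C' * ?h M1 M2"
      if set: "?D N t tol \<Delta>t Nq \<theta> w M1 M2 U \<and> AssG \<gamma> C\<^sub>\<gamma> N t" and n: "n \<in> {1..N}"
      for N t tol \<Delta>t Nq \<theta> w M1 M2 U n
    proof -
      interpret fast_L1_mesh \<alpha> T \<rho> tol \<Delta>t N Nq t \<theta> w
        using set by (intro discrete_setting_fast_L1_mesh[OF _ alpha]) auto
      define h where "h = ?h M1 M2"
      define x where "x = max_step N t powr \<beta>"
      have x: "0 \<le> x" "0 \<le> h" by (auto simp: x_def h_def)
      have "tol * t n powr \<alpha> \<le> tol * T powr \<alpha>"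
        using time_mesh_nonneg[OF mesh, of n] time_mesh_le_T[OF mesh, of n] n alpha tol_pos
        by (intro mult_left_mono powr_mono2) auto
      moreover have "step t 1 powr \<sigma> \<le> m1 * x" "mesh_term \<alpha> \<sigma> t n \<le> m2 * x"
        using graded_mesh_bounds[OF \<sigma> _ _ _ n, of \<gamma> C\<^sub>\<gamma>] \<gamma> set
        by (simp_all add: m1_def m2_def x_def \<beta>_def)
      ultimately have "C * (step t 1 powr \<sigma> + mesh_term \<alpha> \<sigma> t n + tol * t n powr \<alpha> + h)
          \<le> C * (m1 * x + m2 * x + tol * T powr \<alpha> + h)"
        using C by (intro mult_left_mono) auto
      also have "\<dots> = C * (m1 + m2) * x + C * T powr \<alpha> * tol + C * h" by (simp add: algebra_simps)
      also have "\<dots> \<le> C' * x + C' * tol + C' * h"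
        using x tol_pos parts by (intro add_mono mult_right_mono) auto
      also have "\<dots> = C' * (x + tol) + C' * h" by (simp add: distrib_left)
      also have "\<dots> \<le> C' / (\<sigma> * (1 - \<alpha>)) * (x + tol) + C' * h"
        using \<sigma> alpha C' x tol_pos by (intro add_right_mono mult_right_mono inv mult_le_one) auto
      finally show ?thesis
        using bound[rule_format, of N t tol \<Delta>t Nq \<theta> w M1 M2 U n] set n by (simp add: h_def x_def)
    qed
    have opt: "\<beta> = 2 - \<alpha>" if "max 1 ((2 - \<alpha>) / \<sigma>) \<le> \<gamma>"
      using that \<sigma> by (simp add: \<beta>_def pos_divide_le_eq)
    show ?thesis
      apply (intro exI[of _ C'] conjI C' allI impI ballI)
      subgoal premises p using le[OF p, unfolded \<beta>_def] .
      subgoal premises p using le[OF p(1,2), unfolded opt[OF p(3)]] .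
      done
  qed
  show ?thesis
    by (intro conjI allI impI) (intro exI[of _ C] conjI allI impI ballI C general, assumption+, rule graded)
qed

end
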